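(* Let $\mathcal A,\mathcal B\subset\mathbb Z_{\mathbf M}$ be alphabets with limiting Cantor sets (Bedford–McMullen carpets) $\mathbf X,\mathbf Y$. Suppose that $\mathcal A$ has no full row and $\mathcal B$ has no full column. Then there exist $\beta>0$ and $C>0$, independent of $h\in(0,1)$, such that for all $h\in(0,1)$ $$\|\mathbf 1_{\mathbf Y+[-h,h]\times[-h^\alpha,h^\alpha]}\,\mathcal F_h^{\mathrm{ani}}\,\mathbf 1_{\mathrm{Ref}(\mathbf X+[-h,h]\times[-h^\alpha,h^\alpha])}\|_{L^2(\mathbb R^2)\to L^2(\mathbb R^2)}\le Ch^\beta,$$ where $\mathrm{Ref}:\mathbb R^2\to\mathbb R^2$ is the reflection $(x,y)\mapsto(y,x)$.
   Context: Let $\mathbf M=(M_1,M_2)\in\mathbb N^2$ with $M_1>M_2\ge2$, $\alpha=\log M_2/\log M_1\in(0,1)$, and $\mathbb Z_{\mathbf M}=\{0,\dots,M_1-1\}\times\{0,\dots,M_2-1\}$. An alphabet is a nonempty subset of $\mathbb Z_{\mathbf M}$; a row is obtained by fixing the second coordinate and a column by fixing the first; an alphabet has a full row (column) if it contains all elements of $\mathbb Z_{\mathbf M}$ in some row (column). The limiting Cantor set of $\mathcal A$, regarded as a compact subset of $[0,1]^2\subset\mathbb R^2$, is $$\mathbf X=\Big\{\Big(\sum_{j\ge1}a_jM_1^{-j},\sum_{j\ge1}b_jM_2^{-j}\Big):(a_j,b_j)\in\mathcal A\text{ for all }j\Big\};$$ $\mathbf Y$ is defined in the same way from $\mathcal B$.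 $\mathbf 1_E$ is multiplication by the indicator function of $E$, and $\mathcal F_h^{\mathrm{ani}}$ is the anisotropic semiclassical Fourier transform $$\mathcal F_h^{\mathrm{ani}}f(\xi,\eta)=\frac1{h^{(1+\alpha)/2}}\int_{\mathbb R^2}e^{-2\pi i(x\xi/h+y\eta/h^\alpha)}f(x,y)\,dx\,dy.$$ *)

theory Defs
  imports "HOL-Analysis.Analysis" "HOL-Library.Set_Algebras"
begin

definition ZM :: "nat \<Rightarrow> nat \<Rightarrow> (nat \<times> nat) set" where
  "ZM M1 M2 = {0..<M1} \<times> {0..<M2}"

definition is_alphabet :: "nat \<Rightarrow> nat \<Rightarrow> (nat \<times> nat) set \<Rightarrow> bool" where
  "is_alphabet M1 M2 A \<longleftrightarrow> A \<noteq> {} \<and> A \<subseteq> ZM M1 M2"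

definition has_full_row :: "nat \<Rightarrow> nat \<Rightarrow> (nat \<times> nat) set \<Rightarrow> bool" where
  "has_full_row M1 M2 A \<longleftrightarrow> (\<exists>b\<in>{0..<M2}. \<forall>a\<in>{0..<M1}. (a, b) \<in> A)"

definition has_full_column :: "nat \<Rightarrow> nat \<Rightarrow> (nat \<times> nat) set \<Rightarrow> bool" where
  "has_full_column M1 M2 A \<longleftrightarrow> (\<exists>a\<in>{0..<M1}. \<forall>b\<in>{0..<M2}. (a, b) \<in> A)"

definition ani_exponent :: "nat \<Rightarrow> nat \<Rightarrow> real" where
  "ani_exponent M1 M2 = ln (real M2) / ln (real M1)"

text \<open>Digit sequences are indexed from \<open>0\<close>, so the digit \<open>c j\<close> carries the weight of base
  to the power \<open>-(j + 1)\<close>.\<close>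

definition limit_Cantor_set :: "nat \<Rightarrow> nat \<Rightarrow> (nat \<times> nat) set \<Rightarrow> (real \<times> real) set" where
  "limit_Cantor_set M1 M2 A =
     {((\<Sum>j. real (fst (c j)) / real M1 ^ Suc j), (\<Sum>j. real (snd (c j)) / real M2 ^ Suc j))
      | c :: nat \<Rightarrow> nat \<times> nat. \<forall>j. c j \<in> A}"

definition ani_box :: "real \<Rightarrow> real \<Rightarrow> (real \<times> real) set" where
  "ani_box \<alpha> h = {-h..h} \<times> {-(h powr \<alpha>)..h powr \<alpha>}"

definition Ref :: "real \<times> real \<Rightarrow> real \<times> real" where
  "Ref p = (snd p, fst p)"

definition ind_mult :: "(real \<times> real) set \<Rightarrow> (real \<times> real \<Rightarrow> complex) \<Rightarrow> real \<times> real \<Rightarrow> complex" where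
  "ind_mult E f = (\<lambda>p. indicator E p * f p)"

text \<open>The Fourier transform is given by its integral, which is the Bochner integral with value
  \<open>0\<close> on non-integrable functions. It agrees with the \<open>L\<^sup>2\<close> transform on square-integrable
  functions that are also integrable, in particular on those vanishing outside a bounded set.\<close>

definition ani_fourier ::
    "real \<Rightarrow> real \<Rightarrow> (real \<times> real \<Rightarrow> complex) \<Rightarrow> real \<times> real \<Rightarrow> complex" where
  "ani_fourier \<alpha> h f = (\<lambda>(\<xi>, \<eta>).
     of_real (1 / h powr ((1 + \<alpha>) / 2)) *
     (LINT (x, y)|lborel.
        exp (- 2 * of_real pi * \<i> * of_real (x * \<xi> / h + y * \<eta> / h powr \<alpha>)) * f (x, y)))"

text \<open>Elements of \<open>L\<^sup>2\<close> are represented by Borel measurable functions; every class has such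
  a representative.\<close>

definition L2 :: "(real \<times> real \<Rightarrow> complex) set" where
  "L2 = {f \<in> borel_measurable lborel. integrable lborel (\<lambda>p. (cmod (f p))\<^sup>2)}"

definition L2_norm :: "(real \<times> real \<Rightarrow> complex) \<Rightarrow> real" where
  "L2_norm f = sqrt (LINT p|lborel. (cmod (f p))\<^sup>2)"

text \<open>The operator norm is taken in \<^typ>\<open>ennreal\<close>, so that it is \<open>\<infinity>\<close> if \<open>T\<close> does not map
  \<open>L\<^sup>2\<close> boundedly into itself.\<close>

definition L2_opnorm :: "((real \<times> real \<Rightarrow> complex) \<Rightarrow> real \<times> real \<Rightarrow> complex) \<Rightarrow> ennreal" where
  "L2_opnorm T =
     Inf {ennreal c | c. 0 \<le> c \<and> (\<forall>f\<in>L2. T f \<in> L2 \<and> L2_norm (T f) \<le> c * L2_norm f)}"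

end

theory Submission
  imports Defs
begin

text \<open>
  Let \<open>h = M1\<^sup>-\<^sup>L\<close> with \<open>L > 0\<close>, so that \<open>H = h powr \<alpha> = M2\<^sup>-\<^sup>L\<close>. A function \<open>f\<close> that lives near
  the reflected carpet depends on \<open>(x, y)\<close>, where \<open>x\<close> is known at scale \<open>H\<close> and is paired with \<open>\<xi> / h\<close>,
  and \<open>y\<close> is known at scale \<open>h\<close> and is paired with \<open>\<eta> / H\<close>. That \<open>A\<close> has no full row means that, once
  the \<open>M2\<close>-adic digits of \<open>x\<close> are fixed, \<open>y\<close> avoids one \<open>M1\<close>-adic digit at every level. That \<open>B\<close> has no
  full column means that, once the \<open>M1\<close>-adic digits of \<open>\<xi>\<close> are fixed, \<open>\<eta>\<close> avoids one \<open>M2\<close>-adic digit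
  at every level. Over a strip in \<open>x\<close> and a strip in \<open>\<xi>\<close> there remains an uncertainty principle in
  dimension one, between \<open>y\<close> and \<open>\<eta>\<close>.

  In dimension one (\<open>Cantor_FUP_one_dim\<close>), if \<open>\<sigma> y / H\<close> stays away from an arc modulo \<open>1\<close>, then a
  trigonometric polynomial \<open>m\<close> that is concentrated on the arc makes \<open>m f\<close> small, and its
  coefficients \<open>u\<close> give an almost linear relation between the values of the transform of \<open>f\<close> at the
  points \<open>\<eta> + t \<sigma>\<close> with \<open>\<bar>t\<bar> \<le> D\<close>. Let \<open>D = M2^s\<close>, and let \<open>\<sigma>\<close> be close to an \<open>M2\<close>-adic scale.
  By the missing digits only \<open>O((M2-1)^s)\<close> of these points lie in the Cantor set \<open>Q\<close>, far fewer than
  \<open>D\<close>, so \<open>u\<close> can be made to vanish at all of them except \<open>t = 0\<close> (\<open>norm_FT_interpolation\<close>). Thus the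
  transform on \<open>Q\<close> is controlled by the transform off \<open>Q\<close>, and a fixed proportion of its mass near \<open>Q\<close>
  is lost by restriction to \<open>Q\<close> (\<open>FUP_step\<close>). The two Cantor sets have different bases, so their
  levels cannot be matched exactly; instead \<open>y\<close> enters through a single level and \<open>Q\<close> through a count that is invariant
  under translation. One step replaces \<open>Q\<close> by its \<open>D \<sigma>\<close>-neighbourhood, which is negligible at the later,
  much larger spacings; so the steps can be iterated over \<open>K\<close> spacings in geometric progression
  (\<open>FUP_iterate\<close>), with a total gain \<open>\<rho>^K\<close>.

  Strips of widths \<open>M2\<^sup>-\<^sup>j\<^sup>0\<close> in \<open>x\<close> and \<open>M1\<^sup>-\<^sup>i\<^sup>0\<close> in \<open>\<xi>\<close> can be treated separately if the product of the
  widths is at least \<open>h\<close> (\<open>FUP_glue_strips\<close>): on a strip in \<open>\<xi>\<close> the transform in \<open>x\<close> is recovered from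
  its averages over windows which are no longer than the strips in \<open>x\<close>.

  It remains to find the scales (\<open>scale_exponents\<close>). The levels of \<open>y\<close> that \<open>\<eta>\<close> can see are those up to
  \<open>\<alpha> L\<close>, so \<open>j0 = \<alpha> L\<close> digits of \<open>x\<close> have to be fixed, and the product condition leaves \<open>i0 = (1 - \<alpha>\<^sup>2) L\<close> digits of
  \<open>\<xi>\<close>. Level \<open>j\<close> of \<open>y\<close> corresponds to level \<open>L - j / \<alpha>\<close> of \<open>\<eta>\<close>, which is below \<open>i0\<close> iff \<open>j \<ge> \<alpha>^3 L\<close>.
  Since \<open>\<alpha> < 1\<close>, there are \<open>(\<alpha> - \<alpha>^3) L\<close> usable levels, so that \<open>K\<close> is comparable to \<open>L\<close> and
  \<open>\<rho>^K\<close> is a positive power of \<open>h\<close>.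
\<close>

section \<open>Exponentials, test functions and Bessel's inequality\<close>

definition ee :: "real \<Rightarrow> complex" where
  "ee x = cis (2 * pi * x)"

lemma norm_ee [simp]: "norm (ee x) = 1"
  by (simp add: ee_def)

lemma ee_0 [simp]: "ee 0 = 1"
  by (simp add: ee_def)

lemma ee_add: "ee (x + y) = ee x * ee y"
  by (simp add: ee_def cis_mult algebra_simps)

lemma ee_diff: "ee (x - y) = ee x * ee (- y)"
  using ee_add[of x "-y"] by simp

lemma cnj_ee: "cnj (ee x) = ee (- x)"
  by (simp add: ee_def cis_cnj)

lemma ee_power: "ee x ^ n = ee (real n * x)"
  by (simp add: ee_def Complex.DeMoivre algebra_simps)

lemma continuous_ee [continuous_intros]:
  "continuous_on A f \<Longrightarrow> continuous_on A (\<lambda>x. ee (f x))"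
  unfolding ee_def by (intro continuous_intros)

lemma measurable_ee [measurable]: "ee \<in> borel_measurable borel"
  by (intro borel_measurable_continuous_onI continuous_intros)

lemma measurable_cnj [measurable]: "cnj \<in> borel_measurable borel"
  by (intro borel_measurable_continuous_onI continuous_intros)

text \<open>For bounded functions with bounded support every integral below converges absolutely and
  Fubini's theorem applies freely; \<open>L2_bound_by_truncation\<close> passes from them to all of \<open>L2\<close>.\<close>

definition test_fun :: "('a::euclidean_space \<Rightarrow> complex) \<Rightarrow> bool" where
  "test_fun f \<longleftrightarrow> f \<in> borel_measurable borel \<and>
     (\<exists>B. \<forall>x. norm (f x) \<le> B) \<and> (\<exists>R. \<forall>x. R < norm x \<longrightarrow> f x = 0)"

lemma test_funI:
  assumes "f \<in> borel_measurable borel" "\<And>x. norm (f x) \<le> B" "\<And>x. R < norm x \<Longrightarrow> f x = 0"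
  shows "test_fun f"
  using assms unfolding test_fun_def by blast

lemma test_fun_measurable [measurable_dest]: "test_fun f \<Longrightarrow> f \<in> borel_measurable borel"
  by (simp add: test_fun_def)

lemma test_fun_integrable:
  assumes "test_fun f" shows "integrable lborel f"
proof -
  obtain B R where f: "f \<in> borel_measurable borel" and B: "\<And>x. norm (f x) \<le> B"
    and R: "\<And>x. R < norm x \<Longrightarrow> f x = 0" using assms unfolding test_fun_def by blast
  show ?thesis
  proof (rule integrableI_bounded_set[where A="cball 0 R" and B=B])
    show "cball (0::'a) R \<in> sets lborel" by simp
    show "emeasure lborel (cball (0::'a) R) < \<infinity>"
      using emeasure_bounded_finite by blast
    show "AE x\<in>cball (0::'a) R in lborel. norm (f x) \<le> B" using B by simp
    show "AE x in lborel. x \<notin> cball (0::'a) R \<longrightarrow> f x = 0" using R by (auto simp: not_le)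
  qed (use f in auto)
qed

lemma test_fun_mult:
  assumes "test_fun f" "g \<in> borel_measurable borel" "\<And>x. norm (g x) \<le> C"
  shows "test_fun (\<lambda>x. g x * f x)"
proof -
  obtain B R where f: "f \<in> borel_measurable borel" and B: "\<And>x. norm (f x) \<le> B"
    and R: "\<And>x. R < norm x \<Longrightarrow> f x = 0" using assms unfolding test_fun_def by blast
  have "norm (g x * f x) \<le> C * B" for x
    unfolding norm_mult by (intro mult_mono assms(3) B) (auto intro: order_trans[OF norm_ge_zero assms(3)])
  then show ?thesis
    by (intro test_funI[where B="C*B" and R=R]) (use f assms(2) R in auto)
qed

lemma test_fun_mult_cnj:
  assumes f: "test_fun f" and g: "test_fun g" shows "test_fun (\<lambda>x. f x * cnj (g x))"
proof -
  obtain B where "\<And>x. norm (g x) \<le> B" using g unfolding test_fun_def by blast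
  then have "test_fun (\<lambda>x. cnj (g x) * f x)"
    using test_fun_measurable[OF g] by (intro test_fun_mult[OF f, where C=B]) auto
  then show ?thesis by (simp add: mult.commute)
qed

lemma test_fun_norm2_integrable:
  assumes "test_fun f" shows "integrable lborel (\<lambda>x. (norm (f x))\<^sup>2)"
  using integrable_norm[OF test_fun_integrable[OF test_fun_mult_cnj[OF assms assms]]]
  by (simp add: norm_mult power2_eq_square)

lemma test_fun_ee_mult:
  assumes "test_fun f" "g \<in> borel_measurable borel"
  shows "test_fun (\<lambda>x. ee (g x) * f x)"
  by (rule test_fun_mult[OF assms(1), where C=1]) (use assms(2) in auto)

abbreviation esq :: "complex \<Rightarrow> ennreal" where
  "esq z \<equiv> ennreal ((norm z)\<^sup>2)"

abbreviation mass_on :: "'a::euclidean_space set \<Rightarrow> ('a \<Rightarrow> complex) \<Rightarrow> ennreal" where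
  "mass_on E f \<equiv> (\<integral>\<^sup>+x. esq (f x) * indicator E x \<partial>lborel)"

abbreviation sqn :: "('a::euclidean_space \<Rightarrow> complex) \<Rightarrow> ennreal" where
  "sqn f \<equiv> (\<integral>\<^sup>+ x. esq (f x) \<partial>lborel)"

lemma sqn_eq_integral:
  assumes "test_fun f" shows "sqn f = ennreal (LINT x|lborel. (norm (f x))\<^sup>2)"
  by (rule nn_integral_eq_integral[OF test_fun_norm2_integrable[OF assms]]) auto

lemma integral_ee_period:
  assumes "L > 0"
  shows "(LINT x|lborel. indicator {s..s+L} x *\<^sub>R ee (x * of_int k / L)) = (if k = 0 then of_real L else 0)"
proof (cases "k = 0")
  case True
  then show ?thesis using assms by (simp add: scaleR_conv_of_real)
next
  case False
  define c where "c = 2 * pi * of_int k / L"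
  have c0: "c \<noteq> 0" using False assms by (simp add: c_def)
  have ce: "ee (x * of_int k / L) = cis (c * x)" for x
    by (simp add: ee_def c_def field_simps)
  have d: "((\<lambda>x. cis (c*x) / (\<i> * of_real c)) has_vector_derivative cis (c*x)) (at x within A)" for x A
    unfolding cis_conv_exp
    by (rule derivative_eq_intros has_vector_derivative_real_field | use c0 in \<open>simp add: field_simps\<close>)+
  have "(LINT x|lborel. indicator {s..s+L} x *\<^sub>R cis (c*x))
     = cis (c * (s + L)) / (\<i> * of_real c) - cis (c * s) / (\<i> * of_real c)"
    by (intro integral_FTC_Icc d continuous_intros) (use assms in auto)
  also have "cis (c * (s + L)) = cis (c * s)"
  proof -
    have "c * (s + L) = c * s + 2 * pi * of_int k" using assms by (simp add: c_def field_simps)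
    then show ?thesis by (simp add: cis_multiple_2pi flip: cis_mult)
  qed
  finally show ?thesis using False by (simp add: ce)
qed

text \<open>The exponentials of period \<open>L\<close> are orthogonal on an interval of length \<open>L\<close>. Bessel's inequality
  for them is the only form of Fourier inversion in the whole proof.\<close>

lemma Bessel_interval:
  fixes f :: "real \<Rightarrow> complex"
  assumes f: "test_fun f" and L: "L > 0" and supp: "\<And>x. f x \<noteq> 0 \<Longrightarrow> x \<in> {s..s+L}"
    and fin: "finite M"
  shows "(\<Sum>m\<in>M. (norm (LINT x|lborel. ee (- (x * of_int m / L)) * f x))\<^sup>2)
           \<le> L * (LINT x|lborel. (norm (f x))\<^sup>2)"
proof -
  define c where "c m = (LINT x|lborel. ee (- (x * of_int m / L)) * f x)" for m
  define S where "S = (\<Sum>m\<in>M. (norm (c m))\<^sup>2)"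
  define I where "I x = (indicator {s..s+L} x :: complex)" for x
  define g where "g x = I x * (\<Sum>m\<in>M. c m * ee (x * of_int m / L))" for x
  have If: "I x * f x = f x" for x using supp[of x] by (auto simp: I_def indicator_def)
  have II: "I x * I x = I x" "cnj (I x) = I x" for x by (auto simp: I_def indicator_def)
  have "I = indicator {s..s+L}" by (auto simp: I_def)
  then have mI: "I \<in> borel_measurable borel" by simp
  have tI: "test_fun I"
    by (rule test_funI[where B=1 and R="\<bar>s\<bar>+L"]) (use mI in \<open>auto simp: I_def indicator_def\<close>)
  have tIe: "test_fun (\<lambda>x. ee (x * of_int k / L) * I x)" for k
    by (rule test_fun_ee_mult[OF tI]) auto
  have intc: "integrable lborel (\<lambda>x. ee (- (x * of_int m / L)) * f x)" for m
    by (intro test_fun_integrable test_fun_ee_mult f) auto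
  have 1: "(LINT x|lborel. f x * cnj (g x)) = of_real S"
  proof -
    have "(LINT x|lborel. f x * cnj (g x))
        = (LINT x|lborel. (\<Sum>m\<in>M. cnj (c m) * (ee (- (x * of_int m / L)) * f x)))"
    proof (rule Bochner_Integration.integral_cong[OF refl])
      fix x
      have "f x * cnj (g x) = (I x * f x) * (\<Sum>m\<in>M. cnj (c m) * ee (- (x * of_int m / L)))"
        unfolding g_def by (simp add: II cnj_sum cnj_ee)
      also have "\<dots> = (\<Sum>m\<in>M. cnj (c m) * (ee (- (x * of_int m / L)) * f x))"
        unfolding If sum_distrib_left by (simp add: mult_ac)
      finally show "f x * cnj (g x) = \<dots>" .
    qed
    also have "\<dots> = (\<Sum>m\<in>M. cnj (c m) * c m)"
      using intc by (simp add: Bochner_Integration.integral_sum c_def)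
    also have "\<dots> = of_real S"
      unfolding S_def of_real_sum by (intro sum.cong refl) (metis complex_norm_square mult.commute)
    finally show ?thesis .
  qed
  have 2: "(LINT x|lborel. g x * cnj (g x)) = of_real (L * S)"
  proof -
    have "(LINT x|lborel. g x * cnj (g x)) = (LINT x|lborel. (\<Sum>m\<in>M. \<Sum>k\<in>M.
         c m * cnj (c k) * (ee (x * of_int (m-k) / L) * I x)))"
    proof (rule Bochner_Integration.integral_cong[OF refl])
      fix x
      have "g x * cnj (g x) = I x * ((\<Sum>m\<in>M. c m * ee (x * of_int m / L))
          * (\<Sum>k\<in>M. cnj (c k) * ee (-(x * of_int k / L))))"
        unfolding g_def using II[of x] by (simp add: cnj_sum cnj_ee) (metis mult.assoc mult.commute)
      also have "\<dots> = (\<Sum>m\<in>M. \<Sum>k\<in>M. c m * cnj (c k) * (ee (x * of_int (m-k) / L) * I x))"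
        apply (subst sum_product) unfolding sum_distrib_left
        by (intro sum.cong refl) (simp add: left_diff_distrib right_diff_distrib diff_divide_distrib ee_diff[of "x * _ / L"] mult_ac)
      finally show "g x * cnj (g x) = \<dots>" .
    qed
    also have "\<dots> = (\<Sum>m\<in>M. \<Sum>k\<in>M. c m * cnj (c k) * (LINT x|lborel. ee (x * of_int (m-k) / L) * I x))"
      using test_fun_integrable[OF tIe] by (simp add: Bochner_Integration.integral_sum Bochner_Integration.integrable_sum del: of_int_diff)
    also have "\<dots> = (\<Sum>m\<in>M. \<Sum>k\<in>M. c m * cnj (c k) * (if m - k = 0 then of_real L else 0))"
    proof -
      have "(LINT x|lborel. ee (x * of_int k / L) * I x) = (if k = 0 then of_real L else 0)" for k
      proof -
        have "(LINT x|lborel. ee (x * of_int k / L) * I x) = (LINT x|lborel. indicator {s..s+L} x *\<^sub>R ee (x * of_int k / L))"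
          by (intro Bochner_Integration.integral_cong refl) (auto simp: I_def indicator_def)
        then show ?thesis using integral_ee_period[OF L] by simp
      qed
      then show ?thesis by (simp only:)
    qed
    also have "\<dots> = (\<Sum>m\<in>M. of_real L * (c m * cnj (c m)))"
      using fin by (intro sum.cong refl) (simp add: if_distrib sum.delta' mult.commute cong: if_cong)
    also have "\<dots> = of_real (L * S)"
      unfolding S_def of_real_mult of_real_sum sum_distrib_left complex_norm_square ..
    finally show ?thesis .
  qed
  have tg: "test_fun g"
  proof -
    have "norm (\<Sum>m\<in>M. c m * ee (x * of_int m / L)) \<le> (\<Sum>m\<in>M. norm (c m))" for x
      by (rule order_trans[OF norm_sum]) (simp add: norm_mult)
    from test_fun_mult[OF tI _ this] show ?thesis unfolding g_def by (simp add: mult.commute)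
  qed
  have ifg: "integrable lborel (\<lambda>x. f x * cnj (g x))" and igg: "integrable lborel (\<lambda>x. g x * cnj (g x))"
    by (intro test_fun_integrable test_fun_mult_cnj f tg)+
  note iff = test_fun_norm2_integrable[OF f]
  \<comment> \<open>\<open>g / L\<close> is the orthogonal projection of \<open>f\<close> onto the span of the exponentials.\<close>
  have "0 \<le> (LINT x|lborel. (norm (f x - g x / of_real L))\<^sup>2)"
    by simp
  also have "(\<lambda>x. (norm (f x - g x / of_real L))\<^sup>2)
     = (\<lambda>x. ((norm (f x))\<^sup>2 - 2 / L * Re (f x * cnj (g x))) + (1 / L\<^sup>2) * Re (g x * cnj (g x)))"
  proof
    fix x
    have "complex_of_real ((norm (f x - g x / of_real L))\<^sup>2)
      = of_real ((norm (f x))\<^sup>2) - (f x * cnj (g x) + cnj (f x * cnj (g x))) / of_real L + g x * cnj (g x) / (of_real L)\<^sup>2"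
      unfolding complex_norm_square using L by (simp add: field_simps power2_eq_square)
    then have "Re (complex_of_real ((norm (f x - g x / of_real L))\<^sup>2))
      = Re (of_real ((norm (f x))\<^sup>2) - (f x * cnj (g x) + cnj (f x * cnj (g x))) / of_real L + g x * cnj (g x) / (of_real L)\<^sup>2)"
      by simp
    then show "(norm (f x - g x / of_real L))\<^sup>2
      = ((norm (f x))\<^sup>2 - 2 / L * Re (f x * cnj (g x))) + (1 / L\<^sup>2) * Re (g x * cnj (g x))"
      by (simp add: Re_divide_of_real flip: of_real_power of_real_mult) 
  qed
  also have "(LINT x|lborel. ((norm (f x))\<^sup>2 - 2 / L * Re (f x * cnj (g x))) + (1 / L\<^sup>2) * Re (g x * cnj (g x)))
     = (LINT x|lborel. (norm (f x))\<^sup>2) - 2 / L * Re (LINT x|lborel. f x * cnj (g x)) + (1 / L\<^sup>2) * Re (LINT x|lborel. g x * cnj (g x))"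
  proof -
    define h1 h2 where "h1 x = f x * cnj (g x)" and "h2 x = g x * cnj (g x)" for x
    have "integrable lborel h1" "integrable lborel h2"
      using ifg igg by (simp_all add: h1_def[abs_def] h2_def[abs_def])
    then have "(LINT x|lborel. ((norm (f x))\<^sup>2 - 2 / L * Re (h1 x)) + (1 / L\<^sup>2) * Re (h2 x))
      = (LINT x|lborel. (norm (f x))\<^sup>2) - 2 / L * Re (LINT x|lborel. h1 x) + (1 / L\<^sup>2) * Re (LINT x|lborel. h2 x)"
      using iff by (simp add: integral_Re integrable_Re)
    then show ?thesis by (simp only: h1_def h2_def)
  qed
  also have "\<dots> = (LINT x|lborel. (norm (f x))\<^sup>2) - S / L"
    unfolding 1 2 using L by (simp add: field_simps power2_eq_square)
  finally have "S / L \<le> (LINT x|lborel. (norm (f x))\<^sup>2)" by simp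
  then show ?thesis using L unfolding S_def c_def by (simp add: field_simps)
qed

section \<open>An upper half of Plancherel's theorem\<close>

lemma nn_integral_exhaust_le:
  fixes g :: "real \<Rightarrow> ennreal"
  assumes [measurable]: "g \<in> borel_measurable borel"
    and le: "\<And>n::nat. (\<integral>\<^sup>+x. g x * indicator {-real n..<real n} x \<partial>lborel) \<le> C"
  shows "(\<integral>\<^sup>+x. g x \<partial>lborel) \<le> C"
proof -
  have sup: "g x = (SUP n. g x * indicator {-real n..<real n} x)" for x
  proof (rule antisym)
    obtain n :: nat where n: "\<bar>x\<bar> < real n" using reals_Archimedean2 by blast
    have "g x = g x * indicator {-real n..<real n} x" using n by (auto simp: indicator_def)
    also have "\<dots> \<le> (SUP n. g x * indicator {-real n..<real n} x)" by (rule SUP_upper) simp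
    finally show "g x \<le> \<dots>" .
    show "(SUP n. g x * indicator {-real n..<real n} x) \<le> g x"
      by (rule SUP_least) (auto simp: indicator_def)
  qed
  have "(\<integral>\<^sup>+x. g x \<partial>lborel) = (\<integral>\<^sup>+x. (SUP n. g x * indicator {-real n..<real n} x) \<partial>lborel)"
    using sup by presburger
  also have "\<dots> = (SUP n. \<integral>\<^sup>+x. g x * indicator {-real n..<real n} x \<partial>lborel)"
    by (rule nn_integral_monotone_convergence_SUP)
       (auto simp: incseq_def le_fun_def indicator_def)
  also have "\<dots> \<le> C" using le by (rule SUP_least)
  finally show ?thesis .
qed

lemma nn_integral_translate:
  fixes g :: "real \<Rightarrow> ennreal"
  assumes "g \<in> borel_measurable borel"
  shows "(\<integral>\<^sup>+x. g (x + a) \<partial>lborel) = (\<integral>\<^sup>+x. g x \<partial>lborel)"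
  using nn_integral_real_affine[OF assms, of 1 a] by (simp add: add.commute)

definition FT :: "real \<Rightarrow> (real \<Rightarrow> complex) \<Rightarrow> real \<Rightarrow> complex" where
  "FT c f \<eta> = (LINT y|lborel. ee (- (y * \<eta> / c)) * f y)"

lemma FT_measurable [measurable]:
  assumes [measurable]: "f \<in> borel_measurable borel"
  shows "FT c f \<in> borel_measurable borel"
  unfolding FT_def by measurable

lemma FT_integrable:
  assumes "test_fun f" shows "integrable lborel (\<lambda>y. ee (- (y * \<eta> / c)) * f y)"
  by (intro test_fun_integrable test_fun_ee_mult assms) auto

lemma real_cell_decomposition:
  fixes x :: real
  shows "indicator {-real n..<real n} x = (\<Sum>m\<in>{-int n..<int n}. indicator {of_int m..<of_int m + 1} x :: ennreal)"
proof -
  have "(\<Sum>m\<in>{-int n..<int n}. indicator {of_int m..<of_int m + 1} x :: ennreal)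
     = (\<Sum>m\<in>{-int n..<int n}. if m = \<lfloor>x\<rfloor> then 1 else 0)"
    by (intro sum.cong refl) (auto simp: indicator_def floor_eq_iff eq_commute[of _ "\<lfloor>x\<rfloor>"])
  also have "\<dots> = indicator {-real n..<real n} x"
    by (auto simp: indicator_def sum.delta' le_floor_iff floor_less_iff)
  finally show ?thesis by simp
qed

text \<open>Let \<open>f\<close> be supported in an interval of length \<open>L\<close>. For each \<open>\<theta>\<close>, Bessel's inequality bounds the
  sum of the squared transform over the translated lattice \<open>(m + \<theta>) / L\<close>; integration over
  \<open>\<theta> \<in> [0, 1)\<close> turns the lattice sums into an integral over the line.\<close>

lemma Plancherel_le:
  assumes f: "test_fun f" and c: "c > 0"
  shows "sqn (FT c f) \<le> ennreal c * sqn f"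
proof -
  obtain R where R: "\<And>x. R < norm x \<Longrightarrow> f x = 0" using f unfolding test_fun_def by blast
  define L where "L = 2 * \<bar>R\<bar> + 1"
  have L: "L > 0" by (simp add: L_def)
  have supp: "x \<in> {-\<bar>R\<bar>..-\<bar>R\<bar>+L}" if "f x \<noteq> 0" for x
    using R[of x] that unfolding L_def real_norm_def by (cases "R < \<bar>x\<bar>") (auto simp: abs_le_iff)
  note [measurable] = test_fun_measurable[OF f]
  define g where "g \<zeta> = esq (FT L f \<zeta>)" for \<zeta>
  have [measurable]: "g \<in> borel_measurable borel" unfolding g_def by measurable
  have sum_le: "(\<Sum>m\<in>M. g (of_int m + \<theta>)) \<le> ennreal L * sqn f" if "finite M" for M :: "int set" and \<theta>
  proof -
    define f' where "f' x = ee (- (x * \<theta> / L)) * f x" for x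
    have f': "test_fun f'" unfolding f'_def by (rule test_fun_ee_mult[OF f]) auto
    have "(\<Sum>m\<in>M. g (of_int m + \<theta>)) = ennreal (\<Sum>m\<in>M. (norm (FT L f (of_int m + \<theta>)))\<^sup>2)"
      unfolding g_def by (simp add: sum_ennreal)
    also have "(\<Sum>m\<in>M. (norm (FT L f (of_int m + \<theta>)))\<^sup>2)
        = (\<Sum>m\<in>M. (norm (LINT x|lborel. ee (- (x * of_int m / L)) * f' x))\<^sup>2)"
    proof -
      have "ee (- (x * (of_int m + \<theta>) / L)) = ee (- (x * of_int m / L)) * ee (- (x * \<theta> / L))" for x m
        by (simp add: ee_add[symmetric] ring_distribs add_divide_distrib)
      then show ?thesis by (simp add: FT_def f'_def mult.assoc)
    qed
    also have "\<dots> \<le> L * (LINT x|lborel. (norm (f' x))\<^sup>2)"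
      by (rule Bessel_interval[OF f' L _ that]) (use supp in \<open>auto simp: f'_def\<close>)
    also have "(LINT x|lborel. (norm (f' x))\<^sup>2) = (LINT x|lborel. (norm (f x))\<^sup>2)"
      by (simp add: f'_def norm_mult)
    finally show ?thesis
      using L by (simp add: sqn_eq_integral[OF f] ennreal_mult'[symmetric] ennreal_leI)
  qed
  have "(\<integral>\<^sup>+x. g x \<partial>lborel) \<le> ennreal L * sqn f"
  proof (rule nn_integral_exhaust_le)
    fix n :: nat
    have "(\<integral>\<^sup>+x. g x * indicator {-real n..<real n} x \<partial>lborel)
        = (\<Sum>m\<in>{-int n..<int n}. \<integral>\<^sup>+x. g x * indicator {of_int m..<of_int m + 1} x \<partial>lborel)"
      unfolding real_cell_decomposition sum_distrib_left by (rule nn_integral_sum) auto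
    also have "\<dots> = (\<Sum>m\<in>{-int n..<int n}. \<integral>\<^sup>+x. g (of_int m + x) * indicator {0..<1} x \<partial>lborel)"
    proof (rule sum.cong[OF refl])
      fix m :: int
      show "(\<integral>\<^sup>+x. g x * indicator {of_int m..<of_int m + 1} x \<partial>lborel)
         = (\<integral>\<^sup>+x. g (of_int m + x) * indicator {0..<1} x \<partial>lborel)"
        by (subst nn_integral_translate[where a="of_int m", symmetric])
           (auto intro!: nn_integral_cong simp: indicator_def add.commute)
    qed
    also have "\<dots> = (\<integral>\<^sup>+x. (\<Sum>m\<in>{-int n..<int n}. g (of_int m + x)) * indicator {0..<1} x \<partial>lborel)"
      unfolding sum_distrib_right by (rule nn_integral_sum[symmetric]) auto
    also have "\<dots> \<le> (\<integral>\<^sup>+x. ennreal L * sqn f * indicator {0..<1::real} x \<partial>lborel)"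
      by (intro nn_integral_mono mult_right_mono sum_le) auto
    also have "\<dots> = ennreal L * sqn f" by (simp add: nn_integral_cmult)
    finally show "(\<integral>\<^sup>+x. g x * indicator {-real n..<real n} x \<partial>lborel) \<le> ennreal L * sqn f" .
  qed auto
  moreover have "sqn (FT c f) = ennreal (c / L) * (\<integral>\<^sup>+x. g x \<partial>lborel)"
  proof -
    have "FT c f (0 + (c / L) * x) = FT L f x" for x
      using c by (simp add: FT_def)
    then have "sqn (FT c f) = ennreal \<bar>c / L\<bar> * (\<integral>\<^sup>+x. esq (FT L f x) \<partial>lborel)"
      by (subst nn_integral_real_affine[of _ "c/L" 0]) (use c L in auto)
    then show ?thesis using c L by (simp add: g_def)
  qed
  ultimately have "sqn (FT c f) \<le> ennreal (c / L) * (ennreal L * sqn f)"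
    by (simp add: mult_left_mono)
  also have "\<dots> = ennreal c * sqn f"
    using c L by (simp add: mult.assoc[symmetric] ennreal_mult'[symmetric])
  finally show ?thesis .
qed

section \<open>Interpolation along an arithmetic progression\<close>

text \<open>Lagrange interpolation. The bound on the coefficients uses only that \<open>1\<close> keeps the distance \<open>1 / b\<close>
  from the nodes, which makes each linear factor cost at most \<open>2 b\<close>.\<close>

lemma interpolating_poly:
  fixes r :: "int \<Rightarrow> complex"
  assumes "finite Z" and "\<And>z. z \<in> Z \<Longrightarrow> norm (1 - r z) \<ge> 1 / b" and "\<And>z. norm (r z) = 1" and b: "b > 0"
  shows "\<exists>p. degree p \<le> card Z \<and> poly p 1 = 1 \<and> (\<forall>z\<in>Z. poly p (r z) = 0)
           \<and> (\<forall>k. norm (coeff p k) \<le> (2 * b) ^ card Z)"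
  using assms(1,2)
proof (induction Z rule: finite_induct)
  case empty
  show ?case by (rule exI[of _ 1]) (auto simp: coeff_1)
next
  case (insert x Z)
  then obtain p where p: "degree p \<le> card Z" "poly p 1 = 1" "\<And>z. z \<in> Z \<Longrightarrow> poly p (r z) = 0"
    "\<And>k. norm (coeff p k) \<le> (2 * b) ^ card Z" by auto
  have x: "norm (1 - r x) \<ge> 1 / b" using insert by auto
  then have x0: "1 - r x \<noteq> 0" using b by auto
  define q where "q = smult (1 / (1 - r x)) (p * [:- r x, 1:])"
  have "degree q \<le> card (insert x Z)"
    using degree_mult_le[of p "[:- r x, 1:]"] p(1) insert
    by (simp add: q_def degree_smult_eq)
  moreover have "poly q 1 = 1" using x0 p by (simp add: q_def)
  moreover have "\<forall>z\<in>insert x Z. poly q (r z) = 0" using p by (auto simp: q_def)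
  moreover have "norm (coeff q k) \<le> (2 * b) ^ card (insert x Z)" for k
  proof -
    have "norm (coeff (p * [:- r x, 1:]) k) \<le> 2 * (2 * b) ^ card Z"
    proof (cases k)
      case 0
      have "norm (coeff (p * [:- r x, 1:]) 0) = norm (coeff p 0)"
        using assms(3) by (simp add: coeff_mult_0 norm_mult)
      then show ?thesis using p(4)[of 0] b 0 by (smt (verit) norm_ge_zero)
    next
      case (Suc j)
      have "coeff (p * [:- r x, 1:]) (Suc j) = coeff p j - r x * coeff p (Suc j)"
        by (simp add: mult_pCons_right)
      then have "norm (coeff (p * [:- r x, 1:]) (Suc j)) \<le> norm (coeff p j) + norm (coeff p (Suc j))"
        using assms(3) by (metis norm_triangle_ineq4 norm_mult mult_1)
      then show ?thesis using p(4)[of j] p(4)[of "Suc j"] Suc by simp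
    qed
    moreover have "norm (1 / (1 - r x)) \<le> b"
      using x b x0 by (simp add: norm_divide field_simps)
    ultimately have "norm (coeff q k) \<le> b * (2 * (2 * b) ^ card Z)"
      unfolding q_def coeff_smult norm_mult using b by (intro mult_mono) auto
    then show ?thesis using insert by simp
  qed
  ultimately show ?case by blast
qed

lemma norm_one_plus_ee: "norm (1 + ee x) = 2 * \<bar>cos (pi * x)\<bar>"
proof -
  define a where "a = pi * x"
  have "1 + cis (2 * a) = cis a * of_real (2 * cos a)"
    by (simp add: complex_eq_iff cos_double_cos sin_double power2_eq_square)
  then have "norm (1 + cis (2 * a)) = 2 * \<bar>cos a\<bar>" by (simp add: norm_mult)
  then show ?thesis by (simp add: ee_def a_def mult.assoc)
qed

lemma sin_ge_chord:
  fixes t :: real assumes "0 \<le> t" "t \<le> pi / 2" shows "2 * t / pi \<le> sin t"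
proof -
  have "convex_on {0..pi/2} (\<lambda>x. - sin x)"
    by (rule f''_ge0_imp_convex[where f'="\<lambda>x. - cos x" and f''=sin])
       (auto intro!: derivative_eq_intros sin_ge_zero)
  from convex_onD[OF this, of "2 * t / pi" 0 "pi/2"] assms show ?thesis
    by (simp add: field_simps)
qed

lemma norm_one_minus_ee_ge:
  assumes "1 \<le> \<bar>z\<bar>" "\<bar>z\<bar> \<le> int D" 
  shows "norm (1 - ee (real_of_int z / (4 * real D))) \<ge> 1 / real D"
proof -
  define t where "t = 2 * pi * real_of_int \<bar>z\<bar> / (4 * real D)"
  have D: "real D \<ge> 1" using assms by linarith
  have zD: "real_of_int \<bar>z\<bar> \<le> real D" "real_of_int \<bar>z\<bar> \<ge> 1" using assms by linarith+
  have t: "0 \<le> t" "t \<le> pi / 2" using D zD by (auto simp: t_def field_simps)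
  have "1 / real D \<le> 2 * t / pi" using zD D by (simp add: t_def field_simps)
  also have "\<dots> \<le> sin t" by (rule sin_ge_chord[OF t])
  also have "\<dots> \<le> \<bar>sin (2 * pi * (real_of_int z / (4 * real D)))\<bar>"
    by (cases "z \<ge> 0") (auto simp: t_def)
  also have "\<dots> = \<bar>Im (1 - ee (real_of_int z / (4 * real D)))\<bar>" by (simp add: ee_def)
  also have "\<dots> \<le> norm (1 - ee (real_of_int z / (4 * real D)))" by (rule abs_Im_le_cmod)
  finally show ?thesis .
qed

text \<open>This bounds the modulus \<open>\<bar>cos (\<pi> x)\<bar>\<close> of \<open>(1 + e(x)) / 2\<close> away from its peaks at the integers.\<close>

lemma abs_cos_pi_le:
  assumes "\<And>z::int. \<kappa> \<le> \<bar>x - of_int z\<bar>" "0 \<le> \<kappa>"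
  shows "\<bar>cos (pi * x)\<bar> \<le> cos (pi * \<kappa>)"
proof -
  define r where "r = x - of_int (round x)"
  have r: "\<bar>r\<bar> \<le> 1/2" unfolding r_def using of_int_round_abs_le[of x] by (simp add: abs_minus_commute)
  have kr: "\<kappa> \<le> \<bar>r\<bar>" using assms r_def by simp
  have "pi * x = pi * r + pi * of_int (round x)" by (simp add: r_def algebra_simps)
  then have "\<bar>cos (pi * x)\<bar> = \<bar>cos (pi * r)\<bar>"
    by (simp add: cos_add)
  also have "\<dots> = cos (pi * \<bar>r\<bar>)"
  proof -
    have "cos (pi * r) = cos (pi * \<bar>r\<bar>)" by (cases "r \<ge> 0") auto
    moreover have "cos (pi * \<bar>r\<bar>) \<ge> 0" using r by (intro cos_ge_zero) (auto simp: abs_le_iff intro: order_trans[of _ 0])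
    ultimately show ?thesis by simp
  qed
  also have "\<dots> \<le> cos (pi * \<kappa>)"
    using r kr assms(2) by (subst cos_mono_le_eq) (auto intro!: mult_left_mono)
  finally show ?thesis .
qed

text \<open>The coefficients of \<open>e(D x) ((1 + e(-x)) / 2)^(2 D)\<close>, a trigonometric polynomial of degree \<open>D\<close> with
  modulus \<open>\<bar>cos (\<pi> x)\<bar>^(2 D)\<close>. The frequency \<open>t\<close> is stored at the index \<open>j = t + D\<close>. Off the integers
  the polynomial is exponentially small in \<open>D\<close>, whereas its middle coefficient is only of order
  \<open>1 / \<surd>D\<close>.\<close>

definition bump_coeff :: "nat \<Rightarrow> nat \<Rightarrow> real" where
  "bump_coeff D j = real ((2 * D) choose j) / 4 ^ D"

lemma bump_coeff_le_1: "bump_coeff D j \<le> 1"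
proof -
  have "(2 * D) choose j \<le> 2 ^ (2 * D)" by (rule binomial_le_pow2)
  then have "real ((2 * D) choose j) \<le> real (2 ^ (2 * D))" by (simp only: of_nat_le_iff)
  then show ?thesis by (simp add: bump_coeff_def power_mult)
qed

lemma bump_coeff_nonneg: "0 \<le> bump_coeff D j"
  by (simp add: bump_coeff_def)

lemma bump_coeff_middle: "D > 0 \<Longrightarrow> 1 \<le> 2 * real D * bump_coeff D D"
  using central_binomial_lower_bound[of D] by (simp add: bump_coeff_def field_simps)

lemma bump_sum:
  "(\<Sum>j\<le>2*D. of_real (bump_coeff D j) * ee (- ((real j - real D) * x))) =
     ee (real D * x) * ((1 + ee (- x)) / 2) ^ (2 * D)"
proof -
  have "(\<Sum>j\<le>2*D. of_real (bump_coeff D j) * ee (- ((real j - real D) * x)))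
      = (\<Sum>j\<le>2*D. ee (real D * x) / 4 ^ D * (of_nat ((2*D) choose j) * ee (- x) ^ j * 1 ^ (2*D - j)))"
  proof (rule sum.cong[OF refl])
    fix j
    have "- ((real j - real D) * x) = real D * x + real j * (- x)" by (simp add: algebra_simps)
    then have "ee (- ((real j - real D) * x)) = ee (real D * x) * ee (- x) ^ j"
      by (simp only: ee_add ee_power)
    then show "of_real (bump_coeff D j) * ee (- ((real j - real D) * x)) =
      ee (real D * x) / 4 ^ D * (of_nat ((2*D) choose j) * ee (- x) ^ j * 1 ^ (2*D - j))"
      by (simp add: bump_coeff_def)
  qed
  also have "\<dots> = ee (real D * x) / 4 ^ D * (ee (- x) + 1) ^ (2 * D)"
    unfolding sum_distrib_left[symmetric] binomial_ring ..
  also have "\<dots> = ee (real D * x) * ((1 + ee (- x)) / 2) ^ (2 * D)"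
    by (simp add: power_divide power_mult add.commute)
  finally show ?thesis .
qed

lemma norm_bump_sum:
  "norm (\<Sum>j\<le>2*D. of_real (bump_coeff D j) * ee (- ((real j - real D) * x))) = \<bar>cos (pi * x)\<bar> ^ (2 * D)"
  unfolding bump_sum by (simp add: norm_mult norm_power norm_divide norm_one_plus_ee)

text \<open>The loss in the interpolation: \<open>2 D\<close> from the middle coefficient of the bump and \<open>(N + 1) (2 D)^N\<close>
  from an interpolating polynomial with at most \<open>N\<close> nodes.\<close>

definition step_weight :: "nat \<Rightarrow> nat \<Rightarrow> real" where
  "step_weight D N = 2 * real D * (real N + 1) * (2 * real D) ^ N"

text \<open>The squared bump is at most \<open>cos (\<pi> \<kappa> / 2)^(4 D)\<close> at distance \<open>\<kappa> / 2\<close> from its peaks. The condition makes its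
  contribution over \<open>N + 1\<close> translates, with the squared interpolation loss, at most one half of the
  total mass.\<close>

abbreviation bump_wins :: "nat \<Rightarrow> nat \<Rightarrow> real \<Rightarrow> bool" where
  "bump_wins D N \<kappa> \<equiv> 4 * (step_weight D N)\<^sup>2 * (real N + 1)\<^sup>2 * cos (pi * (\<kappa> / 2)) ^ (4 * D) \<le> 1"

text \<open>The factor by which the squared norm drops in one step, see \<open>ennreal_gain\<close>: \<open>V\<close> is the
  constant with which the mass off \<open>Q\<close> controls the mass on \<open>Q\<close>.\<close>

definition step_gain :: "nat \<Rightarrow> nat \<Rightarrow> real" where
  "step_gain D N = (let V = 2 * (step_weight D N)\<^sup>2 * (2 * real D + 1)\<^sup>2 in (V + 1 / 2) / (V + 1))"

definition bump :: "nat \<Rightarrow> real \<Rightarrow> complex" where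
  "bump D x = (\<Sum>j\<le>2*D. of_real (bump_coeff D j) * ee (- ((real j - real D) * x)))"

lemma bump_measurable [measurable]: "bump D \<in> borel_measurable borel"
  unfolding bump_def by measurable

lemma norm_bump: "norm (bump D x) = \<bar>cos (pi * x)\<bar> ^ (2 * D)"
  unfolding bump_def by (rule norm_bump_sum)

lemma abs_cos_power_le_1: "\<bar>cos (x::real)\<bar> ^ n \<le> 1"
  by (rule power_le_one) auto

lemma poly_sum_upto:
  fixes p :: "complex poly"
  assumes "degree p \<le> N" shows "poly p x = (\<Sum>k\<le>N. coeff p k * x ^ k)"
  unfolding poly_altdef using assms
  by (intro sum.mono_neutral_left) (auto simp: coeff_eq_0)

text \<open>Translating the transform by multiples of \<open>\<sigma>\<close> is multiplying \<open>f\<close> by exponentials, and these add up to the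
  bump.\<close>

lemma FT_bump_sum:
  assumes f: "test_fun f" and H: "H > 0"
  shows "(\<Sum>j\<le>2*D. of_real (bump_coeff D j) * ee ((real j - real D) * \<alpha>) * FT H f (\<eta> + (real j - real D) * \<sigma>))
     = FT H (\<lambda>y. bump D (\<sigma> * y / H - \<alpha>) * f y) \<eta>"
proof -
  have *: "integrable lborel (\<lambda>y. ee (- (y * x / H)) * f y)" for x by (rule FT_integrable[OF f])
  have "(\<Sum>j\<le>2*D. of_real (bump_coeff D j) * ee ((real j - real D) * \<alpha>) * FT H f (\<eta> + (real j - real D) * \<sigma>))
     = (LINT y|lborel. (\<Sum>j\<le>2*D. of_real (bump_coeff D j) * ee ((real j - real D) * \<alpha>) *
           (ee (- (y * (\<eta> + (real j - real D) * \<sigma>) / H)) * f y)))"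
    unfolding FT_def using * by (simp add: Bochner_Integration.integral_sum)
  also have "\<dots> = (LINT y|lborel. ee (- (y * \<eta> / H)) * (bump D (\<sigma> * y / H - \<alpha>) * f y))"
  proof (rule Bochner_Integration.integral_cong[OF refl])
    fix y
    have *: "ee ((real j - real D) * \<alpha>) * (ee (- (y * (\<eta> + (real j - real D) * \<sigma>) / H)))
        = ee (- (y * \<eta> / H)) * ee (- ((real j - real D) * (\<sigma> * y / H - \<alpha>)))" for j
      unfolding ee_add[symmetric] using H by (intro arg_cong[of _ _ ee]) (simp add: field_simps)
    have "b * ee ((real j - real D) * \<alpha>) * (ee (- (y * (\<eta> + (real j - real D) * \<sigma>) / H)) * f y)
        = ee (- (y * \<eta> / H)) * (b * ee (- ((real j - real D) * (\<sigma> * y / H - \<alpha>))) * f y)" for j b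
    proof -
      have "b * A * (B * z) = C * (b * E * z)" if "A * B = C * E" for A B C E z :: complex
        using arg_cong[OF that, of "\<lambda>x. b * x * z"] by (simp add: mult_ac)
      from this[OF *] show ?thesis .
    qed
    then show "(\<Sum>j\<le>2*D. of_real (bump_coeff D j) * ee ((real j - real D) * \<alpha>) *
           (ee (- (y * (\<eta> + (real j - real D) * \<sigma>) / H)) * f y)) = ee (- (y * \<eta> / H)) * (bump D (\<sigma> * y / H - \<alpha>) * f y)"
      unfolding bump_def sum_distrib_left sum_distrib_right by (intro sum.cong refl) (simp only:)
  qed
  finally show ?thesis unfolding FT_def .
qed

text \<open>The coefficients \<open>u(t)\<close> of the relation are those of the bump, times \<open>p(e(t / (4 D)))\<close> for a
  polynomial \<open>p\<close> that vanishes at the frequencies \<open>t \<noteq> 0\<close> with \<open>\<eta> + t \<sigma> \<in> Q\<close>. The step \<open>1 / (4 D)\<close> is so small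
  that all nodes lie on a quarter circle on either side of \<open>1\<close>, hence stay at distance \<open>1 / D\<close> from it.
  Expanding \<open>p\<close> into monomials replaces the bump by its translates by \<open>k / (4 D)\<close> with \<open>k \<le> N\<close>. These
  do not depend on \<open>\<eta>\<close>, although \<open>p\<close> does, and for this reason the estimate can be
  integrated over \<open>\<eta>\<close> without regard to how \<open>p\<close> varies.\<close>

lemma norm_FT_interpolation:
  fixes f :: "real \<Rightarrow> complex"
  assumes f: "test_fun f" and H: "H > 0" and D: "D \<ge> 1"
    and count: "card {j. j \<le> 2 * D \<and> \<eta> + (real j - real D) * \<sigma> \<in> Q} \<le> N"
    and \<eta>: "\<eta> \<in> Q"
  shows "norm (FT H f \<eta>) \<le> step_weight D N *
     ((\<Sum>j\<le>2*D. norm (FT H f (\<eta> + (real j - real D) * \<sigma>)) * indicator (- Q) (\<eta> + (real j - real D) * \<sigma>))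
      + (\<Sum>k\<le>N. norm (FT H (\<lambda>y. bump D (\<sigma> * y / H - (y0 + real k / (4 * real D))) * f y) \<eta>)))"
proof -
  define pt where "pt j = \<eta> + (real j - real D) * \<sigma>" for j :: nat
  define J where "J = {j. j \<le> 2 * D \<and> j \<noteq> D \<and> pt j \<in> Q}"
  have fJ: "finite J" by (simp add: J_def)
  define Z where "Z = (\<lambda>j. int j - int D) ` J"
  define r where "r z = ee (real_of_int z / (4 * real D))" for z
  have cZ: "card Z \<le> N"
  proof -
    have "card Z \<le> card J" unfolding Z_def by (rule card_image_le[OF fJ])
    also have "\<dots> \<le> card {j. j \<le> 2 * D \<and> pt j \<in> Q}" by (rule card_mono) (auto simp: J_def)
    finally show ?thesis using count by (simp add: pt_def)
  qed
  have "\<exists>p. degree p \<le> card Z \<and> poly p 1 = 1 \<and> (\<forall>z\<in>Z. poly p (r z) = 0)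
           \<and> (\<forall>k. norm (coeff p k) \<le> (2 * real D) ^ card Z)"
  proof (rule interpolating_poly)
    show "norm (1 - r z) \<ge> 1 / real D" if "z \<in> Z" for z
      unfolding r_def by (rule norm_one_minus_ee_ge) (use that in \<open>auto simp: Z_def J_def\<close>)
  qed (use fJ D in \<open>auto simp: Z_def r_def\<close>)
  then obtain p where p: "degree p \<le> N" "poly p 1 = 1" "\<And>z. z \<in> Z \<Longrightarrow> poly p (r z) = 0"
    and c: "\<And>k. norm (coeff p k) \<le> (2 * real D) ^ N"
  proof -
    assume *: "\<And>p. degree p \<le> N \<Longrightarrow> poly p 1 = 1 \<Longrightarrow> (\<And>z. z \<in> Z \<Longrightarrow> poly p (r z) = 0) \<Longrightarrow>
      (\<And>k. norm (coeff p k) \<le> (2 * real D) ^ N) \<Longrightarrow> thesis"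
    assume "\<exists>p. degree p \<le> card Z \<and> poly p 1 = 1 \<and> (\<forall>z\<in>Z. poly p (r z) = 0)
           \<and> (\<forall>k. norm (coeff p k) \<le> (2 * real D) ^ card Z)"
    then obtain p where p: "degree p \<le> card Z" "poly p 1 = 1" "\<forall>z\<in>Z. poly p (r z) = 0"
      "\<And>k. norm (coeff p k) \<le> (2 * real D) ^ card Z" by blast
    have "(2 * real D) ^ card Z \<le> (2 * real D) ^ N" using D cZ by (intro power_increasing) auto
    then show thesis using p cZ by (intro *[of p]) (auto intro: order_trans)
  qed
  have pr: "norm (poly p (r z)) \<le> (real N + 1) * (2 * real D) ^ N" for z
  proof -
    have "norm (poly p (r z)) \<le> (\<Sum>k\<le>N. norm (coeff p k * r z ^ k))"
      unfolding poly_sum_upto[OF p(1)] by (rule norm_sum)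
    also have "\<dots> \<le> (\<Sum>k\<le>N. (2 * real D) ^ N)"
      by (rule sum_mono) (use c in \<open>simp add: norm_mult norm_power r_def power_mult_distrib\<close>)
    finally show ?thesis by (simp add: algebra_simps)
  qed
  define a where "a j = of_real (bump_coeff D j) * ee ((real j - real D) * y0)" for j
  define G where "G j = FT H f (pt j)" for j
  define \<Phi> where "\<Phi> k = FT H (\<lambda>y. bump D (\<sigma> * y / H - (y0 + real k / (4 * real D))) * f y) \<eta>" for k
  have na: "norm (a j) \<le> 1" for j
    using bump_coeff_le_1[of D j] bump_coeff_nonneg[of D j] by (simp add: a_def norm_mult)
  have S: "(\<Sum>j\<le>2*D. a j * poly p (r (int j - int D)) * G j) = (\<Sum>k\<le>N. coeff p k * \<Phi> k)"
  proof -
    have "(\<Sum>j\<le>2*D. a j * poly p (r (int j - int D)) * G j)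
       = (\<Sum>j\<le>2*D. \<Sum>k\<le>N. coeff p k * (a j * r (int j - int D) ^ k * G j))"
      unfolding poly_sum_upto[OF p(1)] sum_distrib_left sum_distrib_right by (simp add: mult_ac)
    also have "\<dots> = (\<Sum>k\<le>N. coeff p k * (\<Sum>j\<le>2*D. a j * r (int j - int D) ^ k * G j))"
      unfolding sum_distrib_left by (rule sum.swap)
    also have "\<dots> = (\<Sum>k\<le>N. coeff p k * \<Phi> k)"
    proof (intro sum.cong refl arg_cong[of _ _ "(*) _"])
      fix k
      have "a j * r (int j - int D) ^ k = of_real (bump_coeff D j) * ee ((real j - real D) * (y0 + real k / (4 * real D)))" for j
        unfolding a_def r_def ee_power mult.assoc ee_add[symmetric] by (simp add: algebra_simps)
      then show "(\<Sum>j\<le>2*D. a j * r (int j - int D) ^ k * G j) = \<Phi> k"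
        unfolding \<Phi>_def G_def pt_def FT_bump_sum[OF f H, symmetric] by simp
    qed
    finally show ?thesis .
  qed
  \<comment> \<open>The term \<open>j = D\<close> is the frequency \<open>0\<close>, where \<open>p\<close> has the value \<open>1\<close>.\<close>
  have split: "(\<Sum>j\<le>2*D. a j * poly p (r (int j - int D)) * G j)
      = of_real (bump_coeff D D) * FT H f \<eta> + (\<Sum>j\<in>{..2*D}-{D}. a j * poly p (r (int j - int D)) * G j)"
    by (subst sum.remove[of _ D]) (auto simp: a_def r_def p G_def pt_def)
  have rest: "norm (\<Sum>j\<in>{..2*D}-{D}. a j * poly p (r (int j - int D)) * G j)
     \<le> (real N + 1) * (2 * real D) ^ N * (\<Sum>j\<le>2*D. norm (G j) * indicator (- Q) (pt j))"
  proof -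
    have "norm (\<Sum>j\<in>{..2*D}-{D}. a j * poly p (r (int j - int D)) * G j)
        \<le> (\<Sum>j\<in>{..2*D}-{D}. (real N + 1) * (2 * real D) ^ N * (norm (G j) * indicator (- Q) (pt j)))"
    proof (rule sum_norm_le)
      fix j assume j: "j \<in> {..2*D}-{D}"
      show "norm (a j * poly p (r (int j - int D)) * G j) \<le> (real N + 1) * (2 * real D) ^ N * (norm (G j) * indicator (- Q) (pt j))"
      proof (cases "pt j \<in> Q")
        case True
        then have "int j - int D \<in> Z" using j by (auto simp: Z_def J_def)
        then show ?thesis using p(3) by simp
      next
        case False
        have "norm (a j * poly p (r (int j - int D))) \<le> 1 * ((real N + 1) * (2 * real D) ^ N)"
          unfolding norm_mult by (intro mult_mono na pr) auto
        then have "norm (a j * poly p (r (int j - int D))) * norm (G j) \<le> ((real N + 1) * (2 * real D) ^ N) * norm (G j)"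
          by (intro mult_right_mono) auto
        then show ?thesis using False by (simp add: norm_mult)
      qed
    qed
    also have "\<dots> \<le> (\<Sum>j\<le>2*D. (real N + 1) * (2 * real D) ^ N * (norm (G j) * indicator (- Q) (pt j)))"
      by (rule sum_mono2) auto
    finally show ?thesis unfolding sum_distrib_left .
  qed
  have Phi: "norm (\<Sum>k\<le>N. coeff p k * \<Phi> k) \<le> (real N + 1) * (2 * real D) ^ N * (\<Sum>k\<le>N. norm (\<Phi> k))"
  proof -
    have "norm (\<Sum>k\<le>N. coeff p k * \<Phi> k) \<le> (\<Sum>k\<le>N. (2 * real D) ^ N * norm (\<Phi> k))"
      by (rule sum_norm_le, subst norm_mult, rule mult_right_mono[OF c], simp)
    also have "\<dots> = 1 * ((2 * real D) ^ N * (\<Sum>k\<le>N. norm (\<Phi> k)))"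
      unfolding sum_distrib_left[symmetric] mult_1 ..
    also have "\<dots> \<le> (real N + 1) * ((2 * real D) ^ N * (\<Sum>k\<le>N. norm (\<Phi> k)))"
      by (rule mult_right_mono, simp, rule mult_nonneg_nonneg, simp, rule sum_nonneg, simp)
    finally show ?thesis unfolding mult.assoc .
  qed
  have "of_real (bump_coeff D D) * FT H f \<eta> = (\<Sum>k\<le>N. coeff p k * \<Phi> k) -
        (\<Sum>j\<in>{..2*D}-{D}. a j * poly p (r (int j - int D)) * G j)"
    using S split by (simp add: algebra_simps)
  then have "norm (of_real (bump_coeff D D) * FT H f \<eta>) \<le>
      norm (\<Sum>k\<le>N. coeff p k * \<Phi> k) + norm (\<Sum>j\<in>{..2*D}-{D}. a j * poly p (r (int j - int D)) * G j)"
    by (simp add: norm_triangle_ineq4)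
  also have "\<dots> \<le> (real N + 1) * (2 * real D) ^ N * (\<Sum>k\<le>N. norm (\<Phi> k)) +
      (real N + 1) * (2 * real D) ^ N * (\<Sum>j\<le>2*D. norm (G j) * indicator (- Q) (pt j))"
    by (rule add_mono[OF Phi rest])
  finally have *: "bump_coeff D D * norm (FT H f \<eta>) \<le> (real N + 1) * (2 * real D) ^ N *
      ((\<Sum>j\<le>2*D. norm (G j) * indicator (- Q) (pt j)) + (\<Sum>k\<le>N. norm (\<Phi> k)))"
    using bump_coeff_nonneg[of D D] by (simp add: norm_mult algebra_simps)
  have "1 * norm (FT H f \<eta>) \<le> (2 * real D * bump_coeff D D) * norm (FT H f \<eta>)"
    using D by (intro mult_right_mono bump_coeff_middle) auto
  also have "\<dots> = 2 * real D * (bump_coeff D D * norm (FT H f \<eta>))" by simp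
  also have "\<dots> \<le> 2 * real D * ((real N + 1) * (2 * real D) ^ N *
      ((\<Sum>j\<le>2*D. norm (G j) * indicator (- Q) (pt j)) + (\<Sum>k\<le>N. norm (\<Phi> k))))"
    by (rule mult_left_mono[OF *]) auto
  finally show ?thesis by (simp add: step_weight_def G_def \<Phi>_def pt_def mult.assoc)
qed

section \<open>The uncertainty principle in dimension one\<close>

text \<open>If mass \<open>a\<close> on a set is controlled by mass \<open>w\<close> off it, up to half of the total bound, then \<open>a\<close> cannot
  exhaust the total: add \<open>V a\<close> to both sides of the second hypothesis.\<close>

lemma ennreal_gain:
  fixes a w :: ennreal
  assumes "a + w \<le> ennreal R" "a \<le> ennreal V * w + ennreal (R / 2)" "V \<ge> 0" "R \<ge> 0"
  shows "a \<le> ennreal ((V + 1 / 2) / (V + 1) * R)"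
proof -
  have "a + w < top" using assms(1) by (rule le_less_trans) simp
  then have "a < top" "w < top" by (auto simp: less_top[symmetric] ennreal_add_eq_top)
  then obtain a' w' where aw: "a = ennreal a'" "w = ennreal w'" "a' \<ge> 0" "w' \<ge> 0"
    by (metis ennreal_cases less_irrefl)
  have 1: "a' + w' \<le> R" using assms(1,4) aw by (simp flip: ennreal_plus)
  have 2: "a' \<le> V * w' + R / 2"
    using assms(2-4) aw by (simp flip: ennreal_plus ennreal_mult)
  have "(V + 1) * a' \<le> V * (a' + w') + R / 2" using 2 by (simp add: algebra_simps)
  also have "\<dots> \<le> V * R + R / 2" using 1 assms by (simp add: mult_left_mono)
  finally have "a' \<le> (V + 1 / 2) / (V + 1) * R" using assms by (simp add: field_simps)
  then show ?thesis using aw by (simp add: ennreal_leI)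
qed

text \<open>The hypothesis \<open>hyp\<close> is the bound for the remaining scales on the enlarged set \<open>Q'\<close>. It is used for the
  total mass on \<open>Q'\<close> and also for the error terms, because multiplying \<open>f\<close> by a translate of the bump
  does not enlarge its support. There the bump is at most \<open>cos (\<pi> \<kappa> / 2)^(2 D)\<close>: the translates
  move its peaks by at most \<open>N / (4 D) \<le> \<kappa> / 2\<close>. By \<open>small\<close> this outweighs the interpolation loss.\<close>

lemma FUP_step:
  fixes f :: "real \<Rightarrow> complex"
  assumes f: "test_fun f" and H: "H > 0" and D: "D \<ge> 1"
    and ND: "real N / (4 * real D) \<le> \<kappa> / 2" and \<kappa>: "\<kappa> > 0"
    and small: "bump_wins D N \<kappa>"
    and supp: "\<And>y z. f y \<noteq> 0 \<Longrightarrow> \<kappa> \<le> \<bar>\<sigma> * y / H - y0 - real_of_int z\<bar>"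
    and [measurable]: "Q \<in> sets borel" "Q' \<in> sets borel"
    and Q': "\<And>\<eta> j. \<eta> \<in> Q \<Longrightarrow> j \<le> 2 * D \<Longrightarrow> \<eta> + (real j - real D) * \<sigma> \<in> Q'"
    and count: "\<And>\<eta>. card {j. j \<le> 2 * D \<and> \<eta> + (real j - real D) * \<sigma> \<in> Q} \<le> N"
    and hyp: "\<And>g. test_fun g \<Longrightarrow> (\<And>y. g y \<noteq> 0 \<Longrightarrow> f y \<noteq> 0) \<Longrightarrow>
       mass_on Q' (FT H g) \<le> ennreal C0 * sqn g"
    and C0: "C0 \<ge> 0"
  shows "mass_on Q (FT H f)
     \<le> ennreal (step_gain D N * C0) * sqn f"
proof -
  define W where "W = step_weight D N"
  define V where "V = 2 * W\<^sup>2 * (2 * real D + 1)\<^sup>2"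
  define E where "E = (LINT x|lborel. (norm (f x))\<^sup>2)"
  have E: "sqn f = ennreal E" "E \<ge> 0" by (simp_all add: E_def sqn_eq_integral[OF f])
  have W0: "W \<ge> 0" by (simp add: W_def step_weight_def)
  note [measurable] = test_fun_measurable[OF f]
  define pt where "pt \<eta> j = \<eta> + (real j - real D) * \<sigma>" for \<eta> and j :: nat
  define G where "G \<eta> = (norm (FT H f \<eta>))\<^sup>2" for \<eta>
  have [measurable]: "G \<in> borel_measurable borel" unfolding G_def by measurable
  define f' where "f' k y = bump D (\<sigma> * y / H - (y0 + real k / (4 * real D))) * f y" for k y
  define P where "P k \<eta> = (norm (FT H (f' k) \<eta>))\<^sup>2" for k \<eta>
  have f': "test_fun (f' k)" for k
    unfolding f'_def by (rule test_fun_mult[OF f, where C=1]) (auto simp: norm_bump abs_cos_power_le_1)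
  have [measurable]: "P k \<in> borel_measurable borel" for k
    unfolding P_def using test_fun_measurable[OF f'] by measurable
  define q where "q = cos (pi * (\<kappa> / 2))"
  have self: "\<eta> \<in> Q'" if "\<eta> \<in> Q" for \<eta> using Q'[OF that, of D] by simp
  define a w where "a = (\<integral>\<^sup>+\<eta>. ennreal (G \<eta>) * indicator Q \<eta> \<partial>lborel)"
    and "w = (\<integral>\<^sup>+\<eta>. ennreal (G \<eta>) * indicator (Q' - Q) \<eta> \<partial>lborel)"
  have aw: "a + w \<le> ennreal (C0 * E)"
  proof -
    have "a + w = (\<integral>\<^sup>+\<eta>. ennreal (G \<eta>) * indicator Q \<eta> + ennreal (G \<eta>) * indicator (Q' - Q) \<eta> \<partial>lborel)"
      unfolding a_def w_def by (rule nn_integral_add[symmetric]) auto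
    also have "\<dots> = (\<integral>\<^sup>+\<eta>. ennreal (G \<eta>) * indicator Q' \<eta> \<partial>lborel)"
      by (rule nn_integral_cong) (auto simp: indicator_def self)
    also have "\<dots> \<le> ennreal C0 * sqn f" unfolding G_def by (rule hyp[OF f])
    finally show ?thesis using C0 E by (simp add: ennreal_mult)
  qed
  have pw: "ennreal (G \<eta>) * indicator Q \<eta> \<le>
     ennreal (2 * W\<^sup>2 * (2 * real D + 1)) * (\<Sum>j\<le>2*D. ennreal (G (pt \<eta> j)) * indicator (Q' - Q) (pt \<eta> j))
     + ennreal (2 * W\<^sup>2 * (real N + 1)) * (\<Sum>k\<le>N. ennreal (P k \<eta>) * indicator Q' \<eta>)" for \<eta>
  proof (cases "\<eta> \<in> Q")
    case True
    define A B where "A = (\<Sum>j\<le>2*D. norm (FT H f (pt \<eta> j)) * indicator (- Q) (pt \<eta> j))"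
      and "B = (\<Sum>k\<le>N. norm (FT H (f' k) \<eta>))"
    have "norm (FT H f \<eta>) \<le> W * (A + B)"
      unfolding W_def A_def B_def pt_def f'_def
      by (rule norm_FT_interpolation[OF f H D count True])
    then have "G \<eta> \<le> (W * (A + B))\<^sup>2" unfolding G_def by (rule power_mono) auto
    also have "\<dots> = W\<^sup>2 * (A + B)\<^sup>2" by (simp add: power_mult_distrib)
    also have "\<dots> \<le> W\<^sup>2 * (2 * A\<^sup>2 + 2 * B\<^sup>2)"
      using sum_squares_bound[of A B] by (intro mult_left_mono) (auto simp: power2_sum)
    also have "\<dots> \<le> W\<^sup>2 * (2 * ((2 * real D + 1) * (\<Sum>j\<le>2*D. G (pt \<eta> j) * indicator (Q' - Q) (pt \<eta> j)))
       + 2 * ((real N + 1) * (\<Sum>k\<le>N. P k \<eta>)))"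
    proof -
      have "A\<^sup>2 \<le> (\<Sum>j\<le>2*D. (norm (FT H f (pt \<eta> j)) * indicator (- Q) (pt \<eta> j))\<^sup>2) * real (card {..2*D})"
        unfolding A_def by (rule sum_squared_le_sum_of_squares)
      also have "(\<Sum>j\<le>2*D. (norm (FT H f (pt \<eta> j)) * indicator (- Q) (pt \<eta> j))\<^sup>2)
          = (\<Sum>j\<le>2*D. G (pt \<eta> j) * indicator (Q' - Q) (pt \<eta> j))"
        using Q'[OF True] by (intro sum.cong refl) (auto simp: G_def indicator_def pt_def)
      finally have A: "A\<^sup>2 \<le> (2 * real D + 1) * (\<Sum>j\<le>2*D. G (pt \<eta> j) * indicator (Q' - Q) (pt \<eta> j))"
        by (simp add: mult.commute add.commute)
      have "B\<^sup>2 \<le> (\<Sum>k\<le>N. (norm (FT H (f' k) \<eta>))\<^sup>2) * real (card {..N})"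
        unfolding B_def by (rule sum_squared_le_sum_of_squares)
      then have B: "B\<^sup>2 \<le> (real N + 1) * (\<Sum>k\<le>N. P k \<eta>)" by (simp add: P_def mult.commute add.commute)
      show ?thesis using A B by (intro mult_left_mono add_mono) auto
    qed
    also have "\<dots> = 2 * W\<^sup>2 * (2 * real D + 1) * (\<Sum>j\<le>2*D. G (pt \<eta> j) * indicator (Q' - Q) (pt \<eta> j))
       + 2 * W\<^sup>2 * (real N + 1) * (\<Sum>k\<le>N. P k \<eta>)" by (simp add: algebra_simps)
    finally have "ennreal (G \<eta>) \<le> ennreal \<dots>" by (rule ennreal_leI)
    also have "\<dots> = ennreal (2 * W\<^sup>2 * (2 * real D + 1)) * ennreal (\<Sum>j\<le>2*D. G (pt \<eta> j) * indicator (Q' - Q) (pt \<eta> j))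
       + ennreal (2 * W\<^sup>2 * (real N + 1)) * ennreal (\<Sum>k\<le>N. P k \<eta>)"
      by (subst ennreal_plus) (auto intro!: mult_nonneg_nonneg sum_nonneg simp: G_def P_def ennreal_mult')
    also have "ennreal (\<Sum>j\<le>2*D. G (pt \<eta> j) * indicator (Q' - Q) (pt \<eta> j)) = (\<Sum>j\<le>2*D. ennreal (G (pt \<eta> j)) * indicator (Q' - Q) (pt \<eta> j))"
      by (subst sum_ennreal[symmetric]) (auto simp: G_def indicator_def intro!: sum.cong)
    also have "ennreal (\<Sum>k\<le>N. P k \<eta>) = (\<Sum>k\<le>N. ennreal (P k \<eta>) * indicator Q' \<eta>)"
      using self[OF True] by (subst sum_ennreal[symmetric]) (auto simp: P_def)
    finally show ?thesis using True by simp
  qed simp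
  \<comment> \<open>Each translate of the mass off \<open>Q\<close> contributes the same \<open>w\<close>.\<close>
  have tr: "(\<integral>\<^sup>+\<eta>. ennreal (G (pt \<eta> j)) * indicator (Q' - Q) (pt \<eta> j) \<partial>lborel) = w" for j
    unfolding pt_def w_def by (rule nn_integral_translate[of "\<lambda>\<eta>. ennreal (G \<eta>) * indicator (Q' - Q) \<eta>"]) auto
  have P_le: "(\<integral>\<^sup>+\<eta>. ennreal (P k \<eta>) * indicator Q' \<eta> \<partial>lborel) \<le> ennreal (C0 * (q ^ (4 * D) * E))" if k: "k \<le> N" for k
  proof -
    have "(\<integral>\<^sup>+\<eta>. ennreal (P k \<eta>) * indicator Q' \<eta> \<partial>lborel) \<le> ennreal C0 * sqn (f' k)"
      unfolding P_def by (rule hyp[OF f']) (auto simp: f'_def)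
    also have "sqn (f' k) \<le> (\<integral>\<^sup>+y. ennreal (q ^ (4 * D)) * esq (f y) \<partial>lborel)"
    proof (rule nn_integral_mono)
      fix y
      show "esq (f' k y) \<le> ennreal (q ^ (4 * D)) * esq (f y)"
      proof (cases "f y = 0")
        case True then show ?thesis by (simp add: f'_def)
      next
        case False
        define x where "x = \<sigma> * y / H - (y0 + real k / (4 * real D))"
        have kD: "real k / (4 * real D) \<le> \<kappa> / 2"
          using k D by (intro order_trans[OF _ ND] divide_right_mono) auto
        have "\<kappa> / 2 \<le> \<bar>x - real_of_int z\<bar>" for z
          
        proof -
          have "0 \<le> real k / (4 * real D)" by simp
          moreover have "\<sigma> * y / H - y0 - real_of_int z = (x - real_of_int z) + real k / (4 * real D)" by (simp add: x_def)
          ultimately show ?thesis using supp[OF False, of z] kD by linarith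
        qed
        then have c: "\<bar>cos (pi * x)\<bar> \<le> q" unfolding q_def by (rule abs_cos_pi_le) (use \<kappa> in auto)
        have "norm (f' k y) = \<bar>cos (pi * x)\<bar> ^ (2 * D) * norm (f y)"
          unfolding f'_def x_def[symmetric] by (simp add: norm_mult norm_bump)
        then have "(norm (f' k y))\<^sup>2 = (\<bar>cos (pi * x)\<bar> ^ (2 * D))\<^sup>2 * (norm (f y))\<^sup>2" by (simp add: power_mult_distrib)
        also have "(\<bar>cos (pi * x)\<bar> ^ (2 * D))\<^sup>2 \<le> (q ^ (2 * D))\<^sup>2"
          by (intro power_mono c) auto
        finally have "(norm (f' k y))\<^sup>2 \<le> (q ^ (2 * D))\<^sup>2 * (norm (f y))\<^sup>2" by (simp add: mult_right_mono)
        then show ?thesis by (simp add: ennreal_mult'[symmetric] ennreal_leI power_mult[symmetric] mult.commute)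
      qed
    qed
    also have "\<dots> = ennreal (q ^ (4 * D)) * sqn f" by (rule nn_integral_cmult) auto
    finally show ?thesis using C0 E by (simp add: ennreal_mult mult_left_mono zero_le_even_power)
  qed
  have "a \<le> (\<integral>\<^sup>+\<eta>. ennreal (2 * W\<^sup>2 * (2 * real D + 1)) * (\<Sum>j\<le>2*D. ennreal (G (pt \<eta> j)) * indicator (Q' - Q) (pt \<eta> j))
     + ennreal (2 * W\<^sup>2 * (real N + 1)) * (\<Sum>k\<le>N. ennreal (P k \<eta>) * indicator Q' \<eta>) \<partial>lborel)"
    unfolding a_def by (rule nn_integral_mono) (rule pw)
  also have "\<dots> = ennreal (2 * W\<^sup>2 * (2 * real D + 1)) * (\<Sum>j\<le>2*D. w)
     + ennreal (2 * W\<^sup>2 * (real N + 1)) * (\<Sum>k\<le>N. \<integral>\<^sup>+\<eta>. ennreal (P k \<eta>) * indicator Q' \<eta> \<partial>lborel)"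
  proof -
    define F1 F2 where "F1 \<eta> = (\<Sum>j\<le>2*D. ennreal (G (pt \<eta> j)) * indicator (Q' - Q) (pt \<eta> j))"
      and "F2 \<eta> = (\<Sum>k\<le>N. ennreal (P k \<eta>) * indicator Q' \<eta>)" for \<eta>
    have [measurable]: "(\<lambda>\<eta>. pt \<eta> j) \<in> borel_measurable borel" for j
      unfolding pt_def by measurable
    have [measurable]: "F1 \<in> borel_measurable borel" "F2 \<in> borel_measurable borel"
      unfolding F1_def F2_def by measurable
    have 1: "(\<integral>\<^sup>+\<eta>. F1 \<eta> \<partial>lborel) = (\<Sum>j\<le>2*D. w)"
      unfolding F1_def by (subst nn_integral_sum) (measurable, simp only: tr)
    have 2: "(\<integral>\<^sup>+\<eta>. F2 \<eta> \<partial>lborel) = (\<Sum>k\<le>N. \<integral>\<^sup>+\<eta>. ennreal (P k \<eta>) * indicator Q' \<eta> \<partial>lborel)"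
      unfolding F2_def by (rule nn_integral_sum) measurable
    have "(\<integral>\<^sup>+\<eta>. ennreal a * F1 \<eta> + ennreal b * F2 \<eta> \<partial>lborel)
        = ennreal a * (\<integral>\<^sup>+\<eta>. F1 \<eta> \<partial>lborel) + ennreal b * (\<integral>\<^sup>+\<eta>. F2 \<eta> \<partial>lborel)" for a b
      by (simp add: nn_integral_add nn_integral_cmult)
    then show ?thesis unfolding 1 2 unfolding F1_def F2_def .
  qed
  also have "\<dots> \<le> ennreal (2 * W\<^sup>2 * (2 * real D + 1)) * (\<Sum>j\<le>2*D. w)
     + ennreal (2 * W\<^sup>2 * (real N + 1)) * (\<Sum>k\<le>N. ennreal (C0 * (q ^ (4 * D) * E)))"
    by (intro add_left_mono mult_left_mono sum_mono P_le) auto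
  also have "ennreal (2 * W\<^sup>2 * (2 * real D + 1)) * (\<Sum>j\<le>2*D. w) = ennreal V * w"
  proof -
    have "(\<Sum>j\<le>2*D. w) = ennreal (2 * real D + 1) * w"
      by (simp add: ennreal_of_nat_eq_real_of_nat add.commute)
    then show ?thesis by (simp add: V_def ennreal_mult'' mult.assoc[symmetric] power2_eq_square)
  qed
  also have "ennreal (2 * W\<^sup>2 * (real N + 1)) * (\<Sum>k\<le>N. ennreal (C0 * (q ^ (4 * D) * E)))
     = ennreal ((4 * W\<^sup>2 * (real N + 1)\<^sup>2 * q ^ (4 * D)) * (C0 * E) / 2)"
  proof -
    have q4: "q ^ (4 * D) \<ge> 0" by (simp add: zero_le_even_power)
    have "(\<Sum>k\<le>N. ennreal (C0 * (q ^ (4 * D) * E))) = ennreal (\<Sum>k\<le>N. C0 * (q ^ (4 * D) * E))"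
      using C0 E q4 by (subst sum_ennreal) auto
    also have "(\<Sum>k\<le>N. C0 * (q ^ (4 * D) * E)) = (real N + 1) * (C0 * (q ^ (4 * D) * E))" by (simp add: add.commute)
    finally have "ennreal (2 * W\<^sup>2 * (real N + 1)) * (\<Sum>k\<le>N. ennreal (C0 * (q ^ (4 * D) * E)))
        = ennreal (2 * W\<^sup>2 * (real N + 1) * ((real N + 1) * (C0 * (q ^ (4 * D) * E))))"
      by (simp only:) (rule ennreal_mult'[symmetric], simp)
    also have "2 * W\<^sup>2 * (real N + 1) * ((real N + 1) * (C0 * (q ^ (4 * D) * E)))
        = (4 * W\<^sup>2 * (real N + 1)\<^sup>2 * q ^ (4 * D)) * (C0 * E) / 2"
      by (simp add: power2_eq_square)
    finally show ?thesis .
  qed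
  also have "\<dots> \<le> ennreal (C0 * E / 2)"
    using small C0 E by (intro ennreal_leI divide_right_mono) (auto intro!: mult_left_le_one_le simp: W_def q_def zero_le_even_power)
  finally have "a \<le> ennreal V * w + ennreal (C0 * E / 2)" by (simp add: add_left_mono)
  from ennreal_gain[OF aw this] have "a \<le> ennreal ((V + 1 / 2) / (V + 1) * (C0 * E))"
    using C0 E by (simp add: V_def)
  then have "a \<le> ennreal (step_gain D N * C0 * E)"
    by (simp only: step_gain_def Let_def V_def W_def mult.assoc)
  also have "\<dots> = ennreal (step_gain D N * C0) * sqn f"
    unfolding E(1) by (rule ennreal_mult''[OF E(2)])
  finally show ?thesis unfolding a_def G_def .
qed

lemma step_gain_bounds: "0 < step_gain D N" "step_gain D N < 1"
  by (auto simp: step_gain_def Let_def add_nonneg_pos)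

abbreviation near_hits :: "nat \<Rightarrow> real \<Rightarrow> real set \<Rightarrow> real \<Rightarrow> real \<Rightarrow> nat set" where
  "near_hits D \<sigma> Q \<tau> \<eta> \<equiv> {j. j \<le> 2 * D \<and> (\<exists>q\<in>Q. \<bar>\<eta> + (real j - real D) * \<sigma> - q\<bar> \<le> \<tau>)}"

text \<open>Induction from the last scale \<open>K\<close>, where nothing but the Plancherel bound is used, down to \<open>k\<close>. Step \<open>k\<close>
  enlarges the set by \<open>D \<sigma> k\<close>; the counting hypothesis at scale \<open>l\<close> therefore tolerates an error equal
  to the sum of all enlargements at the scales from \<open>k\<close> up to \<open>l\<close>, so that it is inherited by the
  enlarged set.\<close>

lemma FUP_iterate:
  fixes f :: "real \<Rightarrow> complex" and \<sigma> ctr :: "nat \<Rightarrow> real"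
  assumes H: "H > 0" and D: "D \<ge> 1"
    and ND: "real N / (4 * real D) \<le> \<kappa> / 2" and \<kappa>: "\<kappa> > 0"
    and small: "bump_wins D N \<kappa>"
    and \<sigma>: "\<And>l. 0 \<le> \<sigma> l"
    and "k \<le> K" and "test_fun f"
    and "\<And>l y z. k \<le> l \<Longrightarrow> l < K \<Longrightarrow> f y \<noteq> 0 \<Longrightarrow> \<kappa> \<le> \<bar>\<sigma> l * y / H - ctr l - real_of_int z\<bar>"
    and "Q \<in> sets borel"
    and "\<And>l \<eta>. k \<le> l \<Longrightarrow> l < K \<Longrightarrow>
      card (near_hits D (\<sigma> l) Q (\<Sum>m=k..<l. real D * \<sigma> m) \<eta>) \<le> N"
  shows "mass_on Q (FT H f)
     \<le> ennreal (step_gain D N ^ (K - k) * H) * sqn f"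
  using assms(7-)
proof (induction k arbitrary: f Q rule: inc_induct)
  case base
  have "mass_on Q (FT H f) \<le> sqn (FT H f)"
    by (intro nn_integral_mono) (auto simp: indicator_def)
  also have "\<dots> \<le> ennreal H * sqn f" by (rule Plancherel_le[OF base(1) H])
  finally show ?case by simp
next
  case (step k)
  define Q' where "Q' = (\<Union>j\<in>{..2*D}. (\<lambda>\<eta>. \<eta> - (real j - real D) * \<sigma> k) -` Q)"
  have mQ: "Q \<in> sets borel" by fact
  have mQ': "Q' \<in> sets borel" unfolding Q'_def
  proof (intro sets.finite_UN finite_atMost)
    fix j
    have "(\<lambda>\<eta>. \<eta> - (real j - real D) * \<sigma> k) -` Q \<inter> space borel \<in> sets borel"
      by (rule measurable_sets[OF _ mQ]) auto
    then show "(\<lambda>\<eta>. \<eta> - (real j - real D) * \<sigma> k) -` Q \<in> sets borel" by simp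
  qed
  have "mass_on Q (FT H f)
     \<le> ennreal (step_gain D N * (step_gain D N ^ (K - Suc k) * H)) * sqn f"
  proof (rule FUP_step[OF step.prems(1) H D ND \<kappa> small _ mQ mQ'])
    show "\<kappa> \<le> \<bar>\<sigma> k * y / H - ctr k - real_of_int z\<bar>" if "f y \<noteq> 0" for y z
      using step.prems(2)[of k] step.hyps that by simp
    show "\<eta> + (real j - real D) * \<sigma> k \<in> Q'" if "\<eta> \<in> Q" "j \<le> 2 * D" for \<eta> j
      unfolding Q'_def using that by (auto intro!: bexI[of _ j])
    show "card {j. j \<le> 2 * D \<and> \<eta> + (real j - real D) * \<sigma> k \<in> Q} \<le> N" for \<eta>
    proof -
      have "card {j. j \<le> 2 * D \<and> \<eta> + (real j - real D) * \<sigma> k \<in> Q} \<le>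
        card (near_hits D (\<sigma> k) Q (\<Sum>m=k..<k. real D * \<sigma> m) \<eta>)"
        by (rule card_mono) auto
      then show ?thesis using step.prems(4)[of k \<eta>] step.hyps by simp
    qed
    show "0 \<le> step_gain D N ^ (K - Suc k) * H"
      using H step_gain_bounds(1)[of D N] by simp
    fix g :: "real \<Rightarrow> complex"
    assume g: "test_fun g" "\<And>y. g y \<noteq> 0 \<Longrightarrow> f y \<noteq> 0"
    show "mass_on Q' (FT H g)
      \<le> ennreal (step_gain D N ^ (K - Suc k) * H) * sqn g"
    proof (rule step.IH[OF g(1) _ mQ'])
      show "\<kappa> \<le> \<bar>\<sigma> l * y / H - ctr l - real_of_int z\<bar>" if "Suc k \<le> l" "l < K" "g y \<noteq> 0" for l y z
        using step.prems(2)[of l y z] that g(2) by simp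
      fix l \<eta> assume l: "Suc k \<le> l" "l < K"
      have "(near_hits D (\<sigma> l) Q' (\<Sum>m=Suc k..<l. real D * \<sigma> m) \<eta>)
        \<subseteq> (near_hits D (\<sigma> l) Q (\<Sum>m=k..<l. real D * \<sigma> m) \<eta>)"
      proof safe
        fix j q assume j: "j \<le> 2 * D" and q: "q \<in> Q'" "\<bar>\<eta> + (real j - real D) * \<sigma> l - q\<bar> \<le> (\<Sum>m=Suc k..<l. real D * \<sigma> m)"
        then obtain i where i: "i \<le> 2 * D" "q - (real i - real D) * \<sigma> k \<in> Q" by (auto simp: Q'_def)
        have "\<bar>(real i - real D) * \<sigma> k\<bar> \<le> real D * \<sigma> k"
          unfolding abs_mult using i \<sigma>[of k] by (intro mult_mono) auto
        moreover have "(\<Sum>m=k..<l. real D * \<sigma> m) = real D * \<sigma> k + (\<Sum>m=Suc k..<l. real D * \<sigma> m)"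
          using l by (simp add: sum.atLeast_Suc_lessThan)
        ultimately have "\<bar>\<eta> + (real j - real D) * \<sigma> l - (q - (real i - real D) * \<sigma> k)\<bar> \<le> (\<Sum>m=k..<l. real D * \<sigma> m)"
          using q(2) by linarith
        then show "\<exists>q\<in>Q. \<bar>\<eta> + (real j - real D) * \<sigma> l - q\<bar> \<le> (\<Sum>m=k..<l. real D * \<sigma> m)"
          using i by blast
      qed
      then have "card (near_hits D (\<sigma> l) Q' (\<Sum>m=Suc k..<l. real D * \<sigma> m) \<eta>)
         \<le> card (near_hits D (\<sigma> l) Q (\<Sum>m=k..<l. real D * \<sigma> m) \<eta>)"
        by (intro card_mono) auto
      also have "\<dots> \<le> N" using step.prems(4)[of l \<eta>] l by simp
      finally show "card (near_hits D (\<sigma> l) Q' (\<Sum>m=Suc k..<l. real D * \<sigma> m) \<eta>) \<le> N" .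
    qed
  qed
  also have "step_gain D N * (step_gain D N ^ (K - Suc k) * H) = step_gain D N ^ (K - k) * H"
    using step.hyps by (simp add: Suc_diff_Suc[symmetric] mult.assoc)
  finally show ?case .
qed

section \<open>Counting points of a Cantor set in a progression\<close>

text \<open>An integer with a prescribed part above the lowest \<open>s\<close> digits is determined by these digits, and each of
  them takes at most \<open>M - 1\<close> values.\<close>

lemma card_missing_digits_block:
  fixes M :: int and e :: "nat \<Rightarrow> int"
  assumes M: "M \<ge> 1" and e: "\<And>i. 0 \<le> e i \<and> e i < M"
  shows "finite {k. k div M ^ s = q \<and> (\<forall>i<s. (k div M ^ i) mod M \<noteq> e i)} \<and>
    card {k. k div M ^ s = q \<and> (\<forall>i<s. (k div M ^ i) mod M \<noteq> e i)} \<le> nat (M - 1) ^ s"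
  using e
proof (induction s arbitrary: e)
  case 0
  then show ?case by simp
next
  case (Suc s)
  define A where "A = {k. k div M ^ Suc s = q \<and> (\<forall>i<Suc s. (k div M ^ i) mod M \<noteq> e i)}"
  define B where "B = {k. k div M ^ s = q \<and> (\<forall>i<s. (k div M ^ i) mod M \<noteq> e (Suc i))}"
  have B: "finite B" "card B \<le> nat (M - 1) ^ s"
    using Suc.IH[of "\<lambda>i. e (Suc i)"] Suc.prems unfolding B_def by auto
  define g where "g k = (k div M, k mod M)" for k
  have dd: "(k div M) div M ^ i = k div (M * M ^ i)" for k i
    using M by (simp add: zdiv_zmult2_eq)
  have "g ` A \<subseteq> B \<times> ({0..<M} - {e 0})"
  proof (rule image_subsetI)
    fix k assume k: "k \<in> A"
    have *: "(k div M ^ i) mod M \<noteq> e i" if "i < Suc s" for i using k that by (auto simp: A_def)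
    have "k div M \<in> B" using k *[of "Suc _"] unfolding A_def B_def by (auto simp: dd)
    moreover have "k mod M \<in> {0..<M}" using M by simp
    moreover have "k mod M \<noteq> e 0" using *[of 0] by simp
    ultimately show "g k \<in> B \<times> ({0..<M} - {e 0})" by (simp add: g_def)
  qed
  moreover have fin: "finite (B \<times> ({0..<M} - {e 0}))" using B by simp
  moreover have inj: "inj_on g A"
    by (rule inj_onI) (metis g_def prod.inject div_mult_mod_eq)
  ultimately have "finite A" "card A \<le> card (B \<times> ({0..<M} - {e 0}))"
    by (auto intro: inj_on_finite card_inj_on_le)
  moreover have "card (B \<times> ({0..<M} - {e 0})) = card B * nat (M - 1)"
    using Suc.prems[of 0] by (simp add: card_cartesian_product card_Diff_singleton nat_diff_distrib)
  ultimately have A: "finite A" "card A \<le> card B * nat (M - 1)" by simp_all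
  have "card B * nat (M - 1) \<le> nat (M - 1) ^ Suc s"
    using mult_le_mono1[OF B(2), of "nat (M - 1)"] by (simp only: power_Suc mult.commute)
  then show ?case using A unfolding A_def by linarith
qed

lemma card_missing_digits_interval:
  fixes M :: int and e :: "nat \<Rightarrow> int"
  assumes M: "M \<ge> 1" and e: "\<And>i. 0 \<le> e i \<and> e i < M" and ab: "b - a \<le> L * M ^ s" and L: "L \<ge> 0"
  shows "card {k. a \<le> k \<and> k \<le> b \<and> (\<forall>i<s. (k div M ^ i) mod M \<noteq> e i)} \<le> nat (L + 2) * nat (M - 1) ^ s"
proof -
  define blk where "blk q = {k. k div M ^ s = q \<and> (\<forall>i<s. (k div M ^ i) mod M \<noteq> e i)}" for q
  have P: "M ^ s > 0" using M by simp
  have blk: "finite (blk q)" "card (blk q) \<le> nat (M - 1) ^ s" for q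
    unfolding blk_def using card_missing_digits_block[OF M e] by auto
  have "{k. a \<le> k \<and> k \<le> b \<and> (\<forall>i<s. (k div M ^ i) mod M \<noteq> e i)} \<subseteq> (\<Union>q\<in>{a div M ^ s..b div M ^ s}. blk q)"
    unfolding blk_def using P by (auto intro: zdiv_mono1)
  then have "card {k. a \<le> k \<and> k \<le> b \<and> (\<forall>i<s. (k div M ^ i) mod M \<noteq> e i)} \<le> card (\<Union>q\<in>{a div M ^ s..b div M ^ s}. blk q)"
    by (intro card_mono) (auto simp: blk)
  also have "\<dots> \<le> (\<Sum>q\<in>{a div M ^ s..b div M ^ s}. card (blk q))" by (rule card_UN_le) simp
  also have "\<dots> \<le> (\<Sum>q\<in>{a div M ^ s..b div M ^ s}. nat (M - 1) ^ s)" by (rule sum_mono) (rule blk)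
  also have "\<dots> = nat (b div M ^ s - a div M ^ s + 1) * nat (M - 1) ^ s" by simp
  also have "\<dots> \<le> nat (L + 2) * nat (M - 1) ^ s"
  proof (intro mult_right_mono nat_mono)
    have "b div M ^ s \<le> (a + L * M ^ s) div M ^ s" using ab P by (intro zdiv_mono1) auto
    also have "\<dots> = a div M ^ s + L" using P div_mult_self1[of "M ^ s" a L] by linarith
    finally show "b div M ^ s - a div M ^ s + 1 \<le> L + 2" by simp
  qed simp
  finally show ?thesis .
qed

lemma card_nat_near:
  fixes x R :: real assumes "R \<ge> 0"
  shows "finite {j::nat. \<bar>real j - x\<bar> \<le> R} \<and> real (card {j::nat. \<bar>real j - x\<bar> \<le> R}) \<le> 2 * R + 1"
proof -
  have sub: "int ` {j::nat. \<bar>real j - x\<bar> \<le> R} \<subseteq> {\<lceil>x - R\<rceil>..\<lfloor>x + R\<rfloor>}"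
    by (auto simp: ceiling_le_iff le_floor_iff abs_le_iff)
  then have fin: "finite {j::nat. \<bar>real j - x\<bar> \<le> R}"
    by (meson finite_atLeastAtMost_int finite_subset finite_imageD inj_on_of_nat)
  have "card {j::nat. \<bar>real j - x\<bar> \<le> R} = card (int ` {j::nat. \<bar>real j - x\<bar> \<le> R})"
    by (simp add: card_image)
  also have "\<dots> \<le> card {\<lceil>x - R\<rceil>..\<lfloor>x + R\<rfloor>}" by (rule card_mono[OF _ sub]) simp
  finally have "real (card {j::nat. \<bar>real j - x\<bar> \<le> R}) \<le> real (nat (\<lfloor>x + R\<rfloor> + 1 - \<lceil>x - R\<rceil>))" by simp
  also have "\<dots> \<le> 2 * R + 1" using assms by linarith
  finally show ?thesis using fin by simp
qed

definition digits_avoid :: "nat \<Rightarrow> nat \<Rightarrow> (nat \<Rightarrow> nat) \<Rightarrow> int \<Rightarrow> bool" where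
  "digits_avoid M n e k \<longleftrightarrow> (\<forall>i<n. (k div int M ^ (n - 1 - i)) mod int M \<noteq> int (e i))"

text \<open>The radius is two cells of level \<open>n\<close>: one for the digits beyond level \<open>n\<close>, and one for the
  enlargement by the box, which has at most this size.\<close>

definition Cantor_nbhd :: "nat \<Rightarrow> nat \<Rightarrow> (nat \<Rightarrow> nat) \<Rightarrow> real set" where
  "Cantor_nbhd M n e = (\<Union>k\<in>{k. 0 \<le> k \<and> k < int M ^ n \<and> digits_avoid M n e k}. cball (real_of_int k / real M ^ n) (2 / real M ^ n))"

lemma Cantor_nbhd_borel: "Cantor_nbhd M n e \<in> sets borel"
proof -
  have "finite {k. 0 \<le> k \<and> k < int M ^ n \<and> digits_avoid M n e k}"
    by (rule finite_subset[of _ "{0..<int M ^ n}"]) auto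
  then show ?thesis unfolding Cantor_nbhd_def by (intro sets.finite_UN) auto
qed

text \<open>The factors bound, in this order, the blocks of \<open>s\<close> digits met by the progression, the admissible cells
  in a block, and the points of the progression near a cell.\<close>

definition lattice_hits :: "nat \<Rightarrow> nat \<Rightarrow> nat" where
  "lattice_hits M s = (6 * M + 6) * (M - 1) ^ s * (6 * M + 3)"

text \<open>The spacing \<open>\<sigma>\<close> is comparable to the length \<open>M\<^sup>-\<^sup>I\<close> of the cells of level \<open>I\<close>, so each of these cells
  accounts for a bounded number of points, and the whole progression, of length \<open>2 M^s \<sigma>\<close>, meets a bounded
  number of cells of level \<open>I - s\<close>. In each of these cells only \<open>(M - 1)^s\<close> subcells of
  level \<open>I\<close> survive. What matters is that the resulting bound is \<open>o(M^s)\<close>.\<close>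

lemma Cantor_nbhd_lattice_count:
  fixes M s I n :: nat and \<sigma> \<tau> \<eta> :: real
  assumes M: "M \<ge> 2" and e: "\<And>i. e i < M" and sI: "s \<le> I" "I \<le> n"
    and \<sigma>: "\<sigma> * real M ^ I \<le> 1" "1 < \<sigma> * real M ^ Suc I" and \<tau>: "\<tau> \<le> \<sigma>"
  shows "card (near_hits (M ^ s) \<sigma> (Cantor_nbhd M n e) \<tau> \<eta>)
     \<le> lattice_hits M s"
proof -
  define R where "R = 1 + 3 * real M"
  define D where "D = real M ^ s"
  have D1: "D \<ge> 1" using M by (simp add: D_def)
  have MI: "real M ^ I > 0" using M by simp
  have \<sigma>0: "\<sigma> > 0" using \<sigma>(2) M by (smt (verit) mult_nonpos_nonneg zero_le_power of_nat_0_le_iff)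
  have inv: "1 / real M ^ I < real M * \<sigma>" using \<sigma>(2) MI by (simp add: field_simps)
  define K where "K = {k. \<lceil>real M ^ I * (\<eta> - (D + R) * \<sigma>)\<rceil> \<le> k \<and> k \<le> \<lfloor>real M ^ I * (\<eta> + (D + R) * \<sigma>)\<rfloor> \<and>
     (\<forall>i<s. (k div int M ^ i) mod int M \<noteq> int (e (I - 1 - i)))}"
  define F where "F k = {j::nat. \<bar>\<eta> + (real j - D) * \<sigma> - real_of_int k / real M ^ I\<bar> \<le> R * \<sigma>}" for k
  have F: "finite (F k) \<and> card (F k) \<le> 6 * M + 3" for k
  proof -
    define x where "x = (real_of_int k / real M ^ I - \<eta>) / \<sigma> + D"
    have "F k = {j::nat. \<bar>real j - x\<bar> \<le> R}"
    proof -
      have "\<eta> + (real j - D) * \<sigma> - real_of_int k / real M ^ I = (real j - x) * \<sigma>" for j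
        using \<sigma>0 by (simp add: x_def field_simps)
      then show ?thesis unfolding F_def using \<sigma>0 by (simp add: abs_mult)
    qed
    then have "finite (F k)" "real (card (F k)) \<le> 2 * R + 1"
      using card_nat_near[of R x] by (auto simp: R_def)
    then show ?thesis by (simp add: R_def)
  qed
  have "card K \<le> nat (int (4 + 6 * M) + 2) * nat (int M - 1) ^ s"
    unfolding K_def
  proof (rule card_missing_digits_interval)
    have "real_of_int (\<lfloor>real M ^ I * (\<eta> + (D + R) * \<sigma>)\<rfloor> - \<lceil>real M ^ I * (\<eta> - (D + R) * \<sigma>)\<rceil>)
       \<le> real M ^ I * (\<eta> + (D + R) * \<sigma>) - real M ^ I * (\<eta> - (D + R) * \<sigma>)" by linarith
    also have "\<dots> = 2 * (D + R) * (\<sigma> * real M ^ I)" by (simp add: algebra_simps)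
    also have "\<dots> \<le> 2 * (D + R) * 1" using \<sigma>(1) D1 by (intro mult_left_mono) (auto simp: R_def)
    also have "\<dots> \<le> 2 * (D + R * D)" 
    proof -
      have "R * 1 \<le> R * D" using D1 by (intro mult_left_mono) (auto simp: R_def)
      then show ?thesis by simp
    qed
    also have "\<dots> = real_of_int (int (4 + 6 * M) * int M ^ s)" by (simp add: R_def D_def algebra_simps)
    finally show "\<lfloor>real M ^ I * (\<eta> + (D + R) * \<sigma>)\<rfloor> - \<lceil>real M ^ I * (\<eta> - (D + R) * \<sigma>)\<rceil> \<le> int (4 + 6 * M) * int M ^ s"
      by (simp only: of_int_le_iff)
  qed (use M e in auto)
  then have cK: "card K \<le> (6 * M + 6) * (M - 1) ^ s"
    using M by (simp add: nat_diff_distrib algebra_simps nat_add_distrib nat_mult_distrib)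
  have finK: "finite K" unfolding K_def by (rule finite_subset[of _ "{\<lceil>real M ^ I * (\<eta> - (D + R) * \<sigma>)\<rceil>..\<lfloor>real M ^ I * (\<eta> + (D + R) * \<sigma>)\<rfloor>}"]) auto
  have "(near_hits (M ^ s) \<sigma> (Cantor_nbhd M n e) \<tau> \<eta>) \<subseteq> (\<Union>k\<in>K. F k)"
  proof safe
    fix j q assume j: "j \<le> 2 * M ^ s" and q: "q \<in> Cantor_nbhd M n e" "\<bar>\<eta> + (real j - real (M ^ s)) * \<sigma> - q\<bar> \<le> \<tau>"
    from q(1) obtain k where k: "digits_avoid M n e k" "\<bar>real_of_int k / real M ^ n - q\<bar> \<le> 2 / real M ^ n"
      by (auto simp: Cantor_nbhd_def dist_real_def)
    define P where "P = int M ^ (n - I)"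
    have P: "P > 0" using M by (simp add: P_def)
    have Mn: "real M ^ n = real M ^ I * real_of_int P"
      using sI by (simp add: P_def power_add[symmetric])
    \<comment> \<open>\<open>k'\<close> is the cell of level \<open>I\<close> that contains the cell \<open>k\<close> of level \<open>n\<close>.\<close>
    define k' where "k' = k div P"
    have k'1: "real_of_int k' \<le> real_of_int k / real_of_int P" "real_of_int k / real_of_int P < real_of_int k' + 1"
    proof -
      have "k' = \<lfloor>real_of_int k / real_of_int P\<rfloor>" by (simp add: k'_def floor_divide_of_int_eq)
      then show "real_of_int k' \<le> real_of_int k / real_of_int P" "real_of_int k / real_of_int P < real_of_int k' + 1"
        by linarith+
    qed
    have a: "real_of_int k' / real M ^ I \<le> real_of_int k / real M ^ n"
      "real_of_int k / real M ^ n \<le> real_of_int k' / real M ^ I + real M * \<sigma>"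
    proof -
      have eq: "real_of_int k / real M ^ n = (real_of_int k / real_of_int P) / real M ^ I"
        by (simp add: Mn mult.commute)
      show "real_of_int k' / real M ^ I \<le> real_of_int k / real M ^ n"
        unfolding eq using k'1 MI by (intro divide_right_mono) auto
      have "real_of_int k / real M ^ n \<le> (real_of_int k' + 1) / real M ^ I"
        unfolding eq using k'1 MI by (intro divide_right_mono) auto
      then show "real_of_int k / real M ^ n \<le> real_of_int k' / real M ^ I + real M * \<sigma>"
        using inv by (simp add: add_divide_distrib)
    qed
    have "real M ^ I \<le> real M ^ n" using M sI by (intro power_increasing) auto
    then have "1 / real M ^ n \<le> 1 / real M ^ I" using MI M by (intro divide_left_mono) auto
    then have "2 / real M ^ n \<le> 2 * (real M * \<sigma>)" using inv by simp
    then have near: "\<bar>\<eta> + (real j - D) * \<sigma> - real_of_int k' / real M ^ I\<bar> \<le> R * \<sigma>"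
      using a q(2) k(2) \<tau> unfolding R_def D_def of_nat_power ring_distribs by linarith
    have jD: "\<bar>real j - D\<bar> \<le> D" using j by (simp add: D_def abs_le_iff) (metis of_nat_le_iff of_nat_mult of_nat_numeral of_nat_power)
    have "\<bar>(real j - D) * \<sigma>\<bar> \<le> D * \<sigma>"
      unfolding abs_mult using jD \<sigma>0 by (intro mult_mono) auto
    then have w: "\<eta> - (D + R) * \<sigma> \<le> real_of_int k' / real M ^ I" "real_of_int k' / real M ^ I \<le> \<eta> + (D + R) * \<sigma>"
      using near unfolding ring_distribs by linarith+
    have "k' \<in> K" unfolding K_def
    proof (intro CollectI conjI allI impI)
      show "\<lceil>real M ^ I * (\<eta> - (D + R) * \<sigma>)\<rceil> \<le> k'"
        using w(1) MI by (simp add: ceiling_le_iff field_simps)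
      show "k' \<le> \<lfloor>real M ^ I * (\<eta> + (D + R) * \<sigma>)\<rfloor>"
        using w(2) MI by (simp add: le_floor_iff field_simps)
      fix i assume i: "i < s"
      have "k' div int M ^ i = k div int M ^ (n - 1 - (I - 1 - i))"
      proof -
        have "n - 1 - (I - 1 - i) = (n - I) + i" using i sI by linarith
        then show ?thesis unfolding k'_def P_def using M by (simp add: power_add zdiv_zmult2_eq)
      qed
      moreover have "I - 1 - i < n" using i sI by linarith
      ultimately show "(k' div int M ^ i) mod int M \<noteq> int (e (I - 1 - i))"
        using k(1) unfolding digits_avoid_def by metis
    qed
    moreover have "j \<in> F k'" using near by (simp add: F_def)
    ultimately show "j \<in> (\<Union>k\<in>K. F k)" by blast
  qed
  then have "card (near_hits (M ^ s) \<sigma> (Cantor_nbhd M n e) \<tau> \<eta>) \<le> card (\<Union>k\<in>K. F k)"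
    by (intro card_mono) (use finK F in auto)
  also have "\<dots> \<le> (\<Sum>k\<in>K. card (F k))" by (rule card_UN_le[OF finK])
  also have "\<dots> \<le> (\<Sum>k\<in>K. 6 * M + 3)" by (rule sum_mono) (use F in blast)
  also have "\<dots> \<le> lattice_hits M s" using cK by (simp add: lattice_hits_def)
  finally show ?thesis .
qed

section \<open>Separating strips\<close>

lemma test_fun_sections:
  fixes F :: "real \<times> real \<Rightarrow> complex"
  assumes "test_fun F" shows "test_fun (\<lambda>x. F (x, y))" "test_fun (\<lambda>y. F (x, y))"
proof -
  obtain B R where [measurable]: "F \<in> borel_measurable borel" and B: "\<And>x. norm (F x) \<le> B"
    and R: "\<And>x. R < norm x \<Longrightarrow> F x = 0" using assms unfolding test_fun_def by blast
  have n: "norm x \<le> norm (x, y)" "norm y \<le> norm (x, y)" for x y :: real by (simp_all add: norm_Pair)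
  have "(\<lambda>x. F (x, y)) \<in> borel_measurable borel" by measurable
  then show "test_fun (\<lambda>x. F (x, y))"
    by (rule test_funI[where B=B and R=R]) (rule B, rule R, erule less_le_trans, rule n(1))
  have "(\<lambda>y. F (x, y)) \<in> borel_measurable borel" by measurable
  then show "test_fun (\<lambda>y. F (x, y))"
    by (rule test_funI[where B=B and R=R]) (rule B, rule R, erule less_le_trans, rule n(2))
qed

lemma test_fun_Fubini:
  fixes F :: "real \<times> real \<Rightarrow> complex"
  assumes "test_fun F"
  shows "(LINT y|lborel. LINT x|lborel. F (x, y)) = (LINT x|lborel. LINT y|lborel. F (x, y))"
    and "(LINT p|lborel. F p) = (LINT x|lborel. LINT y|lborel. F (x, y))"
proof -
  have i: "integrable (lborel \<Otimes>\<^sub>M lborel) F"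
    unfolding lborel_prod by (rule test_fun_integrable[OF assms])
  then have "integrable (lborel \<Otimes>\<^sub>M lborel) (\<lambda>(x, y). F (x, y))" by simp
  from lborel_pair.Fubini_integral[OF this]
  show "(LINT y|lborel. LINT x|lborel. F (x, y)) = (LINT x|lborel. LINT y|lborel. F (x, y))" .
  show "(LINT p|lborel. F p) = (LINT x|lborel. LINT y|lborel. F (x, y))"
    using lborel_pair.integral_fst'[OF i] unfolding lborel_prod by simp
qed

lemma nn_Fubini:
  fixes F :: "real \<times> real \<Rightarrow> ennreal"
  assumes "F \<in> borel_measurable borel"
  shows "(\<integral>\<^sup>+y. \<integral>\<^sup>+x. F (x, y) \<partial>lborel \<partial>lborel) = (\<integral>\<^sup>+x. \<integral>\<^sup>+y. F (x, y) \<partial>lborel \<partial>lborel)"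
    and "(\<integral>\<^sup>+p. F p \<partial>lborel) = (\<integral>\<^sup>+x. \<integral>\<^sup>+y. F (x, y) \<partial>lborel \<partial>lborel)"
proof -
  have m: "F \<in> borel_measurable (lborel \<Otimes>\<^sub>M lborel)" unfolding lborel_prod using assms by simp
  show "(\<integral>\<^sup>+y. \<integral>\<^sup>+x. F (x, y) \<partial>lborel \<partial>lborel) = (\<integral>\<^sup>+x. \<integral>\<^sup>+y. F (x, y) \<partial>lborel \<partial>lborel)"
    by (rule lborel_pair.Fubini[OF m])
  show "(\<integral>\<^sup>+p. F p \<partial>lborel) = (\<integral>\<^sup>+x. \<integral>\<^sup>+y. F (x, y) \<partial>lborel \<partial>lborel)"
    using lborel.nn_integral_fst[OF m] unfolding lborel_prod by simp
qed

lemma integrable_indicator_Icc: "integrable lborel (indicator {a..b::real} :: real \<Rightarrow> real)"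
  by (rule integrable_real_indicator) (auto simp: emeasure_lborel_Icc_eq)

lemma test_fun_integral:
  fixes F :: "real \<times> real \<Rightarrow> complex"
  assumes F: "test_fun F" shows "test_fun (\<lambda>x. LINT y|lborel. F (x, y))"
proof -
  obtain B R where [measurable]: "F \<in> borel_measurable borel" and B: "\<And>x. norm (F x) \<le> B"
    and R: "\<And>x. R < norm x \<Longrightarrow> F x = 0" using F unfolding test_fun_def by blast
  have z: "F (x, y) = 0" if "R < \<bar>x\<bar> \<or> R < \<bar>y\<bar>" for x y
    using that norm_fst_le[of x y] norm_snd_le[of y x] by (intro R) auto
  show ?thesis
  proof (rule test_funI[where B="B * (2 * \<bar>R\<bar>)" and R=R])
    show "(\<lambda>x. LINT y|lborel. F (x, y)) \<in> borel_measurable borel" by measurable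
    fix x
    have "norm (LINT y|lborel. F (x, y)) \<le> (LINT y|lborel. norm (F (x, y)))" by (rule integral_norm_bound)
    also have "\<dots> \<le> (LINT y|lborel. B * indicator {-\<bar>R\<bar>..\<bar>R\<bar>} y)"
    proof (rule integral_mono)
      show "integrable lborel (\<lambda>y. norm (F (x, y)))"
        by (intro integrable_norm test_fun_integrable test_fun_sections(2) F)
      show "norm (F (x, y)) \<le> B * indicator {-\<bar>R\<bar>..\<bar>R\<bar>} y" for y
        using z[of x y] B[of "(x, y)"] by (cases "R < \<bar>y\<bar>") (auto simp: indicator_def)
    qed (intro integrable_mult_right integrable_indicator_Icc)
    also have "\<dots> = B * (2 * \<bar>R\<bar>)" by simp
    finally show "norm (LINT y|lborel. F (x, y)) \<le> B * (2 * \<bar>R\<bar>)" .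
    show "(LINT y|lborel. F (x, y)) = 0" if "R < norm x" using z that by simp
  qed
qed

lemma test_fun_partial_FT:
  fixes F :: "real \<times> real \<Rightarrow> complex"
  assumes "test_fun F" shows "test_fun (\<lambda>x. FT H (\<lambda>y. F (x, y)) \<eta>)"
  unfolding FT_def
  using test_fun_integral[OF test_fun_ee_mult[OF assms, of "\<lambda>p. - (snd p * \<eta> / H)"]]
  by (simp add: borel_prod[symmetric])

text \<open>A local Fourier coefficient: the average of \<open>\<phi>\<close> times an exponential of frequency \<open>\<theta>\<close> over the
  interval \<open>[x0 - w, x0]\<close>.\<close>

definition window_FT :: "real \<Rightarrow> real \<Rightarrow> (real \<Rightarrow> complex) \<Rightarrow> real \<Rightarrow> complex" where
  "window_FT w \<theta> \<phi> x0 = of_real (1 / w) * (LINT x|lborel. indicator {0..w} (x0 - x) * ee (- (x * \<theta>)) * \<phi> x)"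

lemma window_FT_measurable [measurable]:
  assumes [measurable]: "\<phi> \<in> borel_measurable borel"
  shows "window_FT w \<theta> \<phi> \<in> borel_measurable borel"
  unfolding window_FT_def by measurable

lemma window_FT_zero:
  assumes "\<And>x. x0 - w \<le> x \<Longrightarrow> x \<le> x0 \<Longrightarrow> \<phi> x = 0" shows "window_FT w \<theta> \<phi> x0 = 0"
proof -
  have z: "indicator {0..w} (x0 - x) * ee (- (x * \<theta>)) * \<phi> x = 0" for x
    using assms[of x] by (auto simp: indicator_def)
  show ?thesis unfolding window_FT_def z by simp
qed

lemma test_fun_indicator_window:
  assumes "test_fun \<phi>"
  shows "test_fun (\<lambda>x. indicator {0..w} (x0 - x) * ee (- (x * \<theta>)) * \<phi> x)"
proof -
  have "(\<lambda>x. indicator {0..w} (x0 - x) * ee (- (x * \<theta>))) \<in> borel_measurable borel" by measurable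
  moreover have "norm (indicator {0..w} (x0 - x) * ee (- (x * \<theta>))) \<le> 1" for x
    by (auto simp: indicator_def)
  ultimately show ?thesis by (rule test_fun_mult[OF assms])
qed

lemma window_FT_sum:
  assumes "\<And>b. b \<in> S \<Longrightarrow> test_fun (\<phi> b)"
  shows "window_FT w \<theta> (\<lambda>x. \<Sum>b\<in>S. \<phi> b x) x0 = (\<Sum>b\<in>S. window_FT w \<theta> (\<phi> b) x0)"
proof -
  have "integrable lborel (\<lambda>x. indicator {0..w} (x0 - x) * ee (- (x * \<theta>)) * \<phi> b x)" if "b \<in> S" for b
    using assms[OF that] by (intro test_fun_integrable test_fun_indicator_window)
  then show ?thesis unfolding window_FT_def sum_distrib_left
    by (simp add: Bochner_Integration.integral_sum sum_distrib_left)
qed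

lemma test_fun_window_kernel:
  fixes \<phi> :: "real \<Rightarrow> complex"
  assumes "test_fun \<phi>"
  shows "test_fun (\<lambda>p. indicator {0..w} (fst p - snd p) * \<phi> (snd p))"
proof -
  obtain B R where [measurable]: "\<phi> \<in> borel_measurable borel" and B: "\<And>x. norm (\<phi> x) \<le> B"
    and R: "\<And>x. R < norm x \<Longrightarrow> \<phi> x = 0" using assms unfolding test_fun_def by blast
  show ?thesis
  proof (rule test_funI[where B=B and R="2 * \<bar>R\<bar> + \<bar>w\<bar>"])
    show "(\<lambda>p. indicator {0..w} (fst p - snd p) * \<phi> (snd p)) \<in> borel_measurable borel"
      unfolding borel_prod[symmetric] by measurable
    show "norm (indicator {0..w} (fst p - snd p) * \<phi> (snd p)) \<le> B" for p
      using B[of "snd p"] order_trans[OF norm_ge_zero B[of "snd p"]] by (auto simp: norm_mult indicator_def)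
    fix p :: "real \<times> real" assume p: "2 * \<bar>R\<bar> + \<bar>w\<bar> < norm p"
    show "indicator {0..w} (fst p - snd p) * \<phi> (snd p) = 0"
    proof (rule ccontr)
      assume "indicator {0..w} (fst p - snd p) * \<phi> (snd p) \<noteq> 0"
      then have 1: "0 \<le> fst p - snd p" "fst p - snd p \<le> w" "\<phi> (snd p) \<noteq> 0"
        by (auto simp: indicator_def split: if_splits)
      then have "\<not> R < \<bar>snd p\<bar>" using R[of "snd p"] by auto
      moreover have "norm p \<le> \<bar>fst p\<bar> + \<bar>snd p\<bar>"
        using norm_Pair_le[of "fst p" "snd p"] by simp
      ultimately show False using p 1 by linarith
    qed
  qed
qed

lemma test_fun_window_FT:
  assumes \<phi>: "test_fun \<phi>"
  shows "test_fun (window_FT w \<theta> \<phi>)"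
proof -
  have "test_fun (\<lambda>p. ee (- (snd p * \<theta>)) * (indicator {0..w} (fst p - snd p) * \<phi> (snd p)))"
    by (rule test_fun_ee_mult[OF test_fun_window_kernel[OF \<phi>]]) (simp add: borel_prod[symmetric])
  from test_fun_mult[OF test_fun_integral[OF this], of "\<lambda>_. of_real (1 / w)" "norm (complex_of_real (1 / w))"]
  show ?thesis unfolding window_FT_def[abs_def] by (simp add: mult_ac)
qed

text \<open>The phases vary by at most a sixth of a turn, so all real parts are at least \<open>cos (\<pi> / 3) = 1 / 2\<close>.\<close>

lemma window_average_bound:
  assumes w: "w > 0" and \<omega>: "w * \<bar>\<omega>\<bar> \<le> 1 / 6"
  shows "1 / 2 \<le> norm (of_real (1 / w) * (LINT z|lborel. indicator {0..w} z * ee (- (z * \<omega>))))"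
proof -
  have t: "test_fun (\<lambda>z. indicator {0..w} z * ee (- (z * \<omega>)))"
    by (rule test_funI[where B=1 and R=w]) (auto simp: indicator_def)
  have "w * (1 / 2) = (LINT z|lborel. indicator {0..w} z * (1 / 2))" using w by simp
  also have "\<dots> \<le> (LINT z|lborel. Re (indicator {0..w} z * ee (- (z * \<omega>))))"
  proof (rule integral_mono)
    show "integrable lborel (\<lambda>z. Re (indicator {0..w} z * ee (- (z * \<omega>))))"
      by (intro integrable_Re test_fun_integrable t)
    fix z
    show "indicator {0..w} z * (1 / 2) \<le> Re (indicator {0..w} z * ee (- (z * \<omega>)))"
    proof (cases "z \<in> {0..w}")
      case True
      have "\<bar>z * \<omega>\<bar> \<le> w * \<bar>\<omega>\<bar>" using True unfolding abs_mult by (intro mult_right_mono) auto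
      then have "\<bar>z * \<omega>\<bar> \<le> 1 / 6" using \<omega> by linarith
      then have "2 * pi * \<bar>z * \<omega>\<bar> \<le> 2 * pi * (1 / 6)" by (intro mult_left_mono) auto
      then have "cos (pi / 3) \<le> cos (2 * pi * \<bar>z * \<omega>\<bar>)"
        by (intro cos_monotone_0_pi_le) auto
      then have "1 / 2 \<le> cos (2 * pi * \<bar>z * \<omega>\<bar>)" by (simp add: cos_60)
      also have "\<dots> = cos (2 * pi * (- (z * \<omega>)))" by (cases "z * \<omega> \<ge> 0") auto
      finally show ?thesis using True by (simp add: ee_def)
    qed simp
  qed (intro integrable_mult_left integrable_indicator_Icc)
  also have "\<dots> = Re (LINT z|lborel. indicator {0..w} z * ee (- (z * \<omega>)))"
    by (rule integral_Re[OF test_fun_integrable[OF t]])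
  also have "\<dots> \<le> norm (LINT z|lborel. indicator {0..w} z * ee (- (z * \<omega>)))" by (rule complex_Re_le_cmod)
  finally show ?thesis using w by (simp add: norm_mult norm_divide field_simps)
qed

text \<open>Passing to window averages is a convolution, so it multiplies the transform by the transform of the
  window. By \<open>window_average_bound\<close> this factor is bounded below for \<open>\<xi>\<close> close to \<open>\<xi>0\<close>, which
  is how averages of short range determine the transform on a strip in \<open>\<xi>\<close>.\<close>

lemma FT_window_FT:
  assumes \<phi>: "test_fun \<phi>" and h: "h > 0"
  shows "FT h (window_FT w (\<xi>0 / h) \<phi>) (\<xi> - \<xi>0) =
    of_real (1 / w) * (LINT z|lborel. indicator {0..w} z * ee (- (z * ((\<xi> - \<xi>0) / h)))) * FT h \<phi> \<xi>"
proof -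
  define F where "F p = indicator {0..w} (fst p - snd p) *
     (ee (- (fst p * (\<xi> - \<xi>0) / h)) * ee (- (snd p * (\<xi>0 / h))) * \<phi> (snd p))" for p :: "real \<times> real"
  have tF: "test_fun F"
  proof -
    have "test_fun (\<lambda>p. ee (- (fst p * (\<xi> - \<xi>0) / h)) * (ee (- (snd p * (\<xi>0 / h))) *
        (indicator {0..w} (fst p - snd p) * \<phi> (snd p))))"
      by (intro test_fun_ee_mult test_fun_window_kernel \<phi>) (simp_all add: borel_prod[symmetric])
    then show ?thesis unfolding F_def[abs_def] by (simp add: mult_ac)
  qed
  have "FT h (window_FT w (\<xi>0 / h) \<phi>) (\<xi> - \<xi>0) = (LINT x0|lborel. of_real (1 / w) * (LINT x|lborel. F (x0, x)))"
    unfolding FT_def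
  proof (rule Bochner_Integration.integral_cong[OF refl])
    fix x0
    have "(LINT x|lborel. F (x0, x)) = ee (- (x0 * (\<xi> - \<xi>0) / h)) *
      (LINT x|lborel. indicator {0..w} (x0 - x) * ee (- (x * (\<xi>0 / h))) * \<phi> x)"
      unfolding F_def by (subst integral_mult_right_zero[symmetric]) (simp add: mult_ac)
    then show "ee (- (x0 * (\<xi> - \<xi>0) / h)) * window_FT w (\<xi>0 / h) \<phi> x0 = of_real (1 / w) * (LINT x|lborel. F (x0, x))"
      by (simp add: window_FT_def)
  qed
  also have "\<dots> = of_real (1 / w) * (LINT x0|lborel. LINT x|lborel. F (x0, x))" by simp
  also have "(LINT x0|lborel. LINT x|lborel. F (x0, x)) = (LINT x|lborel. LINT x0|lborel. F (x0, x))"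
    by (rule test_fun_Fubini(1)[OF tF, symmetric])
  also have "\<dots> = (LINT x|lborel. (LINT z|lborel. indicator {0..w} z * ee (- (z * ((\<xi> - \<xi>0) / h)))) * (ee (- (x * \<xi> / h)) * \<phi> x))"
  proof (rule Bochner_Integration.integral_cong[OF refl])
    fix x
    have "(LINT x0|lborel. F (x0, x)) = (LINT z|lborel. F (x + z, x))"
      using lborel_integral_real_affine[of 1 "\<lambda>x0. F (x0, x)" x] by simp
    also have "\<dots> = (LINT z|lborel. indicator {0..w} z * ee (- (z * ((\<xi> - \<xi>0) / h))) * (ee (- (x * \<xi> / h)) * \<phi> x))"
    proof (rule Bochner_Integration.integral_cong[OF refl])
      fix z
      have "ee (- ((x + z) * (\<xi> - \<xi>0) / h)) * ee (- (x * (\<xi>0 / h))) = ee (- (z * ((\<xi> - \<xi>0) / h))) * ee (- (x * \<xi> / h))"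
        unfolding ee_add[symmetric] using h by (intro arg_cong[of _ _ ee]) (simp add: field_simps)
      then show "F (x + z, x) = indicator {0..w} z * ee (- (z * ((\<xi> - \<xi>0) / h))) * (ee (- (x * \<xi> / h)) * \<phi> x)"
        by (simp add: F_def mult.assoc[symmetric])
    qed
    also have "\<dots> = (LINT z|lborel. indicator {0..w} z * ee (- (z * ((\<xi> - \<xi>0) / h)))) * (ee (- (x * \<xi> / h)) * \<phi> x)"
      by simp
    finally show "(LINT x0|lborel. F (x0, x)) = \<dots>" .
  qed
  finally show ?thesis by (simp add: FT_def)
qed

text \<open>The window averages of the \<open>\<phi> b\<close> inherit the localisation to the strips, up to the window length
  \<open>w \<le> sw\<close>. So at most five of them are nonzero at any point, and the square of their sum is
  bounded by five times the sum of their squares.\<close>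

lemma nn_integral_FT_strips:
  fixes \<phi> :: "int \<Rightarrow> real \<Rightarrow> complex"
  assumes \<phi>: "\<And>b. b \<in> S \<Longrightarrow> test_fun (\<phi> b)" and S: "finite S" and h: "h > 0" and w: "w > 0" and sw: "w \<le> sw"
    and supp: "\<And>b x. b \<in> S \<Longrightarrow> \<phi> b x \<noteq> 0 \<Longrightarrow> sw * (of_int b - 1) \<le> x \<and> x \<le> sw * (of_int b + 2)"
    and J: "\<And>\<xi>. \<xi> \<in> J \<Longrightarrow> w * \<bar>\<xi> - \<xi>0\<bar> / h \<le> 1 / 6"
  shows "(\<integral>\<^sup>+\<xi>. esq (\<Sum>b\<in>S. FT h (\<phi> b) \<xi>) * indicator J \<xi> \<partial>lborel)
    \<le> ennreal (20 * h) * (\<Sum>b\<in>S. sqn (window_FT w (\<xi>0 / h) (\<phi> b)))"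
proof -
  define \<Phi> where "\<Phi> x = (\<Sum>b\<in>S. \<phi> b x)" for x
  have t\<Phi>: "test_fun \<Phi>"
  proof -
    have "\<forall>b\<in>S. \<exists>B. \<forall>x. norm (\<phi> b x) \<le> B" "\<forall>b\<in>S. \<exists>R. \<forall>x. R < norm x \<longrightarrow> \<phi> b x = 0"
      using \<phi> unfolding test_fun_def by blast+
    then obtain B R where B: "\<And>b x. b \<in> S \<Longrightarrow> norm (\<phi> b x) \<le> B b"
      and R: "\<And>b x. b \<in> S \<Longrightarrow> R b < norm x \<Longrightarrow> \<phi> b x = 0" by metis
    show ?thesis unfolding \<Phi>_def
    proof (rule test_funI[where B="\<Sum>b\<in>S. B b" and R="\<Sum>b\<in>S. \<bar>R b\<bar>"])
      show "(\<lambda>x. \<Sum>b\<in>S. \<phi> b x) \<in> borel_measurable borel"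
        using \<phi> test_fun_measurable by (intro borel_measurable_sum) blast
      show "norm (\<Sum>b\<in>S. \<phi> b x) \<le> (\<Sum>b\<in>S. B b)" for x using B by (rule sum_norm_le)
      show "(\<Sum>b\<in>S. \<phi> b x) = 0" if "(\<Sum>b\<in>S. \<bar>R b\<bar>) < norm x" for x
      proof (rule sum.neutral, rule ballI)
        fix b assume b: "b \<in> S"
        then have "\<bar>R b\<bar> \<le> (\<Sum>b\<in>S. \<bar>R b\<bar>)" using S by (intro member_le_sum) auto
        then show "\<phi> b x = 0" using that b by (intro R) auto
      qed
    qed
  qed
  define \<psi> where "\<psi> = window_FT w (\<xi>0 / h) \<Phi>"
  have t\<psi>: "test_fun \<psi>" unfolding \<psi>_def by (rule test_fun_window_FT[OF t\<Phi>])
  have FT\<Phi>: "(\<Sum>b\<in>S. FT h (\<phi> b) \<xi>) = FT h \<Phi> \<xi>" for \<xi>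
    unfolding FT_def \<Phi>_def using FT_integrable[OF \<phi>]
    by (simp add: sum_distrib_left Bochner_Integration.integral_sum)
  have [measurable]: "FT h \<psi> \<in> borel_measurable borel"
    by (rule FT_measurable[OF test_fun_measurable[OF t\<psi>]])
  have "(\<integral>\<^sup>+\<xi>. esq (\<Sum>b\<in>S. FT h (\<phi> b) \<xi>) * indicator J \<xi> \<partial>lborel)
     \<le> (\<integral>\<^sup>+\<xi>. ennreal 4 * esq (FT h \<psi> (\<xi> + - \<xi>0)) \<partial>lborel)"
  proof (rule nn_integral_mono)
    fix \<xi>
    show "esq (\<Sum>b\<in>S. FT h (\<phi> b) \<xi>) * indicator J \<xi> \<le> ennreal 4 * esq (FT h \<psi> (\<xi> + - \<xi>0))"
    proof (cases "\<xi> \<in> J")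
      case True
      define c where "c = of_real (1 / w) * (LINT z|lborel. indicator {0..w} z * ee (- (z * ((\<xi> - \<xi>0) / h))))"
      have c: "1 / 2 \<le> norm c"
        unfolding c_def by (rule window_average_bound[OF w]) (use J[OF True] h in \<open>simp add: abs_divide\<close>)
      have "FT h \<psi> (\<xi> + - \<xi>0) = c * FT h \<Phi> \<xi>"
        unfolding \<psi>_def c_def using FT_window_FT[OF t\<Phi> h, of w \<xi>0 \<xi>] by simp
      then have "1 / 2 * norm (FT h \<Phi> \<xi>) \<le> norm (FT h \<psi> (\<xi> + - \<xi>0))"
        using mult_right_mono[OF c norm_ge_zero] by (simp only: norm_mult)
      then have "(norm (FT h \<Phi> \<xi>))\<^sup>2 \<le> (2 * norm (FT h \<psi> (\<xi> + - \<xi>0)))\<^sup>2"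
        by (intro power_mono) auto
      then have "(norm (FT h \<Phi> \<xi>))\<^sup>2 \<le> 4 * (norm (FT h \<psi> (\<xi> + - \<xi>0)))\<^sup>2"
        by (simp add: power_mult_distrib)
      then have "esq (FT h \<Phi> \<xi>) \<le> ennreal 4 * esq (FT h \<psi> (\<xi> + - \<xi>0))"
        by (subst ennreal_mult'[symmetric]) (auto intro: ennreal_leI)
      then show ?thesis using True unfolding FT\<Phi> by simp
    qed simp
  qed
  also have "\<dots> = ennreal 4 * (\<integral>\<^sup>+\<xi>. esq (FT h \<psi> (\<xi> + - \<xi>0)) \<partial>lborel)"
    by (rule nn_integral_cmult) auto
  also have "\<dots> = ennreal 4 * sqn (FT h \<psi>)"
    by (subst nn_integral_translate[where g="\<lambda>\<xi>. esq (FT h \<psi> \<xi>)"]) auto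
  also have "\<dots> \<le> ennreal 4 * (ennreal h * sqn \<psi>)"
    by (intro mult_left_mono Plancherel_le[OF t\<psi> h]) auto
  also have "\<dots> \<le> ennreal 4 * (ennreal h * (ennreal 5 * (\<Sum>b\<in>S. sqn (window_FT w (\<xi>0 / h) (\<phi> b)))))"
  proof (intro mult_left_mono)
    have "sqn \<psi> \<le> (\<integral>\<^sup>+x. ennreal 5 * (\<Sum>b\<in>S. esq (window_FT w (\<xi>0 / h) (\<phi> b) x)) \<partial>lborel)"
    proof (rule nn_integral_mono)
      fix x
      define T where "T = {b \<in> S. window_FT w (\<xi>0 / h) (\<phi> b) x \<noteq> 0}"
      have T: "finite T" using S by (simp add: T_def)
      have "T \<subseteq> {\<lceil>x / sw - 3\<rceil>..\<lfloor>x / sw + 1\<rfloor>}"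
      proof
        fix b assume b: "b \<in> T"
        then have bS: "b \<in> S" and ne: "window_FT w (\<xi>0 / h) (\<phi> b) x \<noteq> 0" by (auto simp: T_def)
        then obtain t where t: "x - w \<le> t" "t \<le> x" "\<phi> b t \<noteq> 0" using window_FT_zero[of x w "\<phi> b"] by blast
        have "sw * (of_int b - 1) \<le> x" "x \<le> sw * (of_int b + 2) + sw"
          using supp[OF bS t(3)] t sw by linarith+
        then have "of_int b - 1 \<le> x / sw" "x / sw \<le> of_int b + 3"
          using w sw by (simp_all add: field_simps)
        then show "b \<in> {\<lceil>x / sw - 3\<rceil>..\<lfloor>x / sw + 1\<rfloor>}"
          unfolding atLeastAtMost_iff by linarith
      qed
      then have "card T \<le> card {\<lceil>x / sw - 3\<rceil>..\<lfloor>x / sw + 1\<rfloor>}" by (rule card_mono[rotated]) simp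
      then have cT: "real (card T) \<le> 5" unfolding card_atLeastAtMost_int by linarith
      have "\<psi> x = (\<Sum>b\<in>S. window_FT w (\<xi>0 / h) (\<phi> b) x)"
        unfolding \<psi>_def \<Phi>_def by (rule window_FT_sum[OF \<phi>])
      also have "\<dots> = (\<Sum>b\<in>T. window_FT w (\<xi>0 / h) (\<phi> b) x)"
        unfolding T_def using S by (intro sum.mono_neutral_right) auto
      finally have "(norm (\<psi> x))\<^sup>2 \<le> (\<Sum>b\<in>T. norm (window_FT w (\<xi>0 / h) (\<phi> b) x))\<^sup>2"
        by (simp add: norm_sum power_mono)
      also have "\<dots> \<le> (\<Sum>b\<in>T. (norm (window_FT w (\<xi>0 / h) (\<phi> b) x))\<^sup>2) * real (card T)"
        by (rule sum_squared_le_sum_of_squares)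
      also have "\<dots> \<le> (\<Sum>b\<in>S. (norm (window_FT w (\<xi>0 / h) (\<phi> b) x))\<^sup>2) * 5"
        using S cT by (intro mult_mono sum_mono2 sum_nonneg) (auto simp: T_def)
      finally have "esq (\<psi> x) \<le> ennreal (5 * (\<Sum>b\<in>S. (norm (window_FT w (\<xi>0 / h) (\<phi> b) x))\<^sup>2))"
        by (intro ennreal_leI) (simp only: mult.commute)
      also have "\<dots> = ennreal 5 * (\<Sum>b\<in>S. esq (window_FT w (\<xi>0 / h) (\<phi> b) x))"
        by (subst sum_ennreal, simp, rule ennreal_mult', simp)
      finally show "esq (\<psi> x) \<le> ennreal 5 * (\<Sum>b\<in>S. esq (window_FT w (\<xi>0 / h) (\<phi> b) x))" .
    qed
    also have "\<dots> = ennreal 5 * (\<Sum>b\<in>S. sqn (window_FT w (\<xi>0 / h) (\<phi> b)))"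
    proof -
      have m: "(\<lambda>x. esq (window_FT w (\<xi>0 / h) (\<phi> b) x)) \<in> borel_measurable lborel" if "b \<in> S" for b
        using window_FT_measurable[OF test_fun_measurable[OF \<phi>[OF that]]] by simp
      have "(\<integral>\<^sup>+x. ennreal 5 * (\<Sum>b\<in>S. esq (window_FT w (\<xi>0 / h) (\<phi> b) x)) \<partial>lborel)
          = ennreal 5 * (\<integral>\<^sup>+x. (\<Sum>b\<in>S. esq (window_FT w (\<xi>0 / h) (\<phi> b) x)) \<partial>lborel)"
        by (rule nn_integral_cmult) (intro borel_measurable_sum m)
      also have "(\<integral>\<^sup>+x. (\<Sum>b\<in>S. esq (window_FT w (\<xi>0 / h) (\<phi> b) x)) \<partial>lborel)
          = (\<Sum>b\<in>S. sqn (window_FT w (\<xi>0 / h) (\<phi> b)))"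
        by (rule nn_integral_sum) (rule m)
      finally show ?thesis .
    qed
    finally show "sqn \<psi> \<le> ennreal 5 * (\<Sum>b\<in>S. sqn (window_FT w (\<xi>0 / h) (\<phi> b)))" .
  qed auto
  also have "\<dots> = ennreal (20 * h) * (\<Sum>b\<in>S. sqn (window_FT w (\<xi>0 / h) (\<phi> b)))"
  proof -
    have "ennreal 4 * (ennreal h * ennreal 5) = ennreal (20 * h)"
      using h by (simp add: ennreal_mult[symmetric] del: ennreal_numeral)
    then show ?thesis by (simp add: mult.assoc[symmetric] del: ennreal_numeral)
  qed
  finally show ?thesis .
qed

lemma nn_integral_window_indicator:
  assumes "w > 0"
  shows "(\<integral>\<^sup>+x0. indicator {0..w} (x0 - x) \<partial>lborel) = ennreal w"
proof -
  have "(\<integral>\<^sup>+x0. indicator {0..w} (x0 - x) \<partial>lborel) = (\<integral>\<^sup>+x0. indicator {x..x+w} x0 \<partial>lborel)"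
    by (intro nn_integral_cong) (auto simp: indicator_def)
  also have "\<dots> = ennreal w" using assms by (simp add: emeasure_lborel_Icc_eq)
  finally show ?thesis .
qed

text \<open>The frequencies \<open>a / (16 w)\<close> are orthogonal on intervals of length \<open>16 w\<close>, in particular for functions
  cut off to one window. Bessel's inequality at each \<open>x0\<close> and integration over \<open>x0\<close> give the claim.\<close>

lemma sum_sqn_window_FT_le:
  assumes g: "test_fun g" and A: "finite A" and w: "w > 0"
  shows "(\<Sum>a\<in>A. sqn (window_FT w (real_of_int a / (16 * w)) g)) \<le> ennreal 16 * sqn g"
proof -
  note [measurable] = test_fun_measurable[OF g]
  have pw: "(\<Sum>a\<in>A. esq (window_FT w (real_of_int a / (16 * w)) g x0))
      \<le> ennreal (16 / w) * (\<integral>\<^sup>+x. indicator {0..w} (x0 - x) * esq (g x) \<partial>lborel)" for x0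
  proof -
    define g' where "g' x = indicator {0..w} (x0 - x) * g x" for x
    have g': "test_fun g'" unfolding g'_def
      by (rule test_fun_mult[OF g, where C=1]) (auto simp: indicator_def)
    have "(\<Sum>a\<in>A. (norm (window_FT w (real_of_int a / (16 * w)) g x0))\<^sup>2)
       = (1 / w)\<^sup>2 * (\<Sum>a\<in>A. (norm (LINT x|lborel. ee (- (x * of_int a / (16 * w))) * g' x))\<^sup>2)"
      unfolding window_FT_def g'_def sum_distrib_left using w
      by (simp add: norm_mult norm_divide power_divide mult_ac)
    also have "\<dots> \<le> (1 / w)\<^sup>2 * (16 * w * (LINT x|lborel. (norm (g' x))\<^sup>2))"
      using w A by (intro mult_left_mono Bessel_interval[OF g', where s="x0 - w"])
         (auto simp: g'_def indicator_def split: if_splits)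
    also have "\<dots> = 16 / w * (LINT x|lborel. (norm (g' x))\<^sup>2)"
      using w by (simp add: power2_eq_square field_simps)
    finally have "ennreal (\<Sum>a\<in>A. (norm (window_FT w (real_of_int a / (16 * w)) g x0))\<^sup>2) \<le> ennreal (16 / w) * sqn g'"
      using w by (simp add: sqn_eq_integral[OF g'] ennreal_mult'[symmetric] ennreal_leI)
    also have "sqn g' = (\<integral>\<^sup>+x. indicator {0..w} (x0 - x) * esq (g x) \<partial>lborel)"
      by (intro nn_integral_cong) (auto simp: g'_def indicator_def)
    finally show ?thesis by (simp add: sum_ennreal)
  qed
  have "(\<Sum>a\<in>A. sqn (window_FT w (real_of_int a / (16 * w)) g))
     = (\<integral>\<^sup>+x0. (\<Sum>a\<in>A. esq (window_FT w (real_of_int a / (16 * w)) g x0)) \<partial>lborel)"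
    by (rule nn_integral_sum[symmetric]) measurable
  also have "\<dots> \<le> (\<integral>\<^sup>+x0. ennreal (16 / w) * (\<integral>\<^sup>+x. indicator {0..w} (x0 - x) * esq (g x) \<partial>lborel) \<partial>lborel)"
    by (rule nn_integral_mono) (rule pw)
  also have "\<dots> = ennreal (16 / w) * (\<integral>\<^sup>+x0. (\<integral>\<^sup>+x. indicator {0..w} (x0 - x) * esq (g x) \<partial>lborel) \<partial>lborel)"
    by (rule nn_integral_cmult) measurable
  also have "(\<integral>\<^sup>+x0. (\<integral>\<^sup>+x. indicator {0..w} (x0 - x) * esq (g x) \<partial>lborel) \<partial>lborel)
     = (\<integral>\<^sup>+x. (\<integral>\<^sup>+x0. indicator {0..w} (x0 - x) * esq (g x) \<partial>lborel) \<partial>lborel)"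
    using nn_Fubini(1)[of "\<lambda>p. indicator {0..w} (fst p - snd p) * esq (g (snd p))"]
    by (simp add: borel_prod[symmetric])
  also have "\<dots> = (\<integral>\<^sup>+x. ennreal w * esq (g x) \<partial>lborel)"
    by (intro nn_integral_cong, subst nn_integral_multc) (auto simp: nn_integral_window_indicator[OF w])
  also have "\<dots> = ennreal w * sqn g" by (rule nn_integral_cmult) auto
  also have "ennreal (16 / w) * (ennreal w * sqn g) = ennreal 16 * sqn g"
    using w by (simp add: mult.assoc[symmetric] ennreal_mult'[symmetric] del: ennreal_numeral)
  finally show ?thesis .
qed

abbreviation wave :: "real \<Rightarrow> real \<Rightarrow> real \<times> real \<Rightarrow> real \<times> real \<Rightarrow> complex" where
  "wave h H p q \<equiv> ee (- (fst q * fst p / h + snd q * snd p / H))"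

definition FT2 :: "real \<Rightarrow> real \<Rightarrow> (real \<times> real \<Rightarrow> complex) \<Rightarrow> real \<times> real \<Rightarrow> complex" where
  "FT2 h H f p = (LINT q|lborel. wave h H p q * f q)"

lemma FT2_eq_iterated:
  assumes f: "test_fun f"
  shows "FT2 h H f (\<xi>, \<eta>) = FT h (\<lambda>x. FT H (\<lambda>y. f (x, y)) \<eta>) \<xi>"
proof -
  have t: "test_fun (\<lambda>q. ee (- (fst q * \<xi> / h + snd q * \<eta> / H)) * f q)"
    by (rule test_fun_ee_mult[OF f]) (auto simp: borel_prod[symmetric])
  have "FT2 h H f (\<xi>, \<eta>) = (LINT x|lborel. LINT y|lborel. ee (- (x * \<xi> / h + y * \<eta> / H)) * f (x, y))"
    unfolding FT2_def using test_fun_Fubini(2)[OF t] by simp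
  also have "\<dots> = FT h (\<lambda>x. FT H (\<lambda>y. f (x, y)) \<eta>) \<xi>"
    unfolding FT_def
  proof (rule Bochner_Integration.integral_cong[OF refl])
    fix x
    have "ee (- (x * \<xi> / h + y * \<eta> / H)) * f (x, y) = ee (- (x * \<xi> / h)) * (ee (- (y * \<eta> / H)) * f (x, y))" for y
      by (simp add: ee_add[symmetric] mult.assoc[symmetric])
    then show "(LINT y|lborel. ee (- (x * \<xi> / h + y * \<eta> / H)) * f (x, y)) =
      ee (- (x * \<xi> / h)) * (LINT y|lborel. ee (- (y * \<eta> / H)) * f (x, y))"
      by (simp only: integral_mult_right_zero)
  qed
  finally show ?thesis .
qed

lemma window_FT_partial_FT:
  assumes f: "test_fun f" and w: "w > 0"
  shows "window_FT w \<theta> (\<lambda>x. FT H (\<lambda>y. f (x, y)) \<eta>) x0 = FT H (\<lambda>y. window_FT w \<theta> (\<lambda>x. f (x, y)) x0) \<eta>"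
proof -
  define F where "F q = (indicator {0..w} (x0 - fst q) * ee (- (fst q * \<theta>)) * ee (- (snd q * \<eta> / H))) * f q" for q
  have "test_fun F" unfolding F_def
    by (rule test_fun_mult[OF f, where C=1]) (auto simp: borel_prod[symmetric] indicator_def norm_mult)
  from test_fun_Fubini(1)[OF this]
  have sw: "(LINT x|lborel. LINT y|lborel. F (x, y)) = (LINT y|lborel. LINT x|lborel. F (x, y))" by simp
  have "window_FT w \<theta> (\<lambda>x. FT H (\<lambda>y. f (x, y)) \<eta>) x0 = of_real (1 / w) * (LINT x|lborel. LINT y|lborel. F (x, y))"
    unfolding window_FT_def FT_def F_def by (simp add: mult.assoc)
  also have "\<dots> = (LINT y|lborel. of_real (1 / w) * (LINT x|lborel. F (x, y)))"
    unfolding sw by simp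
  also have "\<dots> = FT H (\<lambda>y. window_FT w \<theta> (\<lambda>x. f (x, y)) x0) \<eta>"
    unfolding FT_def
  proof (rule Bochner_Integration.integral_cong[OF refl])
    fix y
    have "F (x, y) = ee (- (y * \<eta> / H)) * (indicator {0..w} (x0 - x) * ee (- (x * \<theta>)) * f (x, y))" for x
      by (simp add: F_def mult_ac)
    then show "of_real (1 / w) * (LINT x|lborel. F (x, y)) = ee (- (y * \<eta> / H)) * window_FT w \<theta> (\<lambda>x. f (x, y)) x0"
      unfolding window_FT_def by simp
  qed
  finally show ?thesis .
qed

lemma FT2_measurable [measurable]:
  assumes [measurable]: "f \<in> borel_measurable borel"
  shows "FT2 h H f \<in> borel_measurable borel"
proof -
  have [measurable]: "f \<in> borel_measurable (borel \<Otimes>\<^sub>M borel)" unfolding borel_prod by fact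
  have "(\<lambda>p. LINT q|(lborel \<Otimes>\<^sub>M lborel). wave h H p q * f q) \<in> borel_measurable (borel \<Otimes>\<^sub>M borel)"
    by measurable
  then show ?thesis unfolding FT2_def lborel_prod borel_prod by simp
qed

text \<open>The cell number \<open>a\<close> of width \<open>l\<close>, enlarged by one width on either side to make room for the box.\<close>

abbreviation strip :: "real \<Rightarrow> int \<Rightarrow> real set" where
  "strip l a \<equiv> {l * (of_int a - 1)..l * (of_int a + 2)}"

text \<open>On the strip number \<open>a\<close> in \<open>\<xi>\<close>, the function \<open>f b\<close> is replaced by its window averages at the
  frequency of this strip. The averages act on \<open>x\<close> alone, so at each \<open>x0\<close> their support in
  \<open>y\<close> lies in that of \<open>f b\<close>, and the estimate in dimension one applies to them, with a set \<open>Q a\<close> and a support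
  that depend on \<open>a\<close> and \<open>b\<close> in an arbitrary way. Summing over \<open>a\<close> recovers the norm of \<open>f b\<close> by Bessel's
  inequality.\<close>

lemma FUP_glue_strips:
  fixes f :: "int \<Rightarrow> real \<times> real \<Rightarrow> complex" and Q :: "int \<Rightarrow> real set"
  assumes f: "\<And>b. b \<in> S \<Longrightarrow> test_fun (f b)" and S: "finite S" and A: "finite A"
    and h: "h > 0" and H: "H > 0" and l: "l > 0" and sw: "h / (16 * l) \<le> sw" and r: "r \<ge> 0"
    and supp: "\<And>b x y. b \<in> S \<Longrightarrow> f b (x, y) \<noteq> 0 \<Longrightarrow> sw * (of_int b - 1) \<le> x \<and> x \<le> sw * (of_int b + 2)"
    and Q: "\<And>a. a \<in> A \<Longrightarrow> Q a \<in> sets borel"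
    and fup: "\<And>a b g. a \<in> A \<Longrightarrow> b \<in> S \<Longrightarrow> test_fun g \<Longrightarrow> (\<And>y. g y \<noteq> 0 \<Longrightarrow> \<exists>x. f b (x, y) \<noteq> 0) \<Longrightarrow>
      mass_on (Q a) (FT H g) \<le> ennreal (r * H) * sqn g"
  shows "(\<Sum>a\<in>A. \<integral>\<^sup>+p. esq (\<Sum>b\<in>S. FT2 h H (f b) p) *
            indicator ((strip l a) \<times> Q a) p \<partial>lborel)
     \<le> ennreal (320 * r * (h * H)) * (\<Sum>b\<in>S. sqn (f b))"
proof -
  \<comment> \<open>A strip in \<open>\<xi>\<close> has radius at most \<open>2 l\<close> about \<open>l a\<close>, so its phases on a window vary by at most \<open>1 / 8\<close>.\<close>
  define w where "w = h / (16 * l)"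
  have w: "w > 0" using h l by (simp add: w_def)
  have fm: "f b \<in> borel_measurable borel" if "b \<in> S" for b using test_fun_measurable[OF f[OF that]] .
  define \<theta> where "\<theta> a = real_of_int a / (16 * w)" for a
  have \<theta>: "l * real_of_int a / h = \<theta> a" for a using h l by (simp add: \<theta>_def w_def)
  define V where "V a b x0 y = window_FT w (\<theta> a) (\<lambda>x. f b (x, y)) x0" for a b x0 y
  have Vm: "(\<lambda>q. V a b (fst q) (snd q)) \<in> borel_measurable borel" if "b \<in> S" for a b
  proof -
    note [measurable] = fm[OF that]
    have [measurable]: "f b \<in> borel_measurable (borel \<Otimes>\<^sub>M borel)" unfolding borel_prod by measurable
    have "(\<lambda>q. V a b (fst q) (snd q)) \<in> borel_measurable (borel \<Otimes>\<^sub>M borel)"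
      unfolding V_def window_FT_def by measurable
    then show ?thesis unfolding borel_prod .
  qed
  have FVm: "(\<lambda>q. FT H (V a b (fst q)) (snd q)) \<in> borel_measurable borel" if "b \<in> S" for a b
  proof -
    note [measurable] = fm[OF that]
    have [measurable]: "f b \<in> borel_measurable (borel \<Otimes>\<^sub>M borel)" unfolding borel_prod by measurable
    have "(\<lambda>q. FT H (V a b (fst q)) (snd q)) \<in> borel_measurable (borel \<Otimes>\<^sub>M borel)"
      unfolding FT_def V_def window_FT_def by measurable
    then show ?thesis unfolding borel_prod .
  qed
  have Vt: "test_fun (V a b x0)" if b: "b \<in> S" for a b x0
  proof -
    obtain B R where [measurable]: "f b \<in> borel_measurable borel" and B: "\<And>x. norm (f b x) \<le> B"
      and R: "\<And>x. R < norm x \<Longrightarrow> f b x = 0" using f[OF b] unfolding test_fun_def by blast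
    define F where "F q = (indicator {0..w} (x0 - snd q) * ee (- (snd q * \<theta> a))) * f b (snd q, fst q)" for q
    have swap: "test_fun (\<lambda>q. f b (snd q, fst q))"
    proof (rule test_funI[where B=B and R=R])
      show "(\<lambda>q. f b (snd q, fst q)) \<in> borel_measurable borel" by (simp add: borel_prod[symmetric])
      show "f b (snd q, fst q) = 0" if "R < norm q" for q
        using that by (intro R) (cases q, simp add: norm_Pair add.commute)
    qed (rule B)
    have "test_fun F" unfolding F_def
      by (rule test_fun_mult[OF swap, where C=1]) (auto simp: borel_prod[symmetric] indicator_def norm_mult)
    from test_fun_mult[OF test_fun_integral[OF this], of "\<lambda>_. of_real (1 / w)" "norm (complex_of_real (1 / w))"]
    show ?thesis by (simp add: V_def[abs_def] window_FT_def F_def)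
  qed
  have Vsupp: "\<exists>x. f b (x, y) \<noteq> 0" if "V a b x0 y \<noteq> 0" for a b x0 y
  proof (rule ccontr)
    assume "\<nexists>x. f b (x, y) \<noteq> 0"
    then have "V a b x0 y = 0" unfolding V_def by (intro window_FT_zero) auto
    with that show False by simp
  qed
  have one: "(\<integral>\<^sup>+p. esq (\<Sum>b\<in>S. FT2 h H (f b) p) *
            indicator ((strip l a) \<times> Q a) p \<partial>lborel)
      \<le> ennreal (20 * h) * (ennreal (r * H) * (\<Sum>b\<in>S. \<integral>\<^sup>+x0. sqn (V a b x0) \<partial>lborel))" if a: "a \<in> A" for a
  proof -
    note [measurable] = Q[OF a]
    define J where "J = (strip l a)"
    have J: "w * \<bar>\<xi> - l * of_int a\<bar> / h \<le> 1 / 6" if "\<xi> \<in> J" for \<xi>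
    proof -
      have "\<bar>\<xi> - l * of_int a\<bar> \<le> 2 * l" using that l by (auto simp: J_def abs_le_iff algebra_simps)
      then have "w * \<bar>\<xi> - l * of_int a\<bar> / h \<le> w * (2 * l) / h"
        using w h by (intro divide_right_mono mult_left_mono) auto
      also have "\<dots> \<le> 1 / 6" using h l by (simp add: w_def)
      finally show ?thesis .
    qed
    have m1: "(\<lambda>p. esq (\<Sum>b\<in>S. FT2 h H (f b) p) * indicator (J \<times> Q a) p) \<in> borel_measurable borel"
    proof -
      have "(\<lambda>p. \<Sum>b\<in>S. FT2 h H (f b) p) \<in> borel_measurable borel"
        by (intro borel_measurable_sum FT2_measurable fm)
      moreover have "J \<times> Q a \<in> sets borel" unfolding borel_prod[symmetric] by (auto simp: J_def)
      ultimately show ?thesis by measurable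
    qed
    have "(\<integral>\<^sup>+p. esq (\<Sum>b\<in>S. FT2 h H (f b) p) * indicator (J \<times> Q a) p \<partial>lborel)
       = (\<integral>\<^sup>+\<eta>. \<integral>\<^sup>+\<xi>. esq (\<Sum>b\<in>S. FT2 h H (f b) (\<xi>, \<eta>)) * indicator (J \<times> Q a) (\<xi>, \<eta>) \<partial>lborel \<partial>lborel)"
      unfolding nn_Fubini(1)[OF m1] by (rule nn_Fubini(2)[OF m1])
    also have "\<dots> \<le> (\<integral>\<^sup>+\<eta>. ennreal (20 * h) * (\<Sum>b\<in>S. \<integral>\<^sup>+x0. esq (FT H (V a b x0) \<eta>) * indicator (Q a) \<eta> \<partial>lborel) \<partial>lborel)"
    proof (rule nn_integral_mono)
      fix \<eta>
      show "(\<integral>\<^sup>+\<xi>. esq (\<Sum>b\<in>S. FT2 h H (f b) (\<xi>, \<eta>)) * indicator (J \<times> Q a) (\<xi>, \<eta>) \<partial>lborel)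
        \<le> ennreal (20 * h) * (\<Sum>b\<in>S. \<integral>\<^sup>+x0. esq (FT H (V a b x0) \<eta>) * indicator (Q a) \<eta> \<partial>lborel)"
      proof (cases "\<eta> \<in> Q a")
        case True
        define \<phi> where "\<phi> b x = FT H (\<lambda>y. f b (x, y)) \<eta>" for b x
        have "(\<integral>\<^sup>+\<xi>. esq (\<Sum>b\<in>S. FT h (\<phi> b) \<xi>) * indicator J \<xi> \<partial>lborel)
          \<le> ennreal (20 * h) * (\<Sum>b\<in>S. sqn (window_FT w (l * of_int a / h) (\<phi> b)))"
        proof (rule nn_integral_FT_strips[OF _ S h w _ _ J])
          show "test_fun (\<phi> b)" if "b \<in> S" for b
            unfolding \<phi>_def[abs_def] by (rule test_fun_partial_FT[OF f[OF that]])
          show "w \<le> sw" using sw by (simp add: w_def)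
          show "sw * (of_int b - 1) \<le> x \<and> x \<le> sw * (of_int b + 2)" if "b \<in> S" "\<phi> b x \<noteq> 0" for b x
          proof -
            have "\<exists>y. f b (x, y) \<noteq> 0"
            proof (rule ccontr)
              assume "\<nexists>y. f b (x, y) \<noteq> 0"
              then have "\<phi> b x = 0" by (simp add: \<phi>_def FT_def)
              with that show False by simp
            qed
            then show ?thesis using supp[OF that(1)] by blast
          qed
        qed
        moreover have "window_FT w (l * of_int a / h) (\<phi> b) x0 = FT H (V a b x0) \<eta>" if "b \<in> S" for b x0
          unfolding \<theta> \<phi>_def[abs_def] V_def[abs_def] by (rule window_FT_partial_FT[OF f[OF that] w])
        moreover have "FT2 h H (f b) (\<xi>, \<eta>) = FT h (\<phi> b) \<xi>" if "b \<in> S" for b \<xi>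
          unfolding \<phi>_def[abs_def] by (rule FT2_eq_iterated[OF f[OF that]])
        ultimately show ?thesis using True by (simp add: indicator_times cong: sum.cong)
      qed (simp add: indicator_times)
    qed
    also have "\<dots> = ennreal (20 * h) * (\<Sum>b\<in>S. \<integral>\<^sup>+\<eta>. \<integral>\<^sup>+x0. esq (FT H (V a b x0) \<eta>) * indicator (Q a) \<eta> \<partial>lborel \<partial>lborel)"
    proof -
      have [measurable]: "(\<lambda>\<eta>. \<integral>\<^sup>+x0. esq (FT H (V a b x0) \<eta>) * indicator (Q a) \<eta> \<partial>lborel) \<in> borel_measurable lborel" if "b \<in> S" for b
      proof -
        have [measurable]: "(\<lambda>q. FT H (V a b (snd q)) (fst q)) \<in> borel_measurable (borel \<Otimes>\<^sub>M borel)"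
          using measurable_compose[OF _ FVm[OF that, of a, unfolded borel_prod[symmetric]], of "\<lambda>q. (snd q, fst q)" "borel \<Otimes>\<^sub>M borel"]
          by simp
        have "(\<lambda>q. esq (FT H (V a b (snd q)) (fst q)) * indicator (Q a) (fst q)) \<in> borel_measurable (borel \<Otimes>\<^sub>M borel)"
          by measurable
        then have "(\<lambda>q. esq (FT H (V a b (snd q)) (fst q)) * indicator (Q a) (fst q)) \<in> borel_measurable (lborel \<Otimes>\<^sub>M lborel)"
          unfolding lborel_prod borel_prod by simp
        from lborel.borel_measurable_nn_integral_fst[OF this] show ?thesis by simp
      qed
      show ?thesis by (subst nn_integral_cmult) (auto intro!: borel_measurable_sum nn_integral_sum arg_cong2[of _ _ _ _ "(*)"])
    qed
    also have "\<dots> = ennreal (20 * h) * (\<Sum>b\<in>S. \<integral>\<^sup>+x0. \<integral>\<^sup>+\<eta>. esq (FT H (V a b x0) \<eta>) * indicator (Q a) \<eta> \<partial>lborel \<partial>lborel)"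
    proof (intro arg_cong2[of _ _ _ _ "(*)"] refl sum.cong)
      fix b assume b: "b \<in> S"
      note FVm[OF b, of a, unfolded borel_prod[symmetric], measurable]
      have "(\<lambda>q. esq (FT H (V a b (fst q)) (snd q)) * indicator (Q a) (snd q)) \<in> borel_measurable (borel \<Otimes>\<^sub>M borel)"
        by measurable
      from nn_Fubini(1)[OF this[unfolded borel_prod]]
      show "(\<integral>\<^sup>+\<eta>. \<integral>\<^sup>+x0. esq (FT H (V a b x0) \<eta>) * indicator (Q a) \<eta> \<partial>lborel \<partial>lborel)
        = (\<integral>\<^sup>+x0. \<integral>\<^sup>+\<eta>. esq (FT H (V a b x0) \<eta>) * indicator (Q a) \<eta> \<partial>lborel \<partial>lborel)" by simp
    qed
    also have "\<dots> \<le> ennreal (20 * h) * (\<Sum>b\<in>S. \<integral>\<^sup>+x0. ennreal (r * H) * sqn (V a b x0) \<partial>lborel)"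
      by (intro mult_left_mono sum_mono nn_integral_mono fup[OF a _ Vt Vsupp]) auto
    also have "\<dots> = ennreal (20 * h) * (\<Sum>b\<in>S. ennreal (r * H) * (\<integral>\<^sup>+x0. sqn (V a b x0) \<partial>lborel))"
    proof (intro arg_cong2[of _ _ _ _ "(*)"] refl sum.cong)
      fix b assume b: "b \<in> S"
      note Vm[OF b, of a, unfolded borel_prod[symmetric], measurable]
      show "(\<integral>\<^sup>+x0. ennreal (r * H) * sqn (V a b x0) \<partial>lborel) = ennreal (r * H) * (\<integral>\<^sup>+x0. sqn (V a b x0) \<partial>lborel)"
        by (rule nn_integral_cmult) measurable
    qed
    finally show ?thesis unfolding J_def sum_distrib_left .
  qed
  have two: "(\<Sum>a\<in>A. \<integral>\<^sup>+x0. sqn (V a b x0) \<partial>lborel) \<le> ennreal 16 * sqn (f b)" if b: "b \<in> S" for b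
  proof -
    note Vm[OF b, unfolded borel_prod[symmetric], measurable]
    note [measurable] = fm[OF b]
    have [measurable]: "(\<lambda>q. V a b (snd q) (fst q)) \<in> borel_measurable (borel \<Otimes>\<^sub>M borel)" for a
      using measurable_compose[OF _ Vm[OF b, of a, unfolded borel_prod[symmetric]], of "\<lambda>q. (snd q, fst q)" "borel \<Otimes>\<^sub>M borel"]
      by simp
    have Vm2: "(\<lambda>q. esq (V a b (fst q) (snd q))) \<in> borel_measurable (borel \<Otimes>\<^sub>M borel)" for a by measurable
    have "(\<Sum>a\<in>A. \<integral>\<^sup>+x0. sqn (V a b x0) \<partial>lborel)
        = (\<Sum>a\<in>A. \<integral>\<^sup>+y. \<integral>\<^sup>+x0. esq (V a b x0 y) \<partial>lborel \<partial>lborel)"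
      using nn_Fubini(1)[OF Vm2[unfolded borel_prod]] by simp
    also have "\<dots> = (\<integral>\<^sup>+y. (\<Sum>a\<in>A. \<integral>\<^sup>+x0. esq (V a b x0 y) \<partial>lborel) \<partial>lborel)"
      by (rule nn_integral_sum[symmetric]) measurable
    also have "\<dots> \<le> (\<integral>\<^sup>+y. ennreal 16 * sqn (\<lambda>x. f b (x, y)) \<partial>lborel)"
    proof (rule nn_integral_mono)
      fix y
      show "(\<Sum>a\<in>A. \<integral>\<^sup>+x0. esq (V a b x0 y) \<partial>lborel) \<le> ennreal 16 * sqn (\<lambda>x. f b (x, y))"
        using sum_sqn_window_FT_le[OF test_fun_sections(1)[OF f[OF b], of y] A w]
        by (simp add: V_def \<theta>_def)
    qed
    also have "\<dots> = ennreal 16 * (\<integral>\<^sup>+y. sqn (\<lambda>x. f b (x, y)) \<partial>lborel)"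
      by (rule nn_integral_cmult) measurable
    also have "(\<integral>\<^sup>+y. sqn (\<lambda>x. f b (x, y)) \<partial>lborel) = sqn (f b)"
      using nn_Fubini[of "\<lambda>q. esq (f b q)"] by simp
    finally show ?thesis .
  qed
  have "(\<Sum>a\<in>A. \<integral>\<^sup>+p. esq (\<Sum>b\<in>S. FT2 h H (f b) p) *
            indicator ((strip l a) \<times> Q a) p \<partial>lborel)
     \<le> (\<Sum>a\<in>A. ennreal (20 * h) * (ennreal (r * H) * (\<Sum>b\<in>S. \<integral>\<^sup>+x0. sqn (V a b x0) \<partial>lborel)))"
    by (rule sum_mono) (rule one)
  also have "\<dots> = ennreal (20 * h) * (ennreal (r * H) * (\<Sum>b\<in>S. \<Sum>a\<in>A. \<integral>\<^sup>+x0. sqn (V a b x0) \<partial>lborel))"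
    unfolding sum_distrib_left[symmetric] by (subst sum.swap) (rule refl)
  also have "\<dots> \<le> ennreal (20 * h) * (ennreal (r * H) * (\<Sum>b\<in>S. ennreal 16 * sqn (f b)))"
    by (intro mult_left_mono sum_mono two) auto
  also have "\<dots> = (ennreal (20 * h) * (ennreal (r * H) * ennreal 16)) * (\<Sum>b\<in>S. sqn (f b))"
    by (simp add: sum_distrib_left mult.assoc del: ennreal_numeral)
  also have "ennreal (20 * h) * (ennreal (r * H) * ennreal 16) = ennreal (320 * r * (h * H))"
    using h r H by (simp add: ennreal_mult[symmetric] mult_ac del: ennreal_numeral)
  finally show ?thesis .
qed

section \<open>Cantor sets and digits\<close>

text \<open>A continuous image of the space of digit sequences, which is compact by Tychonoff's theorem. Compactness
  makes the neighbourhoods of the carpets closed, hence measurable.\<close>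

lemma compact_limit_Cantor_set:
  assumes M: "M1 \<ge> 2" "M2 \<ge> 2" and A: "finite A"
  shows "compact (limit_Cantor_set M1 M2 A)"
proof -
  define F where "F c = ((\<Sum>j. real (fst (c j)) / real M1 ^ Suc j), (\<Sum>j. real (snd (c j)) / real M2 ^ Suc j))"
    for c :: "nat \<Rightarrow> nat \<times> nat"
  define \<Omega> where "\<Omega> = PiE (UNIV :: nat set) (\<lambda>_. A)"
  have "compactin (product_topology (\<lambda>_. euclidean) UNIV) \<Omega>"
    unfolding \<Omega>_def compactin_PiE using A by (simp add: finite_imp_compact)
  then have cO: "compact \<Omega>" by (simp add: euclidean_product_topology)
  have cont: "continuous_on \<Omega> (\<lambda>c. \<Sum>j. real (p (c j)) / real M ^ Suc j)"
    if M: "M \<ge> 2" and p: "continuous_on UNIV p" for M :: nat and p :: "nat \<times> nat \<Rightarrow> nat"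
  proof (rule uniform_limit_theorem[OF _ _ sequentially_bot])
    define b where "b = Max (insert 0 (p ` A))"
    have b: "p (c j) \<le> b" if "c \<in> \<Omega>" for c j
      unfolding b_def using that A by (intro Max_ge) (auto simp: \<Omega>_def PiE_def Pi_def)
    show "uniform_limit \<Omega> (\<lambda>n c. \<Sum>j<n. real (p (c j)) / real M ^ Suc j) (\<lambda>c. \<Sum>j. real (p (c j)) / real M ^ Suc j) sequentially"
    proof (rule Weierstrass_m_test)
      fix j c assume "c \<in> \<Omega>"
      then show "norm (real (p (c j)) / real M ^ Suc j) \<le> real b * (1 / real M) ^ Suc j"
        using b[of c j] by (simp add: power_divide divide_right_mono)
    next
      have "summable (\<lambda>j. (1 / real M) ^ Suc j)"
        using M by (subst summable_Suc_iff) (auto intro!: summable_geometric)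
      then show "summable (\<lambda>j. real b * (1 / real M) ^ Suc j)" by (rule summable_mult)
    qed
    show "\<forall>\<^sub>F n in sequentially. continuous_on \<Omega> (\<lambda>c. \<Sum>j<n. real (p (c j)) / real M ^ Suc j)"
    proof (intro always_eventually allI continuous_on_sum)
      fix j :: nat
      have "continuous_on \<Omega> (\<lambda>c. c j)" by (rule continuous_on_subset[OF continuous_on_product_coordinates]) simp
      then have "continuous_on \<Omega> (\<lambda>c. p (c j))" by (rule continuous_on_compose2[OF p]) auto
      moreover have "continuous_on UNIV (\<lambda>n::nat. real n / real M ^ Suc j)" by simp
      ultimately show "continuous_on \<Omega> (\<lambda>c. real (p (c j)) / real M ^ Suc j)"
        using continuous_on_compose2 by blast
    qed
  qed
  have "continuous_on \<Omega> F" unfolding F_def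
    by (intro continuous_on_Pair cont M continuous_on_fst continuous_on_snd continuous_on_id)
  then have "compact (F ` \<Omega>)" using cO by (rule compact_continuous_image)
  moreover have "F ` \<Omega> = limit_Cantor_set M1 M2 A"
    unfolding limit_Cantor_set_def F_def \<Omega>_def by (auto simp: PiE_def Pi_def)
  ultimately show ?thesis by simp
qed

lemma compact_Cantor_plus_box:
  assumes "M1 \<ge> 2" "M2 \<ge> 2" "finite A"
  shows "compact (limit_Cantor_set M1 M2 A + ani_box \<alpha> h)"
proof -
  have "compact (ani_box \<alpha> h)" unfolding ani_box_def by (intro compact_Times compact_Icc)
  from compact_sums'[OF compact_limit_Cantor_set[OF assms] this]
  show ?thesis unfolding set_plus_def by (rule back_subst[of compact]) auto
qed

fun digit_prefix :: "nat \<Rightarrow> (nat \<Rightarrow> nat) \<Rightarrow> nat \<Rightarrow> nat" where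
  "digit_prefix M c 0 = 0"
| "digit_prefix M c (Suc n) = M * digit_prefix M c n + c n"

lemma digit_prefix_less:
  assumes "\<And>j. c j < M" shows "digit_prefix M c n < M ^ n"
proof (induction n)
  case (Suc n)
  have "M * digit_prefix M c n + c n < M * (digit_prefix M c n + 1)" using assms[of n] by simp
  also have "\<dots> \<le> M * M ^ n" using Suc by (intro mult_left_mono) auto
  finally show ?case by simp
qed simp

lemma digit_prefix_div:
  assumes "\<And>j. c j < M" shows "digit_prefix M c (n + m) div M ^ m = digit_prefix M c n"
proof (induction m)
  case (Suc m)
  have "digit_prefix M c (n + Suc m) div M ^ Suc m = (digit_prefix M c (n + Suc m) div M) div M ^ m"
    by (simp add: div_mult2_eq)
  also have "digit_prefix M c (n + Suc m) div M = digit_prefix M c (n + m)"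
    using assms[of "n + m"] by simp
  finally show ?case using Suc by simp
qed simp

lemma digit_prefix_digit:
  assumes c: "\<And>j. c j < M" and i: "i < n"
  shows "digit_prefix M c n div M ^ (n - 1 - i) mod M = c i"
proof -
  have "digit_prefix M c n div M ^ (n - 1 - i) = digit_prefix M c (Suc i)"
    using digit_prefix_div[where c=c and M=M and n="Suc i" and m="n - 1 - i"] c i by simp
  then show ?thesis using c[of i] by simp
qed

lemma digit_expansion:
  assumes M: "M \<ge> 2" and c: "\<And>j. c j < M"
  defines "x \<equiv> (\<Sum>j. real (c j) / real M ^ Suc j)"
  shows "real (digit_prefix M c n) \<le> real M ^ n * x" "real M ^ n * x \<le> real (digit_prefix M c n) + 1"
proof -
  define T where "T n = (\<Sum>j. real (c (j + n)) / real M ^ Suc j)" for n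
  have geo: "(\<lambda>j. (real M - 1) * (1 / real M) ^ Suc j) sums ((real M - 1) * (1 / real M / (1 - 1 / real M)))"
  proof -
    have "(\<lambda>j. (1 / real M) ^ j) sums (1 / (1 - 1 / real M))" using M by (intro geometric_sums) auto
    from sums_mult[OF this, of "(real M - 1) * (1 / real M)"] show ?thesis by (simp add: mult.assoc)
  qed
  have one: "(real M - 1) * (1 / real M / (1 - 1 / real M)) = 1" using M by (simp add: field_simps)
  have le: "real (c (j + n)) / real M ^ Suc j \<le> (real M - 1) * (1 / real M) ^ Suc j" for j n
  proof -
    have "real (c (j + n)) \<le> real M - 1" using c[of "j + n"] by linarith
    then show ?thesis by (simp add: power_divide divide_right_mono)
  qed
  have sm: "summable (\<lambda>j. real (c (j + n)) / real M ^ Suc j)" for n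
    by (rule summable_comparison_test'[OF sums_summable[OF geo]]) (use le in auto)
  have T0: "0 \<le> T n" for n unfolding T_def by (intro suminf_nonneg sm) auto
  have T1: "T n \<le> 1" for n
    unfolding T_def using suminf_le[OF le sm sums_summable[OF geo]] sums_unique[OF geo] one by simp
  have T_Suc: "real M * T n = real (c n) + T (Suc n)" for n
  proof -
    have "T n = real (c n) / real M + (\<Sum>j. real (c (Suc j + n)) / real M ^ Suc (Suc j))"
      unfolding T_def using suminf_split_head[OF sm[of n]] by simp
    also have "(\<Sum>j. real (c (Suc j + n)) / real M ^ Suc (Suc j)) = (\<Sum>j. (1 / real M) * (real (c (j + Suc n)) / real M ^ Suc j))"
      by simp
    also have "\<dots> = (1 / real M) * T (Suc n)" unfolding T_def by (rule suminf_mult[OF sm])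
    finally show ?thesis using M by (simp add: field_simps)
  qed
  have "real M ^ n * x = real (digit_prefix M c n) + T n"
  proof (induction n)
    case 0 then show ?case by (simp add: x_def T_def)
  next
    case (Suc n)
    have "real M ^ Suc n * x = real M * (real M ^ n * x)" by simp
    also have "\<dots> = real M * real (digit_prefix M c n) + real M * T n" unfolding Suc by (simp add: distrib_left)
    finally show ?case unfolding T_Suc by simp
  qed
  then show "real (digit_prefix M c n) \<le> real M ^ n * x" "real M ^ n * x \<le> real (digit_prefix M c n) + 1"
    using T0[of n] T1[of n] by auto
qed

text \<open>Strips are numbered by integers; this reads off the digit number \<open>i\<close>, counted from the leading one,
  of the word of length \<open>n\<close> that belongs to the strip \<open>k\<close>.\<close>

definition word_digit :: "nat \<Rightarrow> nat \<Rightarrow> int \<Rightarrow> nat \<Rightarrow> nat" where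
  "word_digit M n k i = nat ((k div int M ^ (n - 1 - i)) mod int M)"

lemma word_digit_less: "M > 0 \<Longrightarrow> word_digit M n k i < M"
  unfolding word_digit_def by (simp add: nat_less_iff)

lemma word_digit_prefix:
  assumes "\<And>j. c j < M" "i < n"
  shows "word_digit M n (int (digit_prefix M c n)) i = c i"
  unfolding word_digit_def using digit_prefix_digit[of c M i n] assms
  by (metis nat_int of_nat_power zdiv_int zmod_int)

text \<open>The digits beyond level \<open>n\<close> and the perturbation move \<open>x\<close> by at most one cell each.\<close>

lemma strip_bounds:
  assumes M: "M \<ge> 2" and c: "\<And>j. c j < M" and \<epsilon>: "\<epsilon> * real M ^ n \<le> 1"
    and x: "\<bar>x - (\<Sum>j. real (c j) / real M ^ Suc j)\<bar> \<le> \<epsilon>"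
  defines "k \<equiv> real (digit_prefix M c n)"
  shows "1 / real M ^ n * (k - 1) \<le> x" "x \<le> 1 / real M ^ n * (k + 2)" "\<bar>x - k / real M ^ n\<bar> \<le> 2 / real M ^ n"
proof -
  define y where "y = (\<Sum>j. real (c j) / real M ^ Suc j)"
  have P: "real M ^ n > 0" using M by simp
  have y: "k \<le> real M ^ n * y" "real M ^ n * y \<le> k + 1"
    using digit_expansion[where M=M and c=c and n=n] M c unfolding k_def y_def by auto
  have "real M ^ n * \<bar>x - y\<bar> \<le> real M ^ n * \<epsilon>" using x P unfolding y_def by (intro mult_left_mono) auto
  moreover have "real M ^ n * \<bar>x - y\<bar> = \<bar>real M ^ n * x - real M ^ n * y\<bar>"
    using P by (simp only: right_diff_distrib[symmetric] abs_mult abs_of_pos)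
  ultimately have "\<bar>real M ^ n * x - real M ^ n * y\<bar> \<le> 1"
    using \<epsilon> by (simp only: mult.commute)
  then have 1: "k - 1 \<le> real M ^ n * x" "real M ^ n * x \<le> k + 2" using y by linarith+
  show "1 / real M ^ n * (k - 1) \<le> x" "x \<le> 1 / real M ^ n * (k + 2)"
    using 1 P by (simp_all add: field_simps)
  have "\<bar>real M ^ n * x - k\<bar> \<le> 2" using 1 by linarith
  moreover have "x - k / real M ^ n = (real M ^ n * x - k) / real M ^ n" using P by (simp add: field_simps)
  ultimately show "\<bar>x - k / real M ^ n\<bar> \<le> 2 / real M ^ n" using P by (simp add: abs_divide divide_right_mono)
qed

text \<open>Multiplication by \<open>M^i\<close> moves the digit \<open>c i\<close> to the leading place modulo \<open>1\<close>. As \<open>c i \<noteq> d\<close>, the point stays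
  half a cell away from the centre \<open>(d + 1/2) / M\<close> of the cell of \<open>d\<close>, and the perturbation costs at most
  half of this distance.\<close>

lemma gap_avoided:
  assumes M: "M \<ge> 2" and c: "\<And>j. c j < M" and \<epsilon>: "\<epsilon> * real M ^ Suc i \<le> 1 / 4"
    and x: "\<bar>x - (\<Sum>j. real (c j) / real M ^ Suc j)\<bar> \<le> \<epsilon>" and d: "d < M" "c i \<noteq> d"
  shows "1 / (4 * real M) \<le> \<bar>real M ^ i * x - (real d + 1 / 2) / real M - real_of_int z\<bar>"
proof -
  define y where "y = (\<Sum>j. real (c j) / real M ^ Suc j)"
  define k where "k = int (digit_prefix M c i)"
  define m where "m = int M * (k - z) + (int (c i) - int d)"
  have M0: "real M > 0" using M by simp
  have "m \<noteq> 0"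
  proof
    assume "m = 0"
    then have "int M dvd int (c i) - int d" unfolding m_def by (metis add.commute add_eq_0_iff dvd_minus_iff dvd_triv_left)
    then have "int (c i) - int d = 0" using dvd_imp_le_int[of "int (c i) - int d" "int M"] c[of i] d by linarith
    then show False using d by simp
  qed
  then have m: "1 \<le> \<bar>m\<bar>" by simp
  have "real (digit_prefix M c (Suc i)) \<le> real M ^ Suc i * y" "real M ^ Suc i * y \<le> real (digit_prefix M c (Suc i)) + 1"
    using digit_expansion[where M=M and c=c and n="Suc i"] M c unfolding y_def by auto
  moreover have "real (digit_prefix M c (Suc i)) = real M * real_of_int k + real (c i)" by (simp add: k_def)
  ultimately have y: "real M * real_of_int k + real (c i) \<le> real M ^ Suc i * y" "real M ^ Suc i * y \<le> real M * real_of_int k + real (c i) + 1"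
    by linarith+
  have "real M ^ Suc i * \<bar>x - y\<bar> \<le> real M ^ Suc i * \<epsilon>" using x M0 unfolding y_def by (intro mult_left_mono) auto
  moreover have "real M ^ Suc i * \<bar>x - y\<bar> = \<bar>real M ^ Suc i * x - real M ^ Suc i * y\<bar>"
    using M0 by (simp only: right_diff_distrib[symmetric] abs_mult abs_of_pos zero_less_power)
  ultimately have "\<bar>real M ^ Suc i * x - real M ^ Suc i * y\<bar> \<le> 1 / 4"
    using \<epsilon> by (simp only: mult.commute)
  moreover have "real_of_int m = real M * real_of_int k + real (c i) - real d - real M * real_of_int z"
    by (simp add: m_def algebra_simps)
  moreover have "1 \<le> \<bar>real_of_int m\<bar>" using m by linarith
  ultimately have "1 / 4 \<le> \<bar>real M ^ Suc i * x - (real d + 1 / 2) - real M * real_of_int z\<bar>"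
    using y by linarith
  also have "real M ^ Suc i * x - (real d + 1 / 2) - real M * real_of_int z
    = real M * (real M ^ i * x - (real d + 1 / 2) / real M - real_of_int z)" using M0 by (simp add: field_simps)
  finally have "1 / 4 \<le> real M * \<bar>real M ^ i * x - (real d + 1 / 2) / real M - real_of_int z\<bar>"
    using M0 by (simp add: abs_mult)
  then show ?thesis using M0 by (simp add: field_simps)
qed

section \<open>Choice of the scales\<close>

text \<open>With \<open>D = M^s\<close> and \<open>N = O(D t^s)\<close>, where \<open>t = (M - 1) / M < 1\<close>, the interpolation loss is \<open>(2 D)^O(N)\<close>,
  whose logarithm \<open>O(s t^s D)\<close> is \<open>o(D)\<close>; the smallness of the bump is exponential in \<open>D\<close>.\<close>

lemma block_length_exists:
  assumes M: "M \<ge> 2" and \<kappa>: "0 < \<kappa>" "\<kappa> < 1"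
  shows "\<exists>s\<ge>1. real (lattice_hits M s) / (4 * real (M ^ s)) \<le> \<kappa> / 2 \<and>
    bump_wins (M ^ s) (lattice_hits M s) \<kappa>"
proof -
  define t where "t = (real M - 1) / real M"
  have t: "0 \<le> t" "t < 1" "1 / real M \<le> t" using M by (auto simp: t_def divide_right_mono)
  define c0 where "c0 = real ((6 * M + 6) * (6 * M + 3))"
  have c0: "c0 > 0" by (simp add: c0_def)
  define q where "q = cos (pi * (\<kappa> / 2))"
  have "0 < q" unfolding q_def using \<kappa> by (intro cos_gt_zero_pi) (auto intro: less_trans[of _ 0])
  moreover have "q < cos 0" unfolding q_def using \<kappa> by (intro cos_monotone_0_pi) auto
  ultimately have q: "0 < q" "q < 1" by auto
  define lq where "lq = - ln q"
  have lq: "lq > 0" using q by (simp add: lq_def)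
  have rM1: "real (M - 1) = real M - 1" using M by simp
  have Nt: "real (lattice_hits M s) = c0 * t ^ s * real (M ^ s)" for s
    using M by (simp add: lattice_hits_def c0_def t_def power_divide rM1 mult_ac del: of_nat_mult of_nat_add)
       (simp add: rM1 mult_ac of_nat_diff)
  have lim1: "(\<lambda>s. c0 * t ^ s) \<longlonglongrightarrow> c0 * 0"
    using t by (intro tendsto_mult tendsto_const LIMSEQ_realpow_zero) auto
  have lim2: "(\<lambda>s. ln (real M) * (2 * c0 + 8) * (real s * t ^ s + t ^ s)) \<longlonglongrightarrow> ln (real M) * (2 * c0 + 8) * (0 + 0)"
    using t by (intro tendsto_mult tendsto_const tendsto_add LIMSEQ_realpow_zero powser_times_n_limit_0) auto
  have e1: "\<forall>\<^sub>F s in sequentially. c0 * t ^ s < min (2 * \<kappa>) 1"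
    using order_tendstoD(2)[OF lim1, of "min (2 * \<kappa>) 1"] \<kappa> by simp
  have e2: "\<forall>\<^sub>F s in sequentially. ln (real M) * (2 * c0 + 8) * (real s * t ^ s + t ^ s) < 4 * lq"
    using order_tendstoD(2)[OF lim2, of "4 * lq"] lq by simp
  obtain s where s: "c0 * t ^ s < min (2 * \<kappa>) 1" "ln (real M) * (2 * c0 + 8) * (real s * t ^ s + t ^ s) < 4 * lq" "s \<ge> 1"
    using eventually_happens[OF eventually_conj[OF eventually_conj[OF e1 e2] eventually_ge_at_top[of 1]]] by auto
  define D where "D = M ^ s"
  define N where "N = lattice_hits M s"
  have D1: "real D \<ge> 1" using M by (simp add: D_def)
  have ND: "real N = c0 * t ^ s * real D" by (simp add: N_def D_def Nt)
  have "real N / (4 * real D) \<le> \<kappa> / 2" using s(1) D1 unfolding ND by simp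
  moreover have "4 * (step_weight D N)\<^sup>2 * (real N + 1)\<^sup>2 * q ^ (4 * D) \<le> 1"
  proof -
    have "real N \<le> 1 * real D" unfolding ND using s(1) by (intro mult_right_mono) auto
    then have N: "real N + 1 \<le> 2 * real D" using D1 by linarith
    have "step_weight D N \<le> 2 * real D * (2 * real D) * (2 * real D) ^ N"
      unfolding step_weight_def using N by (intro mult_right_mono mult_left_mono) auto
    moreover have "0 \<le> step_weight D N" by (simp add: step_weight_def)
    ultimately have "(step_weight D N)\<^sup>2 \<le> (2 * real D * (2 * real D) * (2 * real D) ^ N)\<^sup>2" by (intro power_mono)
    moreover have "(real N + 1)\<^sup>2 \<le> (2 * real D)\<^sup>2" using N by (intro power_mono) auto
    moreover have "4 \<le> (2 * real D)\<^sup>2" using D1 power_mono[of 2 "2 * real D" 2] by simp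
    ultimately have "4 * (step_weight D N)\<^sup>2 * (real N + 1)\<^sup>2 * q ^ (4 * D)
       \<le> (2 * real D)\<^sup>2 * (2 * real D * (2 * real D) * (2 * real D) ^ N)\<^sup>2 * (2 * real D)\<^sup>2 * q ^ (4 * D)"
      using q by (intro mult_right_mono mult_mono) auto
    also have "\<dots> = (2 * real D) ^ (2 * N + 8) * q ^ (4 * D)"
      by (simp add: power_add power_mult power2_eq_square power_mult_distrib eval_nat_numeral mult_ac)
    also have "\<dots> = exp (ln ((2 * real D) ^ (2 * N + 8) * q ^ (4 * D)))" using D1 q by simp
    also have "ln ((2 * real D) ^ (2 * N + 8) * q ^ (4 * D)) = real (2 * N + 8) * ln (2 * real D) - real (4 * D) * lq"
      using D1 q by (simp add: ln_mult ln_realpow lq_def distrib_left)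
    also have "\<dots> \<le> 0"
    proof -
      have "ln (2 * real D) \<le> ln (real M * real M ^ s)" using M by (intro ln_mono) (auto simp: D_def)
      also have "\<dots> = (real s + 1) * ln (real M)" using M by (simp add: ln_mult ln_realpow algebra_simps)
      finally have lnD: "ln (2 * real D) \<le> (real s + 1) * ln (real M)" .
      have "1 \<le> t ^ s * real D"
      proof -
        have "(1 / real M) ^ s \<le> t ^ s" using t by (intro power_mono) auto
        then have "(1 / real M) ^ s * real D \<le> t ^ s * real D" by (intro mult_right_mono) auto
        moreover have "(1 / real M) ^ s * real D = 1" using M by (simp add: D_def power_divide)
        ultimately show ?thesis by simp
      qed
      then have "real (2 * N + 8) \<le> (2 * c0 + 8) * (t ^ s * real D)" by (simp add: ND algebra_simps)
      then have "real (2 * N + 8) * ln (2 * real D) \<le> ((2 * c0 + 8) * (t ^ s * real D)) * ((real s + 1) * ln (real M))"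
        using lnD D1 c0 t by (intro mult_mono) auto
      also have "\<dots> = real D * (ln (real M) * (2 * c0 + 8) * (real s * t ^ s + t ^ s))" by (simp add: algebra_simps)
      also have "\<dots> \<le> real D * (4 * lq)" using s(2) by (intro mult_left_mono) auto
      finally show ?thesis by simp
    qed
    finally show ?thesis by simp
  qed
  ultimately show ?thesis using s(3) unfolding D_def N_def q_def by blast
qed

text \<open>The level \<open>j\<close> of \<open>y\<close> can be used if its digit of \<open>x\<close> is fixed on the strips, if the box does not blur it, and if
  the spacing \<open>H M1^j\<close> that belongs to it is comparable to a scale of \<open>\<eta>\<close> whose last \<open>s\<close> digits are
  fixed on the strips in \<open>\<xi>\<close>.\<close>

abbreviation usable_level :: "nat \<Rightarrow> nat \<Rightarrow> nat \<Rightarrow> real \<Rightarrow> real \<Rightarrow> nat \<Rightarrow> nat \<Rightarrow> nat \<Rightarrow> bool" where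
  "usable_level M1 M2 s h H i0 j0 j \<equiv> j < j0 \<and> h * real M1 ^ Suc j \<le> 1 / 4 \<and>
     (\<exists>I. s \<le> I \<and> I \<le> i0 \<and> H * real M1 ^ j * real M2 ^ I \<le> 1 \<and> 1 < H * real M1 ^ j * real M2 ^ Suc I)"

text \<open>The fourth condition is the uncertainty principle for the strips: their widths have product at
  least \<open>h\<close>. The conditions before it say that the box is no larger than the strips and the
  cells of level \<open>i0\<close> in \<open>\<eta>\<close>.\<close>

abbreviation scale_data :: "nat \<Rightarrow> nat \<Rightarrow> nat \<Rightarrow> real \<Rightarrow> real \<Rightarrow> nat \<Rightarrow> nat \<Rightarrow> nat \<Rightarrow> nat \<Rightarrow> bool" where
  "scale_data M1 M2 s h H i0 j0 js K \<equiv> h * real M1 ^ i0 \<le> 1 \<and> H * real M2 ^ i0 \<le> 1 \<and> H * real M2 ^ j0 \<le> 1 \<and>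
     h * real M1 ^ i0 * real M2 ^ j0 \<le> 1 \<and> (\<forall>k<K. usable_level M1 M2 s h H i0 j0 (js + s * k))"

text \<open>For \<open>h = M1\<^sup>-\<^sup>L\<close> the choices are \<open>i0 = (1 - \<alpha>\<^sup>2) L\<close>, \<open>j0 = \<alpha> L\<close> and the levels
  \<open>js + s k\<close> starting from \<open>js = \<alpha>^3 L\<close>, up to rounding. Every quantity is a power of \<open>M1\<close>, as \<open>M2 = M1 powr \<alpha>\<close>, so
  that each inequality becomes a linear one between exponents.\<close>

lemma scale_exponents:
  fixes M1 M2 s :: nat and \<rho> :: real
  assumes M: "M2 \<ge> 2" "M1 > M2" and s: "s \<ge> 1" and \<rho>: "0 < \<rho>" "\<rho> < 1"
  defines "\<alpha> \<equiv> ln (real M2) / ln (real M1)"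
  shows "\<exists>\<beta>>0. \<exists>C>0. \<forall>h\<in>{0<..<1::real}. \<exists>i0 j0 js K :: nat.
     scale_data M1 M2 s h (h powr \<alpha>) i0 j0 js K \<and> \<rho> ^ K \<le> C * h powr \<beta>"
proof -
  have l1: "ln (real M1) > 0" and l2: "ln (real M2) > 0" using M by auto
  have \<alpha>: "0 < \<alpha>" "\<alpha> < 1" unfolding \<alpha>_def using M l1 l2 by (auto simp: divide_less_eq)
  have M21: "real M2 powr x = real M1 powr (\<alpha> * x)" for x
    using M l1 by (simp add: powr_def \<alpha>_def)
  have M1p: "real M1 ^ n = real M1 powr real n" "real M2 ^ n = real M1 powr (\<alpha> * real n)" for n
    using M by (simp_all add: powr_realpow M21[symmetric])
  have M1gt: "real M1 > 1" using M by simp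
  define c1 where "c1 = (\<alpha> - \<alpha> ^ 3) / real s"
  define c2 where "c2 = (\<alpha> * real s + 1) / real s + 2"
  have c1: "c1 > 0"
  proof -
    have "\<alpha> ^ 3 < \<alpha> ^ 1" using \<alpha> by (intro power_strict_decreasing) auto
    then show ?thesis using s by (simp add: c1_def)
  qed
  have c2: "c2 > 0" using \<alpha> s by (simp add: c2_def add_nonneg_pos)
  define L0 where "L0 = 3 / (1 - \<alpha>)"
  have L0: "L0 > 0" using \<alpha> by (simp add: L0_def)
  define \<beta> where "\<beta> = c1 * (- ln \<rho>) / ln (real M1)"
  have \<beta>: "\<beta> > 0" unfolding \<beta>_def using c1 \<rho> l1 by (intro divide_pos_pos mult_pos_pos) auto
  define C where "C = max (\<rho> powr (- c2)) (real M1 powr (L0 * \<beta>))"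
  have C: "C > 0" using \<rho> by (simp add: C_def less_max_iff_disj)
  have "\<exists>i0 j0 js K :: nat.
     scale_data M1 M2 s h (h powr \<alpha>) i0 j0 js K \<and> \<rho> ^ K \<le> C * h powr \<beta>" if h: "0 < h" "h < 1" for h
  proof -
    define L where "L = - ln h / ln (real M1)"
    have L: "L > 0" unfolding L_def using h l1 by (intro divide_pos_pos) auto
    have hL: "h = real M1 powr (- L)" using h l1 M by (simp add: L_def powr_def)
    have HL: "h powr \<alpha> = real M1 powr (- \<alpha> * L)" using M by (simp add: hL powr_powr mult.commute)
    have h\<beta>: "h powr \<beta> = real M1 powr (- L * \<beta>)" using M by (simp add: hL powr_powr mult.commute)
    \<comment> \<open>For \<open>L < L0\<close> no step is made: \<open>h\<close> is bounded below, and \<open>C\<close> absorbs the trivial bound.\<close>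
    show ?thesis
    proof (cases "L < L0")
      case True
      have "1 \<le> real M1 powr (L0 * \<beta> - L * \<beta>)" using True \<beta> M1gt by (intro ge_one_powr_ge_zero) auto
      also have "\<dots> = real M1 powr (L0 * \<beta>) * h powr \<beta>" unfolding h\<beta> using M by (simp add: powr_add[symmetric])
      also have "\<dots> \<le> C * h powr \<beta>" by (intro mult_right_mono) (auto simp: C_def)
      finally have "\<rho> ^ 0 \<le> C * h powr \<beta>" by simp
      moreover have "h powr \<alpha> \<le> 1" using h \<alpha> by (intro powr_le1) auto
      ultimately show ?thesis using h by (intro exI[of _ 0]) auto
    next
      case False
      define i0 where "i0 = nat \<lfloor>(1 - \<alpha>\<^sup>2) * L\<rfloor>"
      define j0 where "j0 = nat \<lfloor>\<alpha> * L\<rfloor>"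
      define js where "js = nat \<lceil>\<alpha> ^ 3 * L\<rceil>"
      define K where "K = nat \<lfloor>c1 * L - c2 + 1\<rfloor>"
      have a2: "0 < \<alpha>\<^sup>2" "\<alpha>\<^sup>2 < 1" using \<alpha> by (auto simp: power_less_one_iff)
      have a21: "0 \<le> (1 - \<alpha>\<^sup>2) * L" using a2 L by simp
      have i0: "real i0 \<le> (1 - \<alpha>\<^sup>2) * L" unfolding i0_def using a21 by linarith
      have i0L: "real i0 \<le> L" using i0 a2 L mult_right_mono[of "1 - \<alpha>\<^sup>2" 1 L] by linarith
      have aL: "0 \<le> \<alpha> * L" using \<alpha> L by simp
      have j0: "real j0 \<le> \<alpha> * L" unfolding j0_def using aL by linarith
      have j0L: "real j0 \<le> L" using j0 \<alpha> L mult_right_mono[of \<alpha> 1 L] by linarith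
      have a3: "0 \<le> \<alpha> ^ 3 * L" using \<alpha> L by simp
      have js: "\<alpha> ^ 3 * L \<le> real js" "real js \<le> \<alpha> ^ 3 * L + 1" unfolding js_def using a3 by linarith+
      have le1: "real M1 powr x \<le> 1" if "x \<le> 0" for x
        using powr_mono[OF that, of "real M1"] M1gt by simp
      have 1: "h * real M1 ^ i0 \<le> 1"
        unfolding hL M1p powr_add[symmetric] using i0L by (intro le1) auto
      have 2: "h powr \<alpha> * real M2 ^ i0 \<le> 1"
        unfolding HL M1p powr_add[symmetric] using i0L \<alpha> by (intro le1) auto
      have 3: "h powr \<alpha> * real M2 ^ j0 \<le> 1"
        unfolding HL M1p powr_add[symmetric] using j0L \<alpha> by (intro le1) auto
      have 4: "h * real M1 ^ i0 * real M2 ^ j0 \<le> 1"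
      proof -
        have "\<alpha> * real j0 \<le> \<alpha> * (\<alpha> * L)" using j0 \<alpha> by (intro mult_left_mono) auto
        then have "- L + real i0 + \<alpha> * real j0 \<le> 0" using i0 by (simp add: power2_eq_square algebra_simps)
        then show ?thesis unfolding hL M1p powr_add[symmetric] by (rule le1)
      qed
      have 5: "\<rho> ^ K \<le> C * h powr \<beta>"
      proof -
        have "c1 * L - c2 \<le> real K" unfolding K_def by linarith
        then have "\<rho> powr real K \<le> \<rho> powr (c1 * L - c2)" using \<rho> by (intro powr_mono') auto
        also have "\<dots> = \<rho> powr (- c2) * \<rho> powr (c1 * L)" by (simp add: powr_add[symmetric])
        also have "\<rho> powr (c1 * L) = h powr \<beta>"
          unfolding h\<beta> using \<rho> M l1 by (simp add: powr_def \<beta>_def)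
        also have "\<rho> powr (- c2) * h powr \<beta> \<le> C * h powr \<beta>" by (intro mult_right_mono) (auto simp: C_def)
        finally show ?thesis using \<rho> by (simp add: powr_realpow)
      qed
      have 6: "usable_level M1 M2 s h (h powr \<alpha>) i0 j0 (js + s * k)" if k: "k < K" for k
      proof -
        define j where "j = js + s * k"
        have "real k + 1 \<le> c1 * L - c2 + 1" using k unfolding K_def by linarith
        then have "real s * real k \<le> real s * (c1 * L - c2)" by (intro mult_left_mono) auto
        also have "\<dots> = (\<alpha> - \<alpha> ^ 3) * L - (\<alpha> * real s + 1) - 2 * real s"
          using s by (simp add: c1_def c2_def field_simps)
        finally have j: "real j \<le> \<alpha> * L - \<alpha> * real s - 2 * real s"
          using js(2) by (simp add: j_def algebra_simps)
        have "real js \<le> real j" by (simp add: j_def)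
        then have j3: "\<alpha> ^ 3 * L \<le> real j" using js(1) by linarith
        have "real j + 1 \<le> \<alpha> * L" using j s \<alpha> by (smt (verit) mult_nonneg_nonneg of_nat_1 of_nat_mono)
        then have jj0: "j < j0" unfolding j0_def by linarith
        have "3 \<le> (1 - \<alpha>) * L" using False \<alpha> unfolding L0_def by (simp add: field_simps not_less)
        then have "- L + real (Suc j) \<le> - 2" using \<open>real j + 1 \<le> \<alpha> * L\<close> by (simp add: algebra_simps)
        then have "real M1 powr (- L + real (Suc j)) \<le> real M1 powr (- 2)" using M1gt by (intro powr_mono) auto
        also have "\<dots> \<le> 1 / 4"
        proof -
          have "real M1 powr 2 = (real M1)\<^sup>2" using M by (simp add: powr_numeral)
          moreover have "(2::real)\<^sup>2 \<le> (real M1)\<^sup>2" using M by (intro power_mono) auto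
          ultimately show ?thesis by (simp add: powr_minus_divide divide_simps)
        qed
        finally have hj: "h * real M1 ^ Suc j \<le> 1 / 4" unfolding hL M1p powr_add[symmetric] .
        define x where "x = L - real j / \<alpha>"
        define I where "I = nat \<lfloor>x\<rfloor>"
        have "real j / \<alpha> \<le> (\<alpha> * L - \<alpha> * real s) / \<alpha>" using j \<alpha> s by (intro divide_right_mono) auto
        then have xs: "real s \<le> x" using \<alpha> by (simp add: x_def diff_divide_distrib)
        have I: "real I \<le> x" "x < real I + 1" unfolding I_def using xs by linarith+
        have sI: "s \<le> I" unfolding I_def using xs by linarith
        have "\<alpha>\<^sup>2 * L \<le> real j / \<alpha>" using j3 \<alpha> by (simp add: field_simps power3_eq_cube power2_eq_square)
        then have "x \<le> (1 - \<alpha>\<^sup>2) * L" by (simp add: x_def algebra_simps)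
        then have Ii0: "I \<le> i0" unfolding I_def i0_def by (intro nat_mono floor_mono)
        have e: "h powr \<alpha> * real M1 ^ j * real M2 ^ n = real M1 powr (\<alpha> * (real n - x))" for n
          unfolding HL M1p powr_add[symmetric] using \<alpha> by (intro arg_cong[of _ _ "(powr) _"]) (simp add: x_def field_simps)
        have "h powr \<alpha> * real M1 ^ j * real M2 ^ I \<le> 1"
          unfolding e using I \<alpha> by (intro le1) (simp add: mult_nonneg_nonpos)
        moreover have "1 < h powr \<alpha> * real M1 ^ j * real M2 ^ Suc I"
          unfolding e using I \<alpha> M1gt by (intro gr_one_powr) auto
        ultimately show ?thesis using jj0 hj sI Ii0 unfolding j_def by blast
      qed
      show ?thesis using 1 2 3 4 5 6 by blast
    qed
  qed
  then show ?thesis using \<beta> C by (intro exI[of _ \<beta>] conjI exI[of _ C] ballI) auto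
qed

section \<open>The uncertainty principle for carpets\<close>

text \<open>The enlargements of all earlier steps together stay below the current spacing.\<close>

lemma sum_scaled_geometric_le:
  fixes a :: real
  assumes "0 \<le> d" "d + 1 \<le> a" shows "(\<Sum>m=0..<l. d * a ^ m) \<le> a ^ l"
proof (induction l)
  case (Suc l)
  have "(\<Sum>m=0..<Suc l. d * a ^ m) \<le> a ^ l + d * a ^ l" using Suc by simp
  also have "\<dots> = (d + 1) * a ^ l" by (simp add: algebra_simps)
  also have "\<dots> \<le> a * a ^ l" using assms by (intro mult_right_mono) auto
  finally show ?case by simp
qed simp

lemma FT2_sum:
  assumes "\<And>b. b \<in> S \<Longrightarrow> test_fun (f b)"
  shows "(\<Sum>b\<in>S. FT2 h H (f b) p) = FT2 h H (\<lambda>q. \<Sum>b\<in>S. f b q) p"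
proof -
  have "integrable lborel (\<lambda>q. wave h H p q * f b q)" if "b \<in> S" for b
    by (intro test_fun_integrable test_fun_ee_mult assms that) (auto simp: borel_prod[symmetric])
  then show ?thesis unfolding FT2_def sum_distrib_left by (simp add: Bochner_Integration.integral_sum)
qed

text \<open>Consecutive spacings differ by the factor \<open>M1^s > M2^s = D\<close>, which keeps the sum of the earlier
  enlargements below the current spacing; \<open>M1^(js + s k) y\<close> modulo \<open>1\<close> starts with the digit of \<open>y\<close> at
  the level that is used in step \<open>k\<close>.\<close>

lemma Cantor_FUP_one_dim:
  fixes M1 M2 s i0 js K :: nat and g :: "real \<Rightarrow> complex" and d :: "nat \<Rightarrow> nat"
  assumes M: "M2 \<ge> 2" "M1 > M2" and s: "s \<ge> 1" and H: "H > 0"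
    and ND: "real (lattice_hits M2 s) / (4 * real (M2 ^ s)) \<le> (1 / (4 * real M1)) / 2"
    and small: "bump_wins (M2 ^ s) (lattice_hits M2 s) (1 / (4 * real M1))"
    and scale: "\<And>k. k < K \<Longrightarrow> \<exists>I. s \<le> I \<and> I \<le> i0 \<and> (H * real M1 ^ (js + s * k)) * real M2 ^ I \<le> 1 \<and>
          1 < (H * real M1 ^ (js + s * k)) * real M2 ^ Suc I"
    and e: "\<And>i. e i < M2" and g: "test_fun g"
    and supp: "\<And>k y z. k < K \<Longrightarrow> g y \<noteq> 0 \<Longrightarrow>
       1 / (4 * real M1) \<le> \<bar>real M1 ^ (js + s * k) * y - (real (d k) + 1 / 2) / real M1 - real_of_int z\<bar>"
  shows "mass_on (Cantor_nbhd M2 i0 e) (FT H g)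
     \<le> ennreal (step_gain (M2 ^ s) (lattice_hits M2 s) ^ K * H) * sqn g"
proof -
  define \<sigma> where "\<sigma> l = H * real M1 ^ (js + s * l)" for l
  define D where "D = M2 ^ s"
  have M0: "real M1 > 0" using M by simp
  have D1: "D \<ge> 1" using M by (simp add: D_def)
  have DM: "real D + 1 \<le> real M1 ^ s"
  proof -
    have "M2 ^ s < M1 ^ s" using M s by (intro power_strict_mono) auto
    then have "real (M2 ^ s + 1) \<le> real (M1 ^ s)" by (simp only: of_nat_le_iff)
    then show ?thesis by (simp add: D_def)
  qed
  have \<tau>: "(\<Sum>m=0..<l. real D * \<sigma> m) \<le> \<sigma> l" for l
  proof -
    have "(\<Sum>m=0..<l. real D * \<sigma> m) = H * real M1 ^ js * (\<Sum>m=0..<l. real D * (real M1 ^ s) ^ m)"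
      unfolding sum_distrib_left by (simp add: \<sigma>_def power_add mult_ac flip: power_mult)
    also have "\<dots> \<le> H * real M1 ^ js * (real M1 ^ s) ^ l"
      using H by (intro mult_left_mono sum_scaled_geometric_le DM) auto
    finally show ?thesis by (simp add: \<sigma>_def power_add power_mult mult.assoc)
  qed
  have "mass_on (Cantor_nbhd M2 i0 e) (FT H g)
     \<le> ennreal (step_gain D (lattice_hits M2 s) ^ (K - 0) * H) * sqn g"
  proof (rule FUP_iterate[where \<sigma>=\<sigma> and \<kappa>="1 / (4 * real M1)" and ctr="\<lambda>l. (real (d l) + 1 / 2) / real M1"])
    show "1 / (4 * real M1) \<le> \<bar>\<sigma> l * y / H - (real (d l) + 1 / 2) / real M1 - real_of_int z\<bar>"
      if "l < K" "g y \<noteq> 0" for l y z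
      using supp[OF that, of z] H by (simp add: \<sigma>_def)
    show "card (near_hits D (\<sigma> l) (Cantor_nbhd M2 i0 e) (\<Sum>m=0..<l. real D * \<sigma> m) \<eta>) \<le> lattice_hits M2 s"
      if l: "l < K" for l \<eta>
    proof -
      obtain I where "s \<le> I" "I \<le> i0" "\<sigma> l * real M2 ^ I \<le> 1" "1 < \<sigma> l * real M2 ^ Suc I"
        using scale[OF l] unfolding \<sigma>_def by blast
      then show ?thesis unfolding D_def using M e \<tau>[of l, unfolded D_def]
        by (intro Cantor_nbhd_lattice_count[of M2 e s I]) auto
    qed
    show "0 \<le> \<sigma> l" for l using H by (simp add: \<sigma>_def)
  qed (use H D1 ND small M0 g Cantor_nbhd_borel in \<open>auto simp: D_def\<close>)
  then show ?thesis by (simp add: D_def)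
qed

text \<open>The digits of \<open>x\<close> determine the strip \<open>b\<close> and, through the rows of \<open>A\<close>, the digits \<open>mA\<close> that \<open>y\<close> avoids; the
  digits of \<open>\<xi>\<close> determine the strip \<open>a\<close> and, through the columns of \<open>B\<close>, the digits \<open>mB\<close> that \<open>\<eta>\<close>
  avoids. Neighbouring strips overlap because of the enlargement by the box, so \<open>f\<close> is split
  into pieces with disjoint supports, each point going to the first strip that admits it.\<close>

lemma Cantor_FUP_at_scale:
  fixes M1 M2 s i0 j0 js K :: nat and f :: "real \<times> real \<Rightarrow> complex"
  assumes M: "M2 \<ge> 2" "M1 > M2" and s: "s \<ge> 1" and h: "h > 0"
    and alph: "is_alphabet M1 M2 A" "is_alphabet M1 M2 B"
    and nofull: "\<not> has_full_row M1 M2 A" "\<not> has_full_column M1 M2 B"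
    and ND: "real (lattice_hits M2 s) / (4 * real (M2 ^ s)) \<le> (1 / (4 * real M1)) / 2"
    and small: "bump_wins (M2 ^ s) (lattice_hits M2 s) (1 / (4 * real M1))"
    and sd: "scale_data M1 M2 s h (h powr \<alpha>) i0 j0 js K"
    and f: "test_fun f" and supp: "\<And>p. f p \<noteq> 0 \<Longrightarrow> p \<in> Ref ` (limit_Cantor_set M1 M2 A + ani_box \<alpha> h)"
  shows "mass_on (limit_Cantor_set M1 M2 B + ani_box \<alpha> h) (FT2 h (h powr \<alpha>) f)
     \<le> ennreal (320 * step_gain (M2 ^ s) (lattice_hits M2 s) ^ K * (h * h powr \<alpha>)) * sqn f"
proof -
  have i0: "h * real M1 ^ i0 \<le> 1" "h powr \<alpha> * real M2 ^ i0 \<le> 1" and j0: "h powr \<alpha> * real M2 ^ j0 \<le> 1"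
    and ij: "h * real M1 ^ i0 * real M2 ^ j0 \<le> 1"
    and scale: "\<And>k. k < K \<Longrightarrow> usable_level M1 M2 s h (h powr \<alpha>) i0 j0 (js + s * k)" using sd by blast+
  define H where "H = h powr \<alpha>"
  have H: "H > 0" using h by (simp add: H_def)
  have M0: "M1 \<ge> 2" "M1 > 0" "M2 > 0" using M by auto
  obtain mA where mA: "\<And>b. b < M2 \<Longrightarrow> mA b < M1 \<and> (mA b, b) \<notin> A"
    using nofull(1) unfolding has_full_row_def by (metis atLeastLessThan_iff le0)
  obtain mB where mB: "\<And>a. a < M1 \<Longrightarrow> mB a < M2 \<and> (a, mB a) \<notin> B"
    using nofull(2) unfolding has_full_column_def by (metis atLeastLessThan_iff le0)
  define sw where "sw = 1 / real M2 ^ j0"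
  define l where "l = 1 / real M1 ^ i0"
  define P where "P b = {y. \<forall>j<j0. h * real M1 ^ Suc j \<le> 1 / 4 \<longrightarrow> (\<forall>z::int.
      1 / (4 * real M1) \<le> \<bar>real M1 ^ j * y - (real (mA (word_digit M2 j0 b j)) + 1 / 2) / real M1 - real_of_int z\<bar>)}" for b
  define S where "S = {0..<int M2 ^ j0}"
  define As where "As = {0..<int M1 ^ i0}"
  define \<Omega> where "\<Omega> b = (strip sw b) \<times> P b" for b
  define e where "e a i = mB (word_digit M1 i0 a i)" for a i
  define Q where "Q a = Cantor_nbhd M2 i0 (e a)" for a
  have closedP: "closed (P b)" for b
  proof -
    have "P b = (\<Inter>j\<in>{j. j < j0 \<and> h * real M1 ^ Suc j \<le> 1 / 4}. \<Inter>z::int.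
      {y. 1 / (4 * real M1) \<le> \<bar>real M1 ^ j * y - (real (mA (word_digit M2 j0 b j)) + 1 / 2) / real M1 - real_of_int z\<bar>})"
      by (auto simp: P_def)
    also have "closed \<dots>" by (intro closed_INT ballI closed_Collect_le continuous_intros)
    finally show ?thesis .
  qed
  have \<Omega>m: "\<Omega> b \<in> sets borel" for b
    unfolding \<Omega>_def by (intro borel_closed closed_Times closedP closed_real_atLeastAtMost)
  have cover: "\<exists>b\<in>S. p \<in> \<Omega> b" if "f p \<noteq> 0" for p
  proof -
    obtain x y where p: "p = (x, y)" by (cases p)
    from supp[OF that] obtain X1 X2 u v where X: "(X1, X2) \<in> limit_Cantor_set M1 M2 A" "(u, v) \<in> ani_box \<alpha> h"
      and xy: "y = X1 + u" "x = X2 + v"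
      unfolding p by (auto simp: Ref_def set_plus_def)
    from X(1) obtain c where c: "\<And>j. c j \<in> A" and X12: "X1 = (\<Sum>j. real (fst (c j)) / real M1 ^ Suc j)"
      "X2 = (\<Sum>j. real (snd (c j)) / real M2 ^ Suc j)" unfolding limit_Cantor_set_def by auto
    have c1: "fst (c j) < M1" and c2: "snd (c j) < M2" for j
      using c[of j] alph(1) unfolding is_alphabet_def ZM_def by (auto simp: mem_Times_iff)
    have u: "\<bar>y - X1\<bar> \<le> h" and v: "\<bar>x - X2\<bar> \<le> H"
      using X(2) xy unfolding ani_box_def H_def by (auto simp: abs_le_iff)
    define k where "k = digit_prefix M2 (\<lambda>j. snd (c j)) j0"
    have kS: "int k \<in> S" using digit_prefix_less[of "\<lambda>j. snd (c j)" M2 j0] c2 unfolding S_def k_def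
      by (simp add: of_nat_less_iff[symmetric] del: of_nat_less_iff)
    note sb = strip_bounds[of M2 "\<lambda>j. snd (c j)" H j0 x, OF M(1) c2 j0[folded H_def] v[unfolded X12], folded k_def]
    have "y \<in> P (int k)" unfolding P_def
    proof (intro CollectI allI impI)
      fix j z assume j: "j < j0" "h * real M1 ^ Suc j \<le> 1 / 4"
      have wd: "word_digit M2 j0 (int k) j = snd (c j)" unfolding k_def by (rule word_digit_prefix[OF c2 j(1)])
      have "fst (c j) \<noteq> mA (snd (c j))" using mA[OF c2[of j]] c[of j] by (metis prod.collapse)
      then show "1 / (4 * real M1) \<le> \<bar>real M1 ^ j * y - (real (mA (word_digit M2 j0 (int k) j)) + 1 / 2) / real M1 - real_of_int z\<bar>"
        unfolding wd using mA[OF c2[of j]]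
        by (intro gap_avoided[of M1 "\<lambda>j. fst (c j)" h j y] M0 c1 j u[unfolded X12]) auto
    qed
    then have "p \<in> \<Omega> (int k)" using sb(1,2) unfolding \<Omega>_def p sw_def by simp
    then show ?thesis using kS by blast
  qed
  have coverY: "\<exists>a\<in>As. p \<in> (strip l a) \<times> Q a"
    if "p \<in> limit_Cantor_set M1 M2 B + ani_box \<alpha> h" for p
  proof -
    obtain \<xi> \<eta> where p: "p = (\<xi>, \<eta>)" by (cases p)
    from that obtain X1 X2 u v where X: "(X1, X2) \<in> limit_Cantor_set M1 M2 B" "(u, v) \<in> ani_box \<alpha> h"
      and xy: "\<xi> = X1 + u" "\<eta> = X2 + v"
      unfolding p by (auto simp: set_plus_def)
    from X(1) obtain c where c: "\<And>j. c j \<in> B" and X12: "X1 = (\<Sum>j. real (fst (c j)) / real M1 ^ Suc j)"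
      "X2 = (\<Sum>j. real (snd (c j)) / real M2 ^ Suc j)" unfolding limit_Cantor_set_def by auto
    have c1: "fst (c j) < M1" and c2: "snd (c j) < M2" for j
      using c[of j] alph(2) unfolding is_alphabet_def ZM_def by (auto simp: mem_Times_iff)
    have u: "\<bar>\<xi> - X1\<bar> \<le> h" and v: "\<bar>\<eta> - X2\<bar> \<le> H"
      using X(2) xy unfolding ani_box_def H_def by (auto simp: abs_le_iff)
    define a where "a = digit_prefix M1 (\<lambda>j. fst (c j)) i0"
    define k where "k = digit_prefix M2 (\<lambda>j. snd (c j)) i0"
    have aS: "int a \<in> As" using digit_prefix_less[of "\<lambda>j. fst (c j)" M1 i0] c1 unfolding As_def a_def
      by (simp add: of_nat_less_iff[symmetric] del: of_nat_less_iff)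
    have k: "0 \<le> int k" "int k < int M2 ^ i0" using digit_prefix_less[of "\<lambda>j. snd (c j)" M2 i0] c2 unfolding k_def
      by (simp_all add: of_nat_less_iff[symmetric] del: of_nat_less_iff)
    note sb1 = strip_bounds[of M1 "\<lambda>j. fst (c j)" h i0 \<xi>, OF M0(1) c1 i0(1) u[unfolded X12], folded a_def]
    note sb2 = strip_bounds[of M2 "\<lambda>j. snd (c j)" H i0 \<eta>, OF M(1) c2 i0(2)[folded H_def] v[unfolded X12], folded k_def]
    have "digits_avoid M2 i0 (e (int a)) (int k)" unfolding digits_avoid_def
    proof (intro allI impI)
      fix i assume i: "i < i0"
      have wd: "word_digit M1 i0 (int a) i = fst (c i)" unfolding a_def by (rule word_digit_prefix[OF c1 i])
      have "snd (c i) \<noteq> mB (fst (c i))" using mB[OF c1[of i]] c[of i] by (metis prod.collapse)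
      moreover have "(int k div int M2 ^ (i0 - 1 - i)) mod int M2 = int (snd (c i))"
        unfolding k_def digit_prefix_digit[of "\<lambda>j. snd (c j)" M2, OF c2 i, symmetric] by (simp add: zdiv_int zmod_int)
      ultimately show "(int k div int M2 ^ (i0 - 1 - i)) mod int M2 \<noteq> int (e (int a) i)"
        unfolding e_def wd by simp
    qed
    then have "\<eta> \<in> Q (int a)" unfolding Q_def Cantor_nbhd_def using k sb2(3)
      by (intro UN_I[of "int k"]) (auto simp: dist_real_def abs_minus_commute)
    then have "p \<in> (strip l (int a)) \<times> Q (int a)"
      using sb1(1,2) unfolding p l_def by simp
    then show ?thesis using aS by blast
  qed
  define \<Omega>' where "\<Omega>' b = \<Omega> b - (\<Union>b'\<in>{0..<b}. \<Omega> b')" for b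
  have \<Omega>'m [measurable]: "\<Omega>' b \<in> sets borel" for b
    unfolding \<Omega>'_def by (intro sets.Diff sets.finite_UN \<Omega>m) auto
  define fb where "fb b p = indicator (\<Omega>' b) p * f p" for b p
  have fb: "test_fun (fb b)" for b
    unfolding fb_def by (rule test_fun_mult[OF f, where C=1]) (auto simp: indicator_def)
  have finS: "finite S" by (simp add: S_def)
  define b0 where "b0 p = Min {b \<in> S. p \<in> \<Omega> b}" for p
  have fb_eq: "fb b p = (if b = b0 p then f p else 0)" if b: "b \<in> S" for b p
  proof (cases "f p = 0")
    case False
    have ne: "{b \<in> S. p \<in> \<Omega> b} \<noteq> {}" using cover[OF False] by auto
    have fin: "finite {b \<in> S. p \<in> \<Omega> b}" using finS by simp
    have b0: "b0 p \<in> S" "p \<in> \<Omega> (b0 p)" using Min_in[OF fin ne] unfolding b0_def by auto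
    have min: "b0 p \<le> b'" if "b' \<in> S" "p \<in> \<Omega> b'" for b' using Min_le[OF fin] that unfolding b0_def by auto
    have "p \<in> \<Omega>' b \<longleftrightarrow> b = b0 p"
    proof
      assume p: "p \<in> \<Omega>' b"
      then have "b0 p \<le> b" using min[OF b] by (auto simp: \<Omega>'_def)
      moreover have "\<not> b0 p < b" using p b0 by (auto simp: \<Omega>'_def S_def)
      ultimately show "b = b0 p" by simp
    next
      assume eq: "b = b0 p"
      have "p \<notin> \<Omega> b'" if "b' \<in> {0..<b}" for b'
        using min[of b'] that b eq by (auto simp: S_def)
      then show "p \<in> \<Omega>' b" using b0 eq by (auto simp: \<Omega>'_def)
    qed
    then show ?thesis by (auto simp: fb_def indicator_def)
  qed (simp add: fb_def)
  have b0S: "b0 p \<in> S" if "f p \<noteq> 0" for p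
  proof -
    have ne: "{b \<in> S. p \<in> \<Omega> b} \<noteq> {}" using cover[OF that] by auto
    have fin: "finite {b \<in> S. p \<in> \<Omega> b}" using finS by simp
    show ?thesis using Min_in[OF fin ne] unfolding b0_def by auto
  qed
  have sum_fb: "(\<Sum>b\<in>S. fb b p) = f p" for p
    using b0S[of p] finS by (cases "f p = 0") (auto simp: fb_eq cong: sum.cong)
  have sum_sqn: "(\<Sum>b\<in>S. sqn (fb b)) = sqn f"
  proof -
    have m: "(\<lambda>p. esq (fb b p)) \<in> borel_measurable lborel" for b
      using test_fun_measurable[OF fb] by simp
    have "(\<Sum>b\<in>S. sqn (fb b)) = (\<integral>\<^sup>+p. (\<Sum>b\<in>S. esq (fb b p)) \<partial>lborel)"
      by (rule nn_integral_sum[symmetric]) (rule m)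
    also have "\<dots> = sqn f"
    proof (rule nn_integral_cong)
      fix p
      have "(\<Sum>b\<in>S. esq (fb b p)) = (\<Sum>b\<in>S. if b = b0 p then esq (f p) else 0)"
        by (intro sum.cong refl) (simp add: fb_eq)
      then show "(\<Sum>b\<in>S. esq (fb b p)) = esq (f p)"
        using b0S[of p] finS by (cases "f p = 0") auto
    qed
    finally show ?thesis .
  qed
  let ?\<rho> = "step_gain (M2 ^ s) (lattice_hits M2 s)"
  have glue: "(\<Sum>a\<in>As. \<integral>\<^sup>+p. esq (\<Sum>b\<in>S. FT2 h H (fb b) p) *
            indicator ((strip l a) \<times> Q a) p \<partial>lborel)
     \<le> ennreal (320 * ?\<rho> ^ K * (h * H)) * (\<Sum>b\<in>S. sqn (fb b))"
  proof (rule FUP_glue_strips[where sw=sw])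
    show "h / (16 * l) \<le> sw"
    proof -
      have "h * real M1 ^ i0 \<le> 1 / real M2 ^ j0" using ij M0 by (simp add: field_simps)
      moreover have "0 \<le> h * real M1 ^ i0" using h by simp
      ultimately show ?thesis unfolding l_def sw_def by simp
    qed
    show "sw * (of_int b - 1) \<le> x \<and> x \<le> sw * (of_int b + 2)" if "fb b (x, y) \<noteq> 0" for b x y
      using that by (auto simp: fb_def \<Omega>'_def \<Omega>_def indicator_def split: if_splits)
    show "Q a \<in> sets borel" for a unfolding Q_def by (rule Cantor_nbhd_borel)
    fix a b g assume g: "test_fun g" "\<And>y. g y \<noteq> 0 \<Longrightarrow> \<exists>x. fb b (x, y) \<noteq> 0"
    have gP: "y \<in> P b" if "g y \<noteq> 0" for y
      using g(2)[OF that] by (auto simp: fb_def \<Omega>'_def \<Omega>_def indicator_def split: if_splits)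
    show "mass_on (Q a) (FT H g) \<le> ennreal (?\<rho> ^ K * H) * sqn g"
      unfolding Q_def
    proof (rule Cantor_FUP_one_dim[OF M s H ND small _ _ g(1)])
      show "\<exists>I\<ge>s. I \<le> i0 \<and> H * real M1 ^ (js + s * k) * real M2 ^ I \<le> 1 \<and> 1 < H * real M1 ^ (js + s * k) * real M2 ^ Suc I"
        if "k < K" for k using scale[OF that] unfolding H_def by blast
      show "e a i < M2" for i unfolding e_def using mB[OF word_digit_less[OF M0(2)]] by blast
      show "1 / (4 * real M1) \<le> \<bar>real M1 ^ (js + s * k) * y - (real (mA (word_digit M2 j0 b (js + s * k))) + 1 / 2) / real M1 - real_of_int z\<bar>"
        if "k < K" "g y \<noteq> 0" for k y z
        using gP[OF that(2)] scale[OF that(1)] unfolding P_def by blast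
    qed
  qed (use fb finS h H M0 step_gain_bounds(1)[of "M2 ^ s" "lattice_hits M2 s"] in \<open>auto simp: As_def l_def\<close>)
  have "mass_on (limit_Cantor_set M1 M2 B + ani_box \<alpha> h) (FT2 h H f)
    \<le> (\<integral>\<^sup>+p. (\<Sum>a\<in>As. esq (FT2 h H f p) * indicator ((strip l a) \<times> Q a) p) \<partial>lborel)"
  proof (rule nn_integral_mono)
    fix p
    show "esq (FT2 h H f p) * indicator (limit_Cantor_set M1 M2 B + ani_box \<alpha> h) p
      \<le> (\<Sum>a\<in>As. esq (FT2 h H f p) * indicator ((strip l a) \<times> Q a) p)"
    proof (cases "p \<in> limit_Cantor_set M1 M2 B + ani_box \<alpha> h")
      case True
      then obtain a where a: "a \<in> As" "p \<in> (strip l a) \<times> Q a"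
        using coverY by blast
      have "esq (FT2 h H f p) * indicator (limit_Cantor_set M1 M2 B + ani_box \<alpha> h) p
         = esq (FT2 h H f p) * indicator ((strip l a) \<times> Q a) p"
        using True a by (simp only: indicator_simps)
      also have "\<dots> \<le> (\<Sum>a\<in>As. esq (FT2 h H f p) * indicator ((strip l a) \<times> Q a) p)"
        by (rule member_le_sum[OF a(1)]) (auto simp: As_def)
      finally show ?thesis .
    qed simp
  qed
  also have "\<dots> = (\<Sum>a\<in>As. \<integral>\<^sup>+p. esq (FT2 h H f p) * indicator ((strip l a) \<times> Q a) p \<partial>lborel)"
  proof (rule nn_integral_sum)
    fix a
    have [measurable]: "FT2 h H f \<in> borel_measurable borel" by (rule FT2_measurable[OF test_fun_measurable[OF f]])
    have [measurable]: "(strip l a) \<times> Q a \<in> sets borel"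
      unfolding borel_prod[symmetric] Q_def using Cantor_nbhd_borel by auto
    show "(\<lambda>p. esq (FT2 h H f p) * indicator ((strip l a) \<times> Q a) p) \<in> borel_measurable lborel"
      by measurable
  qed
  also have "\<dots> = (\<Sum>a\<in>As. \<integral>\<^sup>+p. esq (\<Sum>b\<in>S. FT2 h H (fb b) p) * indicator ((strip l a) \<times> Q a) p \<partial>lborel)"
    unfolding FT2_sum[OF fb] sum_fb ..
  also note glue
  finally show ?thesis unfolding sum_sqn H_def .
qed

text \<open>The truncations of a square-integrable function on a compact set are test functions. Their transforms
  converge pointwise by dominated convergence, and Fatou's lemma carries the bound to the limit.\<close>

lemma L2_bound_by_truncation:
  fixes f :: "real \<times> real \<Rightarrow> complex"
  assumes E: "compact E" and Y: "Y \<in> sets borel" and f: "f \<in> L2"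
    and bound: "\<And>g. test_fun g \<Longrightarrow> (\<And>p. g p \<noteq> 0 \<Longrightarrow> p \<in> E) \<Longrightarrow>
      mass_on Y (FT2 h H g) \<le> ennreal B * sqn g"
  shows "mass_on Y (FT2 h H (ind_mult E f)) \<le> ennreal B * sqn f"
proof -
  have [measurable]: "f \<in> borel_measurable borel" and f2: "integrable lborel (\<lambda>p. (norm (f p))\<^sup>2)"
    using f by (auto simp: L2_def)
  have [measurable]: "E \<in> sets borel" using E by (intro borel_closed compact_imp_closed)
  have [measurable]: "Y \<in> sets borel" by fact
  define g where "g = ind_mult E f"
  have gE: "g p = (if p \<in> E then f p else 0)" for p by (simp add: g_def ind_mult_def)
  have [measurable]: "g \<in> borel_measurable borel" unfolding g_def ind_mult_def by measurable
  define gn where "gn n p = (if norm (g p) \<le> real n then g p else 0)" for n :: nat and p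
  have gn_m [measurable]: "gn n \<in> borel_measurable borel" for n unfolding gn_def by measurable
  have gn_le: "norm (gn n p) \<le> norm (g p)" for n p by (simp add: gn_def)
  have tgn: "test_fun (gn n)" for n
  proof -
    obtain R where R: "\<And>p. p \<in> E \<Longrightarrow> norm p \<le> R"
      using compact_imp_bounded[OF E] unfolding bounded_iff by blast
    show ?thesis
    proof (rule test_funI[where B="real n" and R=R])
      show "gn n p = 0" if "R < norm p" for p using R[of p] that by (auto simp: gn_def gE)
    qed (auto simp: gn_def gn_m[unfolded gn_def])
  qed
  have ig: "integrable lborel g"
  proof (rule Bochner_Integration.integrable_bound)
    have "integrable lborel (indicator E :: _ \<Rightarrow> real)"
      using emeasure_bounded_finite[OF compact_imp_bounded[OF E]] by (intro integrable_real_indicator) auto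
    then show "integrable lborel (\<lambda>p. indicator E p + (norm (f p))\<^sup>2)" using f2 by (rule Bochner_Integration.integrable_add)
    have "t \<le> 1 + t\<^sup>2" for t :: real using zero_le_power2[of "t - 1 / 2"] by (simp add: power2_eq_square algebra_simps)
    then show "AE p in lborel. norm (g p) \<le> norm (indicator E p + (norm (f p))\<^sup>2)"
      by (intro AE_I2) (auto simp: gE indicator_def)
  qed simp
  have conv: "(\<lambda>n. FT2 h H (gn n) p) \<longlonglongrightarrow> FT2 h H g p" for p
    unfolding FT2_def
  proof (rule integral_dominated_convergence[where w="\<lambda>q. norm (g q)"])
    show "integrable lborel (\<lambda>q. norm (g q))" using ig by simp
    have m: "(\<lambda>q. wave h H p q) \<in> borel_measurable borel"
      by (auto simp: borel_prod[symmetric])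
    show "(\<lambda>q. wave h H p q * g q) \<in> borel_measurable lborel"
      using m by measurable
    show "(\<lambda>q. wave h H p q * gn n q) \<in> borel_measurable lborel" for n
      using m by measurable
    show "AE q in lborel. (\<lambda>n. wave h H p q * gn n q) \<longlonglongrightarrow> wave h H p q * g q"
    proof (intro AE_I2 tendsto_mult tendsto_const)
      fix q
      obtain n0 :: nat where n0: "norm (g q) \<le> real n0" using real_arch_simple by blast
      have "\<forall>\<^sub>F n in sequentially. gn n q = g q"
        using eventually_ge_at_top[of n0] by eventually_elim (use n0 in \<open>auto simp: gn_def\<close>)
      then show "(\<lambda>n. gn n q) \<longlonglongrightarrow> g q" by (rule tendsto_eventually)
    qed
    show "AE q in lborel. norm (wave h H p q * gn n q) \<le> norm (g q)" for n
      using gn_le by (simp add: norm_mult)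
  qed
  have "mass_on Y (FT2 h H g)
     = (\<integral>\<^sup>+p. liminf (\<lambda>n. esq (FT2 h H (gn n) p) * indicator Y p) \<partial>lborel)"
  proof (rule nn_integral_cong)
    fix p
    have "(\<lambda>n. ennreal ((norm (FT2 h H (gn n) p))\<^sup>2 * indicator Y p)) \<longlonglongrightarrow> ennreal ((norm (FT2 h H g p))\<^sup>2 * indicator Y p)"
      by (intro tendsto_intros conv)
    then have "liminf (\<lambda>n. ennreal ((norm (FT2 h H (gn n) p))\<^sup>2 * indicator Y p)) = ennreal ((norm (FT2 h H g p))\<^sup>2 * indicator Y p)"
      by (intro lim_imp_Liminf) auto
    then show "esq (FT2 h H g p) * indicator Y p = liminf (\<lambda>n. esq (FT2 h H (gn n) p) * indicator Y p)"
      by (simp add: ennreal_mult ennreal_indicator)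
  qed
  also have "\<dots> \<le> liminf (\<lambda>n. \<integral>\<^sup>+p. esq (FT2 h H (gn n) p) * indicator Y p \<partial>lborel)"
    by (rule nn_integral_liminf) measurable
  also have "\<dots> \<le> ennreal B * sqn f"
  proof (rule Liminf_le[OF sequentially_bot always_eventually], rule allI)
    fix n
    have "mass_on Y (FT2 h H (gn n)) \<le> ennreal B * sqn (gn n)"
      by (rule bound[OF tgn]) (auto simp: gn_def gE split: if_splits)
    also have "\<dots> \<le> ennreal B * sqn f"
      by (intro mult_left_mono nn_integral_mono ennreal_leI power_mono) (auto simp: gn_def gE)
    finally show "mass_on Y (FT2 h H (gn n)) \<le> ennreal B * sqn f" .
  qed
  finally show ?thesis unfolding g_def .
qed

lemma ani_fourier_eq_FT2:
  "ani_fourier \<alpha> h f p = of_real (1 / h powr ((1 + \<alpha>) / 2)) * FT2 h (h powr \<alpha>) f p"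
proof -
  have e: "exp (- 2 * of_real pi * \<i> * of_real t) = ee (- t)" for t
    by (simp add: ee_def cis_conv_exp mult_ac)
  obtain \<xi> \<eta> where p: "p = (\<xi>, \<eta>)" by (cases p)
  show ?thesis
    unfolding ani_fourier_def FT2_def p prod.case e by (simp only: case_prod_unfold fst_conv snd_conv prod.collapse)
qed

lemma L2_opnorm_leI:
  assumes "0 \<le> c" "\<And>f. f \<in> L2 \<Longrightarrow> T f \<in> borel_measurable borel"
    and le: "\<And>f. f \<in> L2 \<Longrightarrow> (\<integral>\<^sup>+p. esq (T f p) \<partial>lborel) \<le> ennreal (c\<^sup>2) * sqn f"
  shows "L2_opnorm T \<le> ennreal c"
  unfolding L2_opnorm_def
proof (rule Inf_lower, rule CollectI, rule exI[of _ c], intro conjI refl ballI)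
  fix f assume f: "f \<in> L2"
  have m: "T f \<in> borel_measurable borel" by (rule assms(2)[OF f])
  have f2: "integrable lborel (\<lambda>p. (norm (f p))\<^sup>2)" using f by (simp add: L2_def)
  have sf: "sqn f = ennreal (LINT p|lborel. (norm (f p))\<^sup>2)" by (rule nn_integral_eq_integral[OF f2]) simp
  have b: "(\<integral>\<^sup>+p. esq (T f p) \<partial>lborel) \<le> ennreal (c\<^sup>2 * (LINT p|lborel. (norm (f p))\<^sup>2))"
    using le[OF f] unfolding sf by (simp add: ennreal_mult)
  have i: "integrable lborel (\<lambda>p. (norm (T f p))\<^sup>2)"
    by (rule integrableI_bounded) (use m b in \<open>auto intro: le_less_trans\<close>)
  show "T f \<in> L2" using m i by (simp add: L2_def)
  have "ennreal (LINT p|lborel. (norm (T f p))\<^sup>2) \<le> ennreal (c\<^sup>2 * (LINT p|lborel. (norm (f p))\<^sup>2))"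
    using b nn_integral_eq_integral[OF i] by simp
  then have "(LINT p|lborel. (norm (T f p))\<^sup>2) \<le> c\<^sup>2 * (LINT p|lborel. (norm (f p))\<^sup>2)"
    by (subst (asm) ennreal_le_iff) auto
  then have "sqrt (LINT p|lborel. (norm (T f p))\<^sup>2) \<le> sqrt (c\<^sup>2 * (LINT p|lborel. (norm (f p))\<^sup>2))"
    by (rule real_sqrt_le_mono)
  then show "L2_norm (T f) \<le> c * L2_norm f"
    using assms(1) by (simp add: L2_norm_def real_sqrt_mult)
qed (rule assms(1))

theorem theorem1p6:
  fixes M1 M2 :: nat and A B :: "(nat \<times> nat) set"
    and \<alpha> :: real and X Y :: "(real \<times> real) set"
  assumes "M2 \<ge> 2" and "M1 > M2"
    and "is_alphabet M1 M2 A" and "is_alphabet M1 M2 B"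
    and "\<not> has_full_row M1 M2 A" and "\<not> has_full_column M1 M2 B"
  defines "\<alpha> \<equiv> ani_exponent M1 M2"
    and "X \<equiv> limit_Cantor_set M1 M2 A" and "Y \<equiv> limit_Cantor_set M1 M2 B"
  shows "\<exists>\<beta>>0. \<exists>C>0. \<forall>h\<in>{0<..<1::real}.
           L2_opnorm (\<lambda>f. ind_mult (Y + ani_box \<alpha> h)
              (ani_fourier \<alpha> h (ind_mult (Ref ` (X + ani_box \<alpha> h)) f)))
           \<le> ennreal (C * h powr \<beta>)"
proof -
  have M: "M1 \<ge> 2" "M2 \<ge> 2" using assms(1,2) by auto
  define \<kappa> where "\<kappa> = 1 / (4 * real M1)"
  have \<kappa>: "0 < \<kappa>" "\<kappa> < 1" using M by (auto simp: \<kappa>_def)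
  obtain s where s: "s \<ge> 1" "real (lattice_hits M2 s) / (4 * real (M2 ^ s)) \<le> \<kappa> / 2"
    "bump_wins (M2 ^ s) (lattice_hits M2 s) \<kappa>"
    using block_length_exists[OF M(2) \<kappa>] by blast
  define \<rho> where "\<rho> = step_gain (M2 ^ s) (lattice_hits M2 s)"
  have \<rho>: "0 < \<rho>" "\<rho> < 1" using step_gain_bounds unfolding \<rho>_def by auto
  obtain \<beta> C where \<beta>: "\<beta> > 0" and C: "C > 0" and scales: "\<forall>h\<in>{0<..<1::real}. \<exists>i0 j0 js K :: nat.
     scale_data M1 M2 s h (h powr \<alpha>) i0 j0 js K \<and> \<rho> ^ K \<le> C * h powr \<beta>"
    using scale_exponents[OF assms(1,2) s(1) \<rho>] unfolding \<alpha>_def ani_exponent_def by blast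
  have fin: "finite A" "finite B"
    using assms(3,4) unfolding is_alphabet_def ZM_def by (auto intro: finite_subset)
  have "L2_opnorm (\<lambda>f. ind_mult (Y + ani_box \<alpha> h) (ani_fourier \<alpha> h (ind_mult (Ref ` (X + ani_box \<alpha> h)) f)))
      \<le> ennreal (sqrt (320 * C) * h powr (\<beta> / 2))" if h: "h \<in> {0<..<1}" for h
  proof (rule L2_opnorm_leI)
    have h0: "h > 0" using h by simp
    obtain i0 j0 js K where K: "scale_data M1 M2 s h (h powr \<alpha>) i0 j0 js K" "\<rho> ^ K \<le> C * h powr \<beta>"
      using scales h by meson
    define E where "E = Ref ` (X + ani_box \<alpha> h)"
    define W where "W = Y + ani_box \<alpha> h"
    have cE: "compact E" unfolding E_def X_def
    proof (rule compact_continuous_image)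
      show "continuous_on (limit_Cantor_set M1 M2 A + ani_box \<alpha> h) Ref"
        unfolding Ref_def by (intro continuous_intros)
    qed (rule compact_Cantor_plus_box[OF M fin(1)])
    have mW: "W \<in> sets borel"
      unfolding W_def Y_def using compact_Cantor_plus_box[OF M fin(2)] by (intro borel_closed compact_imp_closed)
    have mE: "E \<in> sets borel" using cE by (intro borel_closed compact_imp_closed)
    define c where "c = 1 / h powr ((1 + \<alpha>) / 2)"
    have c2: "c\<^sup>2 * (h * h powr \<alpha>) = 1"
    proof -
      have "(h powr ((1 + \<alpha>) / 2))\<^sup>2 = h powr (1 + \<alpha>)"
        using h0 by (simp add: power2_eq_square powr_add[symmetric])
      also have "\<dots> = h * h powr \<alpha>" using h0 by (simp add: powr_add)
      finally show ?thesis using h0 by (simp add: c_def power_divide)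
    qed
    show "0 \<le> sqrt (320 * C) * h powr (\<beta> / 2)" using C by simp
    fix f assume f: "f \<in> L2"
    have [measurable]: "f \<in> borel_measurable borel" using f by (simp add: L2_def)
    have T: "ind_mult W (ani_fourier \<alpha> h (ind_mult E f)) p = indicator W p * (of_real c * FT2 h (h powr \<alpha>) (ind_mult E f) p)" for p
      by (simp add: ind_mult_def ani_fourier_eq_FT2 c_def)
    have [measurable]: "W \<in> sets borel" "E \<in> sets borel" by fact+
    have gm: "FT2 h (h powr \<alpha>) (ind_mult E f) \<in> borel_measurable borel"
      by (rule FT2_measurable) (unfold ind_mult_def, measurable)
    show "ind_mult (Y + ani_box \<alpha> h) (ani_fourier \<alpha> h (ind_mult (Ref ` (X + ani_box \<alpha> h)) f)) \<in> borel_measurable borel"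
      unfolding E_def[symmetric] W_def[symmetric] T[abs_def] using gm by measurable
    have "(\<integral>\<^sup>+p. esq (ind_mult W (ani_fourier \<alpha> h (ind_mult E f)) p) \<partial>lborel)
       = (\<integral>\<^sup>+p. ennreal (c\<^sup>2) * (esq (FT2 h (h powr \<alpha>) (ind_mult E f) p) * indicator W p) \<partial>lborel)"
      by (intro nn_integral_cong)
         (auto simp: T norm_mult power_mult_distrib ennreal_mult indicator_def)
    also have "\<dots> = ennreal (c\<^sup>2) * mass_on W (FT2 h (h powr \<alpha>) (ind_mult E f))"
      by (rule nn_integral_cmult) (use gm in measurable)
    also have "\<dots> \<le> ennreal (c\<^sup>2) * (ennreal (320 * \<rho> ^ K * (h * h powr \<alpha>)) * sqn f)"
    proof (intro mult_left_mono L2_bound_by_truncation[OF cE mW f])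
      fix g :: "real \<times> real \<Rightarrow> complex" assume g: "test_fun g" "\<And>p. g p \<noteq> 0 \<Longrightarrow> p \<in> E"
      show "mass_on W (FT2 h (h powr \<alpha>) g)
        \<le> ennreal (320 * \<rho> ^ K * (h * h powr \<alpha>)) * sqn g"
        unfolding W_def Y_def \<rho>_def
        by (rule Cantor_FUP_at_scale[OF assms(1,2) s(1) h0 assms(3-6) s(2,3)[unfolded \<kappa>_def] K(1) g(1) g(2)[unfolded E_def X_def]])
    qed simp
    also have "\<dots> = ennreal (320 * \<rho> ^ K) * sqn f"
    proof -
      have "ennreal (c\<^sup>2) * ennreal (320 * \<rho> ^ K * (h * h powr \<alpha>)) = ennreal (320 * \<rho> ^ K * (c\<^sup>2 * (h * h powr \<alpha>)))"
        by (subst ennreal_mult'[symmetric]) (auto simp: mult_ac)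
      then show ?thesis unfolding c2 by (simp add: mult.assoc[symmetric])
    qed
    also have "\<dots> \<le> ennreal ((sqrt (320 * C) * h powr (\<beta> / 2))\<^sup>2) * sqn f"
    proof (intro mult_right_mono ennreal_leI)
      have "(h powr (\<beta> / 2))\<^sup>2 = h powr \<beta>" using h0 by (simp add: power2_eq_square powr_add[symmetric])
      then show "320 * \<rho> ^ K \<le> (sqrt (320 * C) * h powr (\<beta> / 2))\<^sup>2"
        using K(2) C by (simp add: power_mult_distrib)
    qed simp
    finally show "(\<integral>\<^sup>+p. esq (ind_mult (Y + ani_box \<alpha> h) (ani_fourier \<alpha> h (ind_mult (Ref ` (X + ani_box \<alpha> h)) f)) p) \<partial>lborel)
      \<le> ennreal ((sqrt (320 * C) * h powr (\<beta> / 2))\<^sup>2) * sqn f"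
      unfolding E_def W_def .
  qed
  then show ?thesis
    using \<beta> C by (intro exI[of _ "\<beta> / 2"] conjI exI[of _ "sqrt (320 * C)"] ballI) auto
qed

end
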